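(* Let $n\ge1$, $0<T_0<T_1<\dots<T_{n-1}$, $P>0$ with $T_{i-1}+P<T_i$ for $1\le i\le n-1$, and $0<B_{\mathrm{low}}<B_{\mathrm{up}}$. Consider the contract paying $\prod_{i=1}^n C_i$ at time $T_{n-1}+P$, where $C_i:=\mathbf{1}_{\{B_{\mathrm{low}}<S_u<B_{\mathrm{up}}\ \forall u\in[T_{i-1},T_{i-1}+P]\}}$. Let $V(S,t)$ denote its value function, i.e. $e^{-r(T_{n-1}+P-t)}\mathbb{E}[\prod_{i=1}^nC_i\mid\mathcal{F}_t]=V(S_t,t)$ on the event that $B_{\mathrm{low}}<S_u<B_{\mathrm{up}}$ for all $u\in[0,t]\cap\bigcup_{i=0}^{n-1}[T_i,T_i+P]$. Then $V(S,t)=e^{\alpha x+\beta\tau}U(x,\tau)$ with $x=\log(S/B_{\mathrm{low}})$, $\tau=\tfrac12\sigma^2(T_{n-1}+P-t)$, where: (i) for $0\le j<n$, $\tau_{n-j}\le\tau\le\tau_{n-j}+p$ and $0<x<L$, \[ U(x,\tau)=\underbrace{\int_{-\infty}^{\infty}\!\!\cdots\!\int_{-\infty}^{\infty}}_{j}\underbrace{\int_0^L\!\!\cdots\!\int_0^L}_{j+1}\sum_{k_1=0}^\infty\cdots\sum_{k_{j+1}=0}^\infty g_j(k_1,\dots,k_{j+1};x_1,\dots,x_{j+1};y_1,\dots,y_j;x,\tau)\,dx_1\cdots dx_{j+1}\,dy_1\cdots dy_j; \] (ii) for $0\le j<n$, $\tau_{n-j}+p<\tau<\tau_{n-(j+1)}$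 (with $\tau_0:=\infty$) and $x\in\mathbb{R}$, \[ U(x,\tau)=\underbrace{\int_{-\infty}^{\infty}\!\!\cdots\!\int_{-\infty}^{\infty}}_{j+1}\underbrace{\int_0^L\!\!\cdots\!\int_0^L}_{j+1}\sum_{k_1=0}^\infty\cdots\sum_{k_{j+1}=0}^\infty h_j(k_1,\dots,k_{j+1};x_1,\dots,x_{j+1};y_1,\dots,y_{j+1};x,\tau)\,dx_1\cdots dx_{j+1}\,dy_1\cdots dy_{j+1}. \]
   Context: Black–Scholes model under the pricing measure: $dS_t/S_t=r\,dt+\sigma\,dW_t$, $r>0$, $\sigma>0$, $W$ a standard Brownian motion with filtration $(\mathcal{F}_t)$; $\mathbb{E}$ is expectation under this measure. Notation: $L:=\log(B_{\mathrm{up}}/B_{\mathrm{low}})$, $p:=\tfrac12\sigma^2P$, $\alpha:=-\tfrac12(\tfrac{2r}{\sigma^2}-1)$, $\beta:=-\tfrac{2r}{\sigma^2}-\alpha^2$, and $\tau_i:=\tfrac12\sigma^2(T_{n-1}-T_{i-1})$ for $i=1,\dots,n$ (so $\tau_n=0$ and the barrier period $[T_{i-1},T_{i-1}+P]$ corresponds to $\tau\in[\tau_i,\tau_i+p]$). Auxiliary functions are defined recursively: $g_0(k_1;x_1;\,;x,\tau):=\tfrac2L e^{-\alpha x_1}\sin\tfrac{k_1\pi x_1}{L}\sin\tfrac{k_1\pi x}{L}e^{-(k_1\pi/L)^2\tau}$; for $j\ge0$, $h_j(k_1,\dots,k_{j+1};x_1,\dots,x_{j+1};y_1,\dots,y_{j+1};x,\tau):=\tfrac1{\sqrt{2\pi}}e^{-y_{j+1}^2/2}\,\mathbf{1}_{[-x/\sqrt{2(\tau-(\tau_{n-j}+p))},\,(L-x)/\sqrt{2(\tau-(\tau_{n-j}+p))}]}(y_{j+1})\cdot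 g_j\big(k_1,\dots,k_{j+1};x_1,\dots,x_{j+1};y_1,\dots,y_j;\,x+y_{j+1}\sqrt{2(\tau-(\tau_{n-j}+p))},\,\tau_{n-j}+p\big)$; for $j\ge1$, $g_j(k_1,\dots,k_{j+1};x_1,\dots,x_{j+1};y_1,\dots,y_j;x,\tau):=\tfrac2L\sin\tfrac{k_{j+1}\pi x_{j+1}}{L}\sin\tfrac{k_{j+1}\pi x}{L}e^{-(k_{j+1}\pi/L)^2(\tau-\tau_{n-j})}\cdot h_{j-1}(k_1,\dots,k_j;x_1,\dots,x_j;y_1,\dots,y_j;x_{j+1},\tau_{n-j})$.
   Formalization: In (i) the left endpoint τ = τ_{n-j} is excluded (the range is τ_{n-j} < τ ≤ τ_{n-j}+p), because there the series in k_{j+1} has no exponential damping and diverges for almost every x_{j+1}, so the formula is undefined. *)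

theory Defs
  imports "HOL-Probability.Probability"
begin

definition std_BM :: "'a measure \<Rightarrow> (real \<Rightarrow> 'a measure) \<Rightarrow> (real \<Rightarrow> 'a \<Rightarrow> real) \<Rightarrow> bool" where
  "std_BM M F W \<longleftrightarrow> prob_space M \<and>
     (\<forall>t\<ge>0. subalgebra M (F t)) \<and>
     (\<forall>s t. 0 \<le> s \<longrightarrow> s \<le> t \<longrightarrow> sets (F s) \<subseteq> sets (F t)) \<and>
     (\<forall>t\<ge>0. W t \<in> borel_measurable (F t)) \<and>
     (\<forall>\<omega>\<in>space M. W 0 \<omega> = 0) \<and>
     (\<forall>\<omega>\<in>space M. continuous_on {0..} (\<lambda>t. W t \<omega>)) \<and>
     (\<forall>s t. 0 \<le> s \<longrightarrow> s < t \<longrightarrow>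
        distributed M lborel (\<lambda>\<omega>. W t \<omega> - W s \<omega>) (\<lambda>y. ennreal (normal_density 0 (sqrt (t - s)) y)) \<and>
        prob_space.indep_set M (sets (F s))
          (sets (vimage_algebra (space M) (\<lambda>\<omega>. W t \<omega> - W s \<omega>) borel)))"

text \<open>Parameters: L, alpha, p, tau (the function i |-> tau_i), n.
  Vectors k_1.., x_1.., y_1.. are functions on nat (index 0 unused).\<close>

definition hstep :: "real \<Rightarrow> real \<Rightarrow> (nat \<Rightarrow> real) \<Rightarrow> nat \<Rightarrow> nat \<Rightarrow> (real \<Rightarrow> real \<Rightarrow> real)
    \<Rightarrow> (nat \<Rightarrow> real) \<Rightarrow> real \<Rightarrow> real \<Rightarrow> real" where
  "hstep L p tau n j G ys x t =
     (let c = tau (n - j) + p; sd = sqrt (2 * (t - c)) in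
      exp (- (ys (Suc j))\<^sup>2 / 2) / sqrt (2 * pi)
      * indicator {- x / sd .. (L - x) / sd} (ys (Suc j))
      * G (x + ys (Suc j) * sd) c)"

fun gfun :: "real \<Rightarrow> real \<Rightarrow> real \<Rightarrow> (nat \<Rightarrow> real) \<Rightarrow> nat \<Rightarrow> nat \<Rightarrow> (nat \<Rightarrow> nat)
    \<Rightarrow> (nat \<Rightarrow> real) \<Rightarrow> (nat \<Rightarrow> real) \<Rightarrow> real \<Rightarrow> real \<Rightarrow> real" where
  "gfun L a p tau n 0 k xs ys x t =
     2 / L * exp (- a * xs 1) * sin (real (k 1) * pi * xs 1 / L) * sin (real (k 1) * pi * x / L)
     * exp (- ((real (k 1) * pi / L)\<^sup>2) * t)"
| "gfun L a p tau n (Suc j) k xs ys x t =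
     2 / L * sin (real (k (Suc (Suc j))) * pi * xs (Suc (Suc j)) / L)
     * sin (real (k (Suc (Suc j))) * pi * x / L)
     * exp (- ((real (k (Suc (Suc j))) * pi / L)\<^sup>2) * (t - tau (n - Suc j)))
     * hstep L p tau n j (\<lambda>x' t'. gfun L a p tau n j k xs ys x' t') ys
         (xs (Suc (Suc j))) (tau (n - Suc j))"

definition hfun :: "real \<Rightarrow> real \<Rightarrow> real \<Rightarrow> (nat \<Rightarrow> real) \<Rightarrow> nat \<Rightarrow> nat \<Rightarrow> (nat \<Rightarrow> nat)
    \<Rightarrow> (nat \<Rightarrow> real) \<Rightarrow> (nat \<Rightarrow> real) \<Rightarrow> real \<Rightarrow> real \<Rightarrow> real" where
  "hfun L a p tau n j k xs ys x t =
     hstep L p tau n j (\<lambda>x' t'. gfun L a p tau n j k xs ys x' t') ys x t"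

fun isum :: "nat \<Rightarrow> nat \<Rightarrow> ((nat \<Rightarrow> nat) \<Rightarrow> real) \<Rightarrow> (nat \<Rightarrow> nat) \<Rightarrow> real" where
  "isum a 0 F \<kappa> = F \<kappa>"
| "isum a (Suc m) F \<kappa> = (\<Sum>i. isum (Suc a) m F (\<kappa>(a := i)))"

fun iint :: "real set \<Rightarrow> nat \<Rightarrow> ((nat \<Rightarrow> real) \<Rightarrow> real) \<Rightarrow> (nat \<Rightarrow> real) \<Rightarrow> real" where
  "iint D 0 F \<xi> = F \<xi>"
| "iint D (Suc m) F \<xi> = (LINT t:D|lborel. iint D m F (\<xi>(Suc m := t)))"

definition U_barrier :: "real \<Rightarrow> real \<Rightarrow> real \<Rightarrow> (nat \<Rightarrow> real) \<Rightarrow> nat \<Rightarrow> nat \<Rightarrow> real \<Rightarrow> real \<Rightarrow> real" where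
  "U_barrier L a p tau n j x t =
     iint UNIV j (\<lambda>ys. iint {0..L} (Suc j)
        (\<lambda>xs. isum 1 (Suc j) (\<lambda>k. gfun L a p tau n j k xs ys x t) (\<lambda>_. 0)) (\<lambda>_. 0)) (\<lambda>_. 0)"

definition U_free :: "real \<Rightarrow> real \<Rightarrow> real \<Rightarrow> (nat \<Rightarrow> real) \<Rightarrow> nat \<Rightarrow> nat \<Rightarrow> real \<Rightarrow> real \<Rightarrow> real" where
  "U_free L a p tau n j x t =
     iint UNIV (Suc j) (\<lambda>ys. iint {0..L} (Suc j)
        (\<lambda>xs. isum 1 (Suc j) (\<lambda>k. hfun L a p tau n j k xs ys x t) (\<lambda>_. 0)) (\<lambda>_. 0)) (\<lambda>_. 0)"


text \<open>Solution of dS/S = r dt + sigma dW with S_0 = S0.\<close>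
definition gbm :: "real \<Rightarrow> real \<Rightarrow> real \<Rightarrow> (real \<Rightarrow> 'a \<Rightarrow> real) \<Rightarrow> real \<Rightarrow> 'a \<Rightarrow> real" where
  "gbm S0 r \<sigma> W u \<omega> = S0 * exp ((r - \<sigma>\<^sup>2 / 2) * u + \<sigma> * W u \<omega>)"

definition payoff :: "(real \<Rightarrow> 'a \<Rightarrow> real) \<Rightarrow> nat \<Rightarrow> (nat \<Rightarrow> real) \<Rightarrow> real \<Rightarrow> real \<Rightarrow> real \<Rightarrow> 'a \<Rightarrow> real" where
  "payoff S n T P Blow Bup \<omega> = (\<Prod>i\<in>{1..n}.
     indicator {\<omega>. \<forall>u\<in>{T (i - 1) .. T (i - 1) + P}. Blow < S u \<omega> \<and> S u \<omega> < Bup} \<omega>)"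

definition alive :: "'a measure \<Rightarrow> (real \<Rightarrow> 'a \<Rightarrow> real) \<Rightarrow> nat \<Rightarrow> (nat \<Rightarrow> real) \<Rightarrow> real \<Rightarrow> real \<Rightarrow> real \<Rightarrow> real \<Rightarrow> 'a set" where
  "alive M S n T P Blow Bup t = {\<omega>\<in>space M. \<forall>u\<in>{0..t} \<inter> (\<Union>i<n. {T i .. T i + P}). Blow < S u \<omega> \<and> S u \<omega> < Bup}"

end

theory Submission
  imports Defs
begin

text \<open>
  In the variables \<open>x = ln (S / B\<^sub>l\<^sub>o\<^sub>w)\<close> and \<open>\<tau>\<close>, the exponential tilt \<open>e\<^bsup>\<alpha>x\<^esup>\<close> removes the drift
  of the log price. It remains to see that driftless Brownian motion killed on leaving \<open>(0, L)\<close>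
  has the Dirichlet heat kernel as transition density; the price then follows by alternating, backwards in
  time, killed steps over the barrier periods and free Gaussian steps between them, and Fubini turns
  this recursion into the iterated integrals of the statement.

  For the kernel neither the reflection principle nor optional stopping is used. The function
  \<open>\<phi> = sin (k\<pi>x/L) + k sin (\<pi>x/L)\<close> is nonnegative on \<open>[0, L]\<close>, and under the heat flow on the whole line each of
  its two terms is merely multiplied by a constant. For the walk obtained by checking the barriers only on a grid of mesh \<open>h\<close>,
  the analogous function of a slightly larger interval is a supersolution and \<open>\<phi>\<close> itself a
  subsolution, up to errors \<open>O(h\<^sup>2)\<close> per step. Path continuity lets the mesh and then the enlargement tend to zero, so
  the survival functional is known on all sines, and by Stone--Weierstrass on all continuous functions.
\<close>

section \<open>The iterated series and integrals\<close>

text \<open>The obstacle is sign. Checking the barriers on a grid overestimates survival, and that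
  becomes an inequality between integrals only for a nonnegative payoff, which a higher sine mode is
  not. This forces the summand k sin(pi x/L), which is removed at the end because for k = 1 the sum
  is twice the ground state. Cutting the whole-line heat flow off at the ends of an interval
  discards nonpositive values of that interval's own mode nearby, so the mode yields only a lower
  bound; an upper bound needs a margin on which the discarded values are nonnegative. The error
  O(h^2) per step is a fourth moment bound for jumps beyond a fixed distance; the variance would
  leave O(h), too much for 1/h steps. Statements about paths carry a bounded weight
  \<open>Z\<close>, measurable at the starting time, instead of a conditional expectation. The
  Markov property then is Fubini, events already survived are absorbed into \<open>Z\<close>, and
  the conditional expectation comes out last, by testing. Removing the drift costs exp(- nu (t - s))
  with nu = mu^2/(2 sigma^2); together with the discount rate r this makes up \<beta>.\<close>

definition dker :: "real \<Rightarrow> real \<Rightarrow> real \<Rightarrow> real \<Rightarrow> real" where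
  "dker L s z x = (\<Sum>k. 2 / L * sin (real k * pi * z / L) * sin (real k * pi * x / L)
     * exp (- ((real k * pi / L)\<^sup>2) * s))"

lemma summable_exp_neg_square:
  fixes c :: real
  assumes "c > 0"
  shows "summable (\<lambda>k. exp (- (real k)\<^sup>2 * c))"
proof (rule summable_comparison_test')
  show "summable (\<lambda>k. exp (- c) ^ k)"
    using assms by (intro summable_geometric) auto
  fix k :: nat assume "k \<ge> 0"
  have "real k \<le> (real k)\<^sup>2"
    by (cases k) (auto simp: power2_eq_square)
  then have "real k * c \<le> (real k)\<^sup>2 * c" using assms by (intro mult_right_mono) auto
  then show "norm (exp (- (real k)\<^sup>2 * c)) \<le> exp (- c) ^ k"
    by (simp flip: exp_of_nat_mult)
qed

lemma summable_dker_bound: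
  fixes L s :: real
  assumes "L > 0" "s > 0"
  shows "summable (\<lambda>k. 2 / L * exp (- ((real k * pi / L)\<^sup>2) * s))"
proof -
  have "summable (\<lambda>k. exp (- (real k)\<^sup>2 * ((pi / L)\<^sup>2 * s)))"
    using assms by (intro summable_exp_neg_square) auto
  then show ?thesis by (intro summable_mult) (simp add: power_mult_distrib power_divide mult.assoc)
qed

lemma dker_term_bound:
  fixes L s :: real
  assumes "L > 0"
  shows "norm (2 / L * sin a * sin b * exp (- c * s)) \<le> 2 / L * exp (- c * s)"
proof -
  have "\<bar>sin a\<bar> * \<bar>sin b\<bar> \<le> 1 * 1" by (intro mult_mono) auto
  then have "2 / L * exp (- c * s) * (\<bar>sin a\<bar> * \<bar>sin b\<bar>) \<le> 2 / L * exp (- c * s) * 1"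
    using assms by (intro mult_left_mono) auto
  then show ?thesis using assms by (simp add: abs_mult mult_ac)
qed

lemma summable_dker:
  fixes L s :: real
  assumes "L > 0" "s > 0"
  shows "summable (\<lambda>k. 2 / L * sin (real k * pi * z / L) * sin (real k * pi * x / L)
     * exp (- ((real k * pi / L)\<^sup>2) * s))"
  by (rule summable_comparison_test'[OF summable_dker_bound[OF assms], of 0])
     (rule dker_term_bound[OF assms(1)])

text \<open>At a fixed positive time the exponentials alone are summable, so the bound is uniform in
  both space points. It supplies the domination for all later exchanges of integrals and
  limits.\<close>

lemma dker_bounded:
  fixes L s :: real
  assumes "L > 0" "s > 0"
  obtains C where "C \<ge> 0" "\<And>z x. \<bar>dker L s z x\<bar> \<le> C"
proof
  let ?g = "\<lambda>k. 2 / L * exp (- ((real k * pi / L)\<^sup>2) * s)"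
  show "suminf ?g \<ge> 0"
    using assms by (intro suminf_nonneg summable_dker_bound) auto
  show "\<bar>dker L s z x\<bar> \<le> suminf ?g" for z x
    unfolding dker_def
    unfolding real_norm_def[symmetric]
    by (rule norm_suminf_le[OF _ summable_dker_bound[OF assms]]) (rule dker_term_bound[OF assms(1)])
qed

lemma measurable_dker [measurable (raw)]:
  assumes [measurable]: "f \<in> borel_measurable N" "g \<in> borel_measurable N"
  shows "(\<lambda>w. dker L s (f w) (g w)) \<in> borel_measurable N"
  unfolding dker_def by measurable

text \<open>An inner series sees the outer indices as constants, so the factors come out one by one.
  \<open>A\<close> collects everything that depends on indices already fixed, hence the condition
  that it reads only coordinates below \<open>b\<close>.\<close>

lemma isum_prod:
  assumes "\<And>i. i \<in> {b..<b+m} \<Longrightarrow> summable (c i)"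
    and "\<And>\<kappa>. F \<kappa> = A \<kappa> * (\<Prod>i\<in>{b..<b+m}. c i (\<kappa> i))"
    and "\<And>\<kappa> \<kappa>'. (\<forall>i<b. \<kappa> i = \<kappa>' i) \<Longrightarrow> A \<kappa> = A \<kappa>'"
  shows "isum b m F \<kappa> = A \<kappa> * (\<Prod>i\<in>{b..<b+m}. suminf (c i))"
  using assms
proof (induction m arbitrary: b A \<kappa>)
  case 0
  then show ?case by simp
next
  case (Suc m)
  have *: "{b..<b + Suc m} = insert b {Suc b..<Suc b + m}" by auto
  have "isum (Suc b) m F (\<kappa>(b := i)) = A \<kappa> * c b i * (\<Prod>i\<in>{Suc b..<Suc b+m}. suminf (c i))" for i
  proof -
    \<comment> \<open>The induction hypothesis is used with \<open>A\<close> enlarged by the factor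
      \<open>c b (\<kappa> b)\<close>, which belongs to the index just fixed.\<close>
    have "isum (Suc b) m F (\<kappa>(b := i)) =
      (\<lambda>\<kappa>. A \<kappa> * c b (\<kappa> b)) (\<kappa>(b := i)) * (\<Prod>i\<in>{Suc b..<Suc b+m}. suminf (c i))"
    proof (rule Suc.IH)
      fix \<kappa> show "F \<kappa> = A \<kappa> * c b (\<kappa> b) * (\<Prod>i\<in>{Suc b..<Suc b + m}. c i (\<kappa> i))"
        unfolding Suc.prems(2) * by simp
    next
      fix \<kappa> \<kappa>' :: "nat \<Rightarrow> nat" assume "\<forall>i<Suc b. \<kappa> i = \<kappa>' i"
      then show "A \<kappa> * c b (\<kappa> b) = A \<kappa>' * c b (\<kappa>' b)"
        using Suc.prems(3)[of \<kappa> \<kappa>'] by auto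
    qed (use Suc.prems(1) in auto)
    also have "A (\<kappa>(b := i)) = A \<kappa>" by (rule Suc.prems(3)) auto
    finally show ?thesis by (simp only: fun_upd_same)
  qed
  then have "isum b (Suc m) F \<kappa> = (\<Sum>i. c b i * (A \<kappa> * (\<Prod>i\<in>{Suc b..<Suc b+m}. suminf (c i))))"
    by (simp add: mult_ac)
  also have "\<dots> = suminf (c b) * (A \<kappa> * (\<Prod>i\<in>{Suc b..<Suc b+m}. suminf (c i)))"
    by (rule suminf_mult2[symmetric]) (use Suc.prems(1) in auto)
  finally show ?case unfolding * by simp
qed

text \<open>Holds without integrability: a constant factor commutes with the Lebesgue integral even
  where the latter takes its default value 0.\<close>

lemma iint_cmult: "iint D m (\<lambda>\<eta>. c * F \<eta>) \<xi> = c * iint D m F \<xi>"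
  by (induction m arbitrary: \<xi>) auto

text \<open>The iterated integral overwrites only coordinates 1 to \<open>m\<close>; the others can
  be fixed at their base values when integrands are compared.\<close>

lemma iint_cong:
  assumes "\<And>\<eta>. (\<And>i. i \<notin> {1..m} \<Longrightarrow> \<eta> i = \<xi> i) \<Longrightarrow> F \<eta> = G \<eta>"
  shows "iint D m F \<xi> = iint D m G \<xi>"
  using assms
proof (induction m arbitrary: \<xi>)
  case (Suc m)
  have "iint D m F (\<xi>(Suc m := t)) = iint D m G (\<xi>(Suc m := t))" for t
    by (rule Suc.IH, rule Suc.prems) auto
  then show ?case by simp
qed auto

text \<open>Joint measurability in the parameter and the base point is the form that survives
  induction: the next variable to be integrated is a coordinate of the base point.\<close>

lemma measurable_iint:
  assumes "(\<lambda>w. F (fst w) (snd w)) \<in> borel_measurable (N \<Otimes>\<^sub>M Pi\<^sub>M UNIV (\<lambda>_. borel))"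
    and [measurable]: "D \<in> sets borel"
  shows "(\<lambda>w. iint D m (F (fst w)) (snd w)) \<in> borel_measurable (N \<Otimes>\<^sub>M Pi\<^sub>M UNIV (\<lambda>_. borel))"
proof (induction m)
  case 0
  then show ?case using assms by simp
next
  case (Suc m)
  note Suc[measurable]
  have [measurable]: "(\<lambda>w. (snd (fst w))(Suc m := snd w)) \<in>
     measurable ((N \<Otimes>\<^sub>M Pi\<^sub>M UNIV (\<lambda>_. borel)) \<Otimes>\<^sub>M lborel) (Pi\<^sub>M UNIV (\<lambda>_. borel :: real measure))"
    by (rule measurable_PiM_single') (auto simp: space_PiM split: if_splits)
  have "(\<lambda>w. iint D m (F (fst (fst w))) ((snd (fst w))(Suc m := snd w)))
     \<in> borel_measurable ((N \<Otimes>\<^sub>M Pi\<^sub>M UNIV (\<lambda>_. borel)) \<Otimes>\<^sub>M lborel)"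
    by (rule measurable_compose[OF _ Suc, of "\<lambda>w. (fst (fst w), (snd (fst w))(Suc m := snd w))",
        unfolded fst_conv snd_conv]) measurable
  then show ?case
    unfolding iint.simps set_lebesgue_integral_def
    by (intro lborel.borel_measurable_lebesgue_integral) (auto simp: split_beta')
qed

text \<open>If \<open>f\<close> is not integrable its integral is 0 by convention and the bound is
  trivial. This spares measurability arguments in all later estimates.\<close>

lemma abs_integral_le_of_bound:
  fixes f g :: "'b \<Rightarrow> real"
  assumes "integrable M g" "\<And>x. \<bar>f x\<bar> \<le> g x"
  shows "\<bar>integral\<^sup>L M f\<bar> \<le> integral\<^sup>L M g"
proof (cases "integrable M f")
  case True
  have "\<bar>integral\<^sup>L M f\<bar> \<le> (\<integral>x. \<bar>f x\<bar> \<partial>M)" by (rule integral_abs_bound)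
  also have "\<dots> \<le> integral\<^sup>L M g"
    using True assms by (intro integral_mono integrable_abs) auto
  finally show ?thesis .
next
  case False
  have "0 \<le> g x" for x using assms(2)[of x] by linarith
  then show ?thesis using False by (simp add: not_integrable_integral_eq)
qed

text \<open>Each Gaussian factor has mass 1, so integrating it out leaves the constant unchanged. In
  the induction the density of the outermost variable is moved into \<open>C\<close>.\<close>

lemma abs_iint_UNIV_le:
  assumes "\<And>\<eta>. (\<And>i. i \<notin> {1..m} \<Longrightarrow> \<eta> i = \<xi> i) \<Longrightarrow> \<bar>F \<eta>\<bar> \<le> C * (\<Prod>i=1..m. std_normal_density (\<eta> i))"
  shows "\<bar>iint UNIV m F \<xi>\<bar> \<le> C"
  using assms
proof (induction m arbitrary: \<xi> C)
  case (Suc m)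
  have "\<bar>iint UNIV m F (\<xi>(Suc m := t))\<bar> \<le> C * std_normal_density t" for t
  proof (rule Suc.IH)
    fix \<eta> assume *: "\<And>i. i \<notin> {1..m} \<Longrightarrow> \<eta> i = (\<xi>(Suc m := t)) i"
    have "\<bar>F \<eta>\<bar> \<le> C * (\<Prod>i=1..Suc m. std_normal_density (\<eta> i))"
      by (rule Suc.prems) (use * in auto)
    also have "\<eta> (Suc m) = t" using *[of "Suc m"] by simp
    then have "C * (\<Prod>i=1..Suc m. std_normal_density (\<eta> i)) = C * std_normal_density t * (\<Prod>i=1..m. std_normal_density (\<eta> i))"
      by simp
    finally show "\<bar>F \<eta>\<bar> \<le> C * std_normal_density t * (\<Prod>i=1..m. std_normal_density (\<eta> i))" .
  qed
  then have "\<bar>\<integral>t. iint UNIV m F (\<xi>(Suc m := t)) \<partial>lborel\<bar> \<le> (\<integral>t. C * std_normal_density t \<partial>lborel)"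
    by (intro abs_integral_le_of_bound) auto
  also have "\<dots> = C" by simp
  finally show ?case by (simp add: set_lebesgue_integral_def)
qed auto

text \<open>Fubini, one Gaussian variable at a time, dominated by the product of densities on the
  line and a constant on \<open>{0..L}\<close>. In \<open>U_barrier\<close> all y-integrals stand
  outside all x-integrals, whereas the recursion of the price alternates them.\<close>

lemma iint_swap:
  fixes F :: "real \<Rightarrow> (nat \<Rightarrow> real) \<Rightarrow> real"
  assumes F: "(\<lambda>w. F (fst w) (snd w)) \<in> borel_measurable (borel \<Otimes>\<^sub>M Pi\<^sub>M UNIV (\<lambda>_. borel))"
    and "\<And>z \<eta>. (\<And>i. i \<notin> {1..m} \<Longrightarrow> \<eta> i = \<xi> i) \<Longrightarrow> \<bar>F z \<eta>\<bar> \<le> C * (\<Prod>i=1..m. std_normal_density (\<eta> i))"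
  shows "iint UNIV m (\<lambda>\<eta>. LINT z:{0..L}|lborel. F z \<eta>) \<xi> = (LINT z:{0..L}|lborel. iint UNIV m (F z) \<xi>)"
  using assms(2)
proof (induction m arbitrary: \<xi> C)
  case (Suc m)
  have bnd: "\<bar>F z \<eta>\<bar> \<le> C * std_normal_density t * (\<Prod>i=1..m. std_normal_density (\<eta> i))"
    if *: "\<And>i. i \<notin> {1..m} \<Longrightarrow> \<eta> i = (\<xi>(Suc m := t)) i" for t z \<eta>
  proof -
    have "\<bar>F z \<eta>\<bar> \<le> C * (\<Prod>i=1..Suc m. std_normal_density (\<eta> i))"
      by (rule Suc.prems) (use * in auto)
    also have "\<eta> (Suc m) = t" using *[of "Suc m"] by simp
    then have "C * (\<Prod>i=1..Suc m. std_normal_density (\<eta> i)) = C * std_normal_density t * (\<Prod>i=1..m. std_normal_density (\<eta> i))"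
      by simp
    finally show ?thesis .
  qed
  have bnd2: "\<bar>iint UNIV m (F z) (\<xi>(Suc m := t))\<bar> \<le> C * std_normal_density t" for z t
    by (rule abs_iint_UNIV_le) (rule bnd)
  \<comment> \<open>The assumed bound itself forces this sign, since the density that multiplies
    \<open>C\<close> is positive.\<close>
  have C: "0 \<le> C" using bnd2[of 0 0] normal_density_pos[of 1 0 0]
    by (smt (verit) mult_neg_pos)
  have [measurable]: "(\<lambda>w. (fst w, \<xi>(Suc m := snd w))) \<in>
     measurable (borel \<Otimes>\<^sub>M borel) (borel \<Otimes>\<^sub>M Pi\<^sub>M UNIV (\<lambda>_. borel :: real measure))"
    by (intro measurable_Pair measurable_PiM_single') (auto simp: space_PiM split: if_splits)
  have meas: "(\<lambda>w. iint UNIV m (F (fst w)) (\<xi>(Suc m := snd w))) \<in> borel_measurable (borel \<Otimes>\<^sub>M borel)"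
    using measurable_compose[OF \<open>(\<lambda>w. (fst w, \<xi>(Suc m := snd w))) \<in> _\<close> measurable_iint[OF F, of UNIV m]] by simp
  let ?f = "\<lambda>z t. indicator {0..L} z * iint UNIV m (F z) (\<xi>(Suc m := t))"
  have int: "integrable (lborel \<Otimes>\<^sub>M lborel) (\<lambda>(z, t). ?f z t)"
  proof (rule Bochner_Integration.integrable_bound)
    show "integrable (lborel \<Otimes>\<^sub>M lborel) (\<lambda>(z::real, t). indicator {0..L} z * (C * std_normal_density t))"
      by (rule lborel_pair.Fubini_integrable)
         (auto simp: abs_mult C emeasure_lborel_Icc_eq intro!: integrable_mult_left integrable_real_indicator)
    show "(\<lambda>(z, t). ?f z t) \<in> borel_measurable (lborel \<Otimes>\<^sub>M lborel)"
      using meas by (simp add: split_beta')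
    show "AE w in lborel \<Otimes>\<^sub>M lborel. norm (case w of (z, t) \<Rightarrow> ?f z t)
        \<le> norm (case w of (z, t) \<Rightarrow> indicator {0..L} z * (C * std_normal_density t))"
      using bnd2 C by (auto simp: abs_mult split: split_indicator)
  qed
  have "iint UNIV (Suc m) (\<lambda>\<eta>. LINT z:{0..L}|lborel. F z \<eta>) \<xi>
     = (\<integral>t. (LINT z:{0..L}|lborel. iint UNIV m (F z) (\<xi>(Suc m := t))) \<partial>lborel)"
    using Suc.IH[OF bnd] by (simp add: set_lebesgue_integral_def)
  also have "\<dots> = (\<integral>t. (\<integral>z. ?f z t \<partial>lborel) \<partial>lborel)"
    by (simp add: set_lebesgue_integral_def)
  also have "\<dots> = (\<integral>z. (\<integral>t. ?f z t \<partial>lborel) \<partial>lborel)"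
    by (rule lborel_pair.Fubini_integral[OF int])
  also have "\<dots> = (LINT z:{0..L}|lborel. iint UNIV (Suc m) (F z) \<xi>)"
    by (simp add: set_lebesgue_integral_def)
  finally show ?case .
qed auto


lemma abs_set_integral_Icc_le:
  fixes f :: "real \<Rightarrow> real"
  assumes "\<And>z. z \<in> {0..L} \<Longrightarrow> \<bar>f z\<bar> \<le> C" "0 \<le> L"
  shows "\<bar>LINT z:{0..L}|lborel. f z\<bar> \<le> L * C"
proof -
  have "\<bar>LINT z:{0..L}|lborel. f z\<bar> \<le> (\<integral>z. indicator {0..L} z * C \<partial>lborel)"
    unfolding set_lebesgue_integral_def real_scaleR_def
    by (rule abs_integral_le_of_bound)
       (use assms in \<open>auto split: split_indicator intro!: integrable_mult_left integrable_real_indicator\<close>)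
  then show ?thesis using assms(2) by simp
qed

section \<open>Summing the series and integrating out the space variables\<close>

fun gsum :: "real \<Rightarrow> real \<Rightarrow> real \<Rightarrow> (nat \<Rightarrow> real) \<Rightarrow> nat \<Rightarrow> nat
    \<Rightarrow> (nat \<Rightarrow> real) \<Rightarrow> (nat \<Rightarrow> real) \<Rightarrow> real \<Rightarrow> real \<Rightarrow> real" where
  "gsum L a p tau n 0 xs ys x t = exp (- a * xs 1) * dker L t (xs 1) x"
| "gsum L a p tau n (Suc j) xs ys x t =
     dker L (t - tau (n - Suc j)) (xs (Suc (Suc j))) x
     * hstep L p tau n j (gsum L a p tau n j xs ys) ys (xs (Suc (Suc j))) (tau (n - Suc j))"

text \<open>What remains of \<open>g_j\<close> once the series are summed and all x-integrals are
  carried out; only the y-variables are left free.\<close>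

fun gint :: "real \<Rightarrow> real \<Rightarrow> real \<Rightarrow> (nat \<Rightarrow> real) \<Rightarrow> nat \<Rightarrow> nat
    \<Rightarrow> (nat \<Rightarrow> real) \<Rightarrow> real \<Rightarrow> real \<Rightarrow> real" where
  "gint L a p tau n 0 ys x t = (LINT z:{0..L}|lborel. exp (- a * z) * dker L t z x)"
| "gint L a p tau n (Suc j) ys x t = (LINT z:{0..L}|lborel. dker L (t - tau (n - Suc j)) z x
     * hstep L p tau n j (gint L a p tau n j ys) ys z (tau (n - Suc j)))"

text \<open>Every factor of \<open>g\<^sub>j\<close> involves a single summation index, so the iterated series is a product of series.\<close>

lemma gfun_factor:
  assumes "L > 0" "p > 0" "t > tau (n - j)" "tau n = 0"
  shows "\<exists>A c. (\<forall>i\<in>{1..Suc j}. summable (c i)) \<and>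
     (\<forall>k. gfun L a p tau n j k xs ys x t = A * (\<Prod>i\<in>{1..Suc j}. c i (k i))) \<and>
     gsum L a p tau n j xs ys x t = A * (\<Prod>i\<in>{1..Suc j}. suminf (c i))"
  using assms(3)
proof (induction j arbitrary: x t)
  case 0
  then have "t > 0" using assms by simp
  have eq: "{1..Suc 0} = {1}" by auto
  let ?c = "\<lambda>k. 2 / L * sin (real k * pi * xs 1 / L)
         * sin (real k * pi * x / L) * exp (- ((real k * pi / L)\<^sup>2) * t)"
  show ?case
    unfolding eq
  proof (intro exI[of _ "exp (- a * xs 1)"] exI[of _ "\<lambda>_. ?c"] conjI ballI allI)
    show "summable ?c" by (rule summable_dker[OF assms(1) \<open>t > 0\<close>])
  qed (simp_all add: dker_def)
next
  case (Suc j)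
  define s where "s = tau (n - j) + p"
  define sd where "sd = sqrt (2 * (tau (n - Suc j) - s))"
  let ?z = "xs (Suc (Suc j))"
  define w where "w = exp (- (ys (Suc j))\<^sup>2 / 2) / sqrt (2 * pi) * indicator {- ?z / sd .. (L - ?z) / sd} (ys (Suc j))"
  have hs: "hstep L p tau n j G ys ?z (tau (n - Suc j)) = w * G (?z + ys (Suc j) * sd) s" for G
    by (simp add: hstep_def w_def sd_def s_def Let_def)
  have "s > tau (n - j)" using assms(2) by (simp add: s_def)
  from Suc.IH[OF this, of "?z + ys (Suc j) * sd"] obtain A c where
    c: "\<And>i. i \<in> {1..Suc j} \<Longrightarrow> summable (c i)"
    and g: "\<And>k. gfun L a p tau n j k xs ys (?z + ys (Suc j) * sd) s = A * (\<Prod>i\<in>{1..Suc j}. c i (k i))"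
    and gs: "gsum L a p tau n j xs ys (?z + ys (Suc j) * sd) s = A * (\<Prod>i\<in>{1..Suc j}. suminf (c i))"
    by metis
  define d where "d k = 2 / L * sin (real k * pi * ?z / L) * sin (real k * pi * x / L)
         * exp (- ((real k * pi / L)\<^sup>2) * (t - tau (n - Suc j)))" for k
  have d: "summable d" "suminf d = dker L (t - tau (n - Suc j)) ?z x"
    unfolding d_def dker_def using summable_dker[OF assms(1), of "t - tau (n - Suc j)"] Suc.prems by auto
  let ?c = "c (Suc (Suc j) := d)"
  have eq: "(\<Prod>i\<in>{1..Suc (Suc j)}. f i) = (\<Prod>i\<in>{1..Suc j}. f i) * f (Suc (Suc j))" for f :: "nat \<Rightarrow> real"
    by simp
  show ?case
  proof (intro exI[of _ "w * A"] exI[of _ ?c] conjI ballI allI)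
    show "summable (?c i)" if "i \<in> {1..Suc (Suc j)}" for i
      using that c d by (cases "i = Suc (Suc j)") auto
    show "gfun L a p tau n (Suc j) k xs ys x t = w * A * (\<Prod>i\<in>{1..Suc (Suc j)}. ?c i (k i))" for k
    proof -
      have "gfun L a p tau n (Suc j) k xs ys x t = d (k (Suc (Suc j))) * (w * (A * (\<Prod>i\<in>{1..Suc j}. c i (k i))))"
        by (simp only: gfun.simps hs g d_def)
      then show ?thesis unfolding eq by simp
    qed
    show "gsum L a p tau n (Suc j) xs ys x t = w * A * (\<Prod>i\<in>{1..Suc (Suc j)}. suminf (?c i))"
      unfolding eq by (simp add: hs gs d)
  qed
qed

text \<open>The constant \<open>b\<close> stands for the Gaussian weight and the cut-off that
  \<open>hfun\<close> puts in front; neither depends on a summation index.\<close>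

lemma isum_gfun:
  assumes "L > 0" "p > 0" "t > tau (n - j)" "tau n = 0"
  shows "isum 1 (Suc j) (\<lambda>k. b * gfun L a p tau n j k xs ys x t) \<kappa> = b * gsum L a p tau n j xs ys x t"
proof -
  obtain A c where *: "\<And>i. i \<in> {1..Suc j} \<Longrightarrow> summable (c i)"
     "\<And>k. gfun L a p tau n j k xs ys x t = A * (\<Prod>i\<in>{1..Suc j}. c i (k i))"
     "gsum L a p tau n j xs ys x t = A * (\<Prod>i\<in>{1..Suc j}. suminf (c i))"
    using gfun_factor[OF assms] by metis
  have eq: "{1..<1 + Suc j} = {1..Suc j}" by auto
  have "isum 1 (Suc j) (\<lambda>k. b * gfun L a p tau n j k xs ys x t) \<kappa>
      = (\<lambda>_. b * A) \<kappa> * (\<Prod>i\<in>{1..<1 + Suc j}. suminf (c i))"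
    by (rule isum_prod) (unfold eq, simp_all add: * del: prod.cl_ivl_Suc)
  then show ?thesis unfolding eq *(3) by simp
qed

text \<open>With the outermost space variable held fixed, the new kernel, the weight and the shift
  inside \<open>hstep\<close> are constants, so the inner integrals are an instance of the previous
  level.\<close>

lemma iint_gsum:
  "iint {0..L} (Suc j) (\<lambda>xs. gsum L a p tau n j xs ys x t) \<xi> = gint L a p tau n j ys x t"
proof (induction j arbitrary: x t \<xi>)
  case (Suc j)
  have "iint {0..L} (Suc j) (\<lambda>xs. gsum L a p tau n (Suc j) xs ys x t) (\<xi>(Suc (Suc j) := z))
     = dker L (t - tau (n - Suc j)) z x * hstep L p tau n j (gint L a p tau n j ys) ys z (tau (n - Suc j))" for z
  proof -
    have "iint {0..L} (Suc j) (\<lambda>xs. gsum L a p tau n (Suc j) xs ys x t) (\<xi>(Suc (Suc j) := z))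
      = iint {0..L} (Suc j) (\<lambda>xs. dker L (t - tau (n - Suc j)) z x *
           hstep L p tau n j (gsum L a p tau n j xs ys) ys z (tau (n - Suc j))) (\<xi>(Suc (Suc j) := z))"
      by (rule iint_cong) auto
    then show ?thesis
      unfolding hstep_def Let_def iint_cmult Suc.IH .
  qed
  then show ?case unfolding iint.simps(2)[of _ "Suc j"] by simp
qed simp

lemma U_barrier_gint:
  assumes "L > 0" "p > 0" "t > tau (n - j)" "tau n = 0"
  shows "U_barrier L a p tau n j x t = iint UNIV j (\<lambda>ys. gint L a p tau n j ys x t) (\<lambda>_. 0)"
  unfolding U_barrier_def using isum_gfun[OF assms, of 1]
  by (simp only: mult_1_left iint_gsum)

lemma U_free_gint:
  assumes "L > 0" "p > 0" "tau n = 0"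
  shows "U_free L a p tau n j x t
    = iint UNIV (Suc j) (\<lambda>ys. hstep L p tau n j (gint L a p tau n j ys) ys x t) (\<lambda>_. 0)"
proof -
  have *: "tau (n - j) + p > tau (n - j)" using assms by simp
  show ?thesis
    unfolding U_free_def hfun_def hstep_def Let_def isum_gfun[OF assms(1,2) * assms(3)] iint_cmult iint_gsum ..
qed

section \<open>Recursions for \<open>U_free\<close> and \<open>U_barrier\<close>\<close>

lemma gint_cong:
  assumes "\<And>i. i \<in> {1..j} \<Longrightarrow> ys i = ys' i"
  shows "gint L a p tau n j ys x t = gint L a p tau n j ys' x t"
  using assms
proof (induction j arbitrary: x t)
  case (Suc j)
  have *: "gint L a p tau n j ys = gint L a p tau n j ys'"
    by (intro ext Suc.IH) (use Suc.prems in auto)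
  have "ys (Suc j) = ys' (Suc j)" using Suc.prems[of "Suc j"] by simp
  then show ?case by (simp add: * hstep_def)
qed simp

text \<open>Every coordinate that \<open>F\<close> reads gets overwritten, so the base point is
  irrelevant.\<close>

lemma iint_base:
  assumes F: "\<And>\<eta> \<eta>'. (\<And>i. i \<in> {1..m} \<Longrightarrow> \<eta> i = \<eta>' i) \<Longrightarrow> F \<eta> = F \<eta>'"
  shows "iint D m F \<xi> = iint D m F \<xi>'"
proof -
  \<comment> \<open>Generalised for induction: with only \<open>l\<close> integrals left, the base
    points must still agree on the coordinates above \<open>l\<close>.\<close>
  have "iint D l F \<xi> = iint D l F \<xi>'" if "\<And>i. i \<in> {l<..m} \<Longrightarrow> \<xi> i = \<xi>' i" "l \<le> m" for l
    using that
  proof (induction l arbitrary: \<xi> \<xi>')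
    case 0
    then show ?case by (auto intro!: F)
  next
    case (Suc l)
    have "iint D l F (\<xi>(Suc l := t)) = iint D l F (\<xi>'(Suc l := t))" for t
      by (rule Suc.IH) (use Suc.prems in auto)
    then show ?case by simp
  qed
  from this[of m] show ?thesis by simp
qed

text \<open>Weight and cut-off of \<open>hstep\<close> involve only the outermost variable
  \<open>ys (Suc j)\<close>. They leave the inner integrals, which then form
  \<open>U_barrier\<close> at the shifted point.\<close>

lemma U_free_eq:
  fixes L a p t :: real and tau :: "nat \<Rightarrow> real" and j n :: nat
  assumes "L > 0" "p > 0" "tau n = 0"
  defines "c \<equiv> tau (n - j) + p"
  defines "sd \<equiv> sqrt (2 * (t - c))"
  shows "U_free L a p tau n j x t = (\<integral>y. std_normal_density y
      * indicator {- x / sd .. (L - x) / sd} y * U_barrier L a p tau n j (x + y * sd) c \<partial>lborel)"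
proof -
  have c: "c > tau (n - j)" using assms by simp
  have "iint UNIV j (\<lambda>ys. hstep L p tau n j (gint L a p tau n j ys) ys x t) ((\<lambda>_. 0)(Suc j := y))
     = std_normal_density y * indicator {- x / sd .. (L - x) / sd} y * U_barrier L a p tau n j (x + y * sd) c" for y
  proof -
    have "iint UNIV j (\<lambda>ys. hstep L p tau n j (gint L a p tau n j ys) ys x t) ((\<lambda>_. 0)(Suc j := y))
     = iint UNIV j (\<lambda>ys. std_normal_density y * indicator {- x / sd .. (L - x) / sd} y
          * gint L a p tau n j ys (x + y * sd) c) ((\<lambda>_. 0)(Suc j := y))"
      by (rule iint_cong) (simp add: hstep_def sd_def c_def Let_def std_normal_density_def)
    also have "\<dots> = std_normal_density y * indicator {- x / sd .. (L - x) / sd} y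
          * iint UNIV j (\<lambda>ys. gint L a p tau n j ys (x + y * sd) c) ((\<lambda>_. 0)(Suc j := y))"
      by (rule iint_cmult)
    also have "iint UNIV j (\<lambda>ys. gint L a p tau n j ys (x + y * sd) c) ((\<lambda>_. 0)(Suc j := y))
       = U_barrier L a p tau n j (x + y * sd) c"
      unfolding U_barrier_gint[OF assms(1,2) c assms(3)] by (rule iint_base, rule gint_cong) auto
    finally show ?thesis .
  qed
  then show ?thesis unfolding U_free_gint[where tau=tau and n=n, OF assms(1-3)] by (simp add: set_lebesgue_integral_def)
qed

lemma hstep_measurable:
  assumes "(\<lambda>w. G (snd w) (fst w) (tau (n - j) + p)) \<in> borel_measurable (borel \<Otimes>\<^sub>M Pi\<^sub>M UNIV (\<lambda>_. borel))"
  shows "(\<lambda>w. hstep L p tau n j (G (snd w)) (snd w) (fst w) t)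
    \<in> borel_measurable (borel \<Otimes>\<^sub>M Pi\<^sub>M UNIV (\<lambda>_. borel))"
proof -
  define sd where "sd = sqrt (2 * (t - (tau (n - j) + p)))"
  have [measurable]: "(\<lambda>w. snd w (Suc j)) \<in> borel_measurable (borel \<Otimes>\<^sub>M Pi\<^sub>M UNIV (\<lambda>_. borel :: real measure))"
    by measurable
  have [measurable]: "(\<lambda>w. G (snd w) (fst w + snd w (Suc j) * sd) (tau (n - j) + p))
     \<in> borel_measurable (borel \<Otimes>\<^sub>M Pi\<^sub>M UNIV (\<lambda>_. borel))"
    by (rule measurable_compose[OF _ assms, of "\<lambda>w. (fst w + snd w (Suc j) * sd, snd w)",
        unfolded fst_conv snd_conv]) measurable
  \<comment> \<open>The interval of the indicator has endpoints that move with the point, so it is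
    written as two comparisons, which are jointly measurable.\<close>
  have "(\<lambda>w. exp (- (snd w (Suc j))\<^sup>2 / 2) / sqrt (2 * pi)
      * (if - fst w / sd \<le> snd w (Suc j) \<and> snd w (Suc j) \<le> (L - fst w) / sd then 1 else 0)
      * G (snd w) (fst w + snd w (Suc j) * sd) (tau (n - j) + p))
     \<in> borel_measurable (borel \<Otimes>\<^sub>M Pi\<^sub>M UNIV (\<lambda>_. borel))"
    by measurable
  then show ?thesis
    unfolding hstep_def Let_def sd_def indicator_def atLeastAtMost_iff of_bool_def .
qed

lemma measurable_gint:
  "(\<lambda>w. gint L a p tau n j (snd w) (fst w) t) \<in> borel_measurable (borel \<Otimes>\<^sub>M Pi\<^sub>M UNIV (\<lambda>_. borel))"
proof (induction j arbitrary: t)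
  case 0
  show ?case by (simp add: set_lebesgue_integral_def)
next
  case (Suc j)
  have "(\<lambda>w. hstep L p tau n j (gint L a p tau n j (snd (fst w))) (snd (fst w)) (snd w) (tau (n - Suc j)))
    \<in> borel_measurable ((borel \<Otimes>\<^sub>M Pi\<^sub>M UNIV (\<lambda>_. borel)) \<Otimes>\<^sub>M lborel)"
    by (rule measurable_compose[OF _ hstep_measurable[OF Suc.IH], of "\<lambda>w. (snd w, snd (fst w))",
        unfolded fst_conv snd_conv]) measurable
  note this[measurable]
  show ?case
    unfolding gint.simps set_lebesgue_integral_def
    by (intro lborel.borel_measurable_lebesgue_integral) (simp add: split_beta')
qed

lemma hstep_abs_le:
  assumes "\<And>x. \<bar>gint L a p tau n j ys x (tau (n - j) + p)\<bar> \<le> C * (\<Prod>i=1..j. std_normal_density (ys i))"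
  shows "\<bar>hstep L p tau n j (gint L a p tau n j ys) ys z s\<bar> \<le> C * (\<Prod>i=1..Suc j. std_normal_density (ys i))"
proof -
  let ?y = "z + ys (Suc j) * sqrt (2 * (s - (tau (n - j) + p)))"
  have "\<bar>hstep L p tau n j (gint L a p tau n j ys) ys z s\<bar>
      \<le> std_normal_density (ys (Suc j)) * \<bar>gint L a p tau n j ys ?y (tau (n - j) + p)\<bar>"
    by (auto simp: hstep_def Let_def std_normal_density_def abs_mult split: split_indicator)
  also have "\<dots> \<le> std_normal_density (ys (Suc j)) * (C * (\<Prod>i=1..j. std_normal_density (ys i)))"
    by (intro mult_left_mono assms) auto
  finally show ?thesis by (simp add: mult_ac)
qed

text \<open>The constant depends on neither \<open>x\<close> nor the y-variables, which is the
  Gaussian domination required by \<open>iint_swap\<close> and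
  \<open>abs_iint_UNIV_le\<close>.\<close>

lemma gint_bounded:
  fixes L a p t :: real
  assumes "L > 0" "p > 0" "t > tau (n - j)" "tau n = 0"
  shows "\<exists>C\<ge>0. \<forall>ys x. \<bar>gint L a p tau n j ys x t\<bar> \<le> C * (\<Prod>i=1..j. std_normal_density (ys i))"
  using assms(3)
proof (induction j arbitrary: t)
  case 0
  then have "t > 0" using assms by simp
  obtain C where C: "C \<ge> 0" "\<And>z x. \<bar>dker L t z x\<bar> \<le> C" using dker_bounded[OF assms(1) \<open>t > 0\<close>] by blast
  have "\<bar>exp (- a * z) * dker L t z x\<bar> \<le> exp (\<bar>a\<bar> * L) * C" if "z \<in> {0..L}" for z x
  proof -
    have "- a * z \<le> \<bar>a\<bar> * L" using that 
      by (rule_tac order_trans[OF abs_ge_self], unfold abs_mult abs_minus_cancel, intro mult_left_mono) auto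
    then have "\<bar>exp (- a * z)\<bar> \<le> exp (\<bar>a\<bar> * L)" by simp
    then show ?thesis unfolding abs_mult using C by (intro mult_mono) auto
  qed
  then have "\<bar>LINT z:{0..L}|lborel. exp (- a * z) * dker L t z x\<bar> \<le> L * (exp (\<bar>a\<bar> * L) * C)" for x
    using assms(1) by (intro abs_set_integral_Icc_le) auto
  then show ?case using C assms(1) by (intro exI[of _ "L * (exp (\<bar>a\<bar> * L) * C)"]) auto
next
  case (Suc j)
  define c where "c = tau (n - j) + p"
  have "c > tau (n - j)" using assms by (simp add: c_def)
  from Suc.IH[OF this] obtain C where C: "C \<ge> 0"
    "\<And>ys x. \<bar>gint L a p tau n j ys x c\<bar> \<le> C * (\<Prod>i=1..j. std_normal_density (ys i))" by blast
  obtain D where D: "D \<ge> 0" "\<And>z x. \<bar>dker L (t - tau (n - Suc j)) z x\<bar> \<le> D"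
    using dker_bounded[OF assms(1), of "t - tau (n - Suc j)"] Suc.prems by auto
  note h = hstep_abs_le[of L a p tau n j _ C, OF C(2)[unfolded c_def]]
  have "\<bar>gint L a p tau n (Suc j) ys x t\<bar> \<le> L * (D * (C * (\<Prod>i=1..Suc j. std_normal_density (ys i))))" for ys x
    unfolding gint.simps
  proof (rule abs_set_integral_Icc_le)
    show "\<bar>dker L (t - tau (n - Suc j)) z x * hstep L p tau n j (gint L a p tau n j ys) ys z (tau (n - Suc j))\<bar>
       \<le> D * (C * (\<Prod>i=1..Suc j. std_normal_density (ys i)))" for z
      unfolding abs_mult using D(1) by (intro mult_mono D h) auto
  qed (use assms in simp)
  then show ?case using C(1) D(1) assms(1) by (intro exI[of _ "L * (D * C)"]) (simp add: mult.assoc del: prod.cl_ivl_Suc)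
qed

lemma U_barrier_0:
  assumes "L > 0" "p > 0" "tau n = 0" "t > 0"
  shows "U_barrier L a p tau n 0 x t = (LINT z:{0..L}|lborel. exp (- a * z) * dker L t z x)"
  using assms by (simp add: U_barrier_gint)

text \<open>Moving the last space integral outside all y-integrals exposes a killed heat step
  applied to the free solution at the moment where the barrier period joins the gap.\<close>

lemma U_barrier_Suc:
  assumes "L > 0" "p > 0" "tau n = 0" "t > tau (n - Suc j)"
  shows "U_barrier L a p tau n (Suc j) x t
    = (LINT z:{0..L}|lborel. dker L (t - tau (n - Suc j)) z x * U_free L a p tau n j z (tau (n - Suc j)))"
proof -
  let ?s = "tau (n - Suc j)"
  let ?F = "\<lambda>z ys. dker L (t - ?s) z x * hstep L p tau n j (gint L a p tau n j ys) ys z ?s"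
  define c where "c = tau (n - j) + p"
  have "c > tau (n - j)" using assms by (simp add: c_def)
  from gint_bounded[OF assms(1,2) this assms(3)] obtain C where C: "C \<ge> 0"
    "\<And>ys x. \<bar>gint L a p tau n j ys x c\<bar> \<le> C * (\<Prod>i=1..j. std_normal_density (ys i))" by blast
  obtain D where D: "D \<ge> 0" "\<And>z x. \<bar>dker L (t - ?s) z x\<bar> \<le> D"
    using dker_bounded[OF assms(1), of "t - ?s"] assms(4) by auto
  note h = hstep_abs_le[of L a p tau n j _ C, OF C(2)[unfolded c_def]]
  have F: "\<bar>?F z ys\<bar> \<le> D * C * (\<Prod>i=1..Suc j. std_normal_density (ys i))" for z ys
    unfolding abs_mult mult.assoc using D h by (intro mult_mono) (auto simp del: prod.cl_ivl_Suc)
  note hstep_measurable[OF measurable_gint, measurable]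
  have "U_barrier L a p tau n (Suc j) x t = iint UNIV (Suc j) (\<lambda>ys. LINT z:{0..L}|lborel. ?F z ys) (\<lambda>_. 0)"
    using U_barrier_gint[OF assms(1,2,4,3)] by simp
  also have "\<dots> = (LINT z:{0..L}|lborel. iint UNIV (Suc j) (?F z) (\<lambda>_. 0))"
    by (rule iint_swap[where C="D * C"]) (measurable, rule F)
  finally show ?thesis
    unfolding iint_cmult U_free_gint[where tau=tau and n=n, OF assms(1-3)] .
qed

lemma measurable_U_barrier:
  assumes "L > 0" "p > 0" "t > tau (n - j)" "tau n = 0"
  shows "(\<lambda>x. U_barrier L a p tau n j x t) \<in> borel_measurable borel"
proof -
  have "(\<lambda>w. iint UNIV j (\<lambda>ys. gint L a p tau n j ys (fst w) t) (snd w)) \<in> borel_measurable (borel \<Otimes>\<^sub>M Pi\<^sub>M UNIV (\<lambda>_. borel))"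
    by (rule measurable_iint[where F="\<lambda>x ys. gint L a p tau n j ys x t"]) (auto intro: measurable_gint)
  from measurable_compose[OF _ this, of "\<lambda>x. (x, \<lambda>_. 0)" borel] show ?thesis
    unfolding U_barrier_gint[OF assms] by (simp add: measurable_Pair space_PiM)
qed

lemma U_barrier_bounded:
  assumes "L > 0" "p > 0" "t > tau (n - j)" "tau n = 0"
  obtains C where "\<And>x. \<bar>U_barrier L a p tau n j x t\<bar> \<le> C"
proof -
  from gint_bounded[OF assms] obtain C where
    "\<And>ys x. \<bar>gint L a p tau n j ys x t\<bar> \<le> C * (\<Prod>i=1..j. std_normal_density (ys i))" by blast
  then have "\<bar>U_barrier L a p tau n j x t\<bar> \<le> C" for x
    unfolding U_barrier_gint[OF assms] by (rule abs_iint_UNIV_le)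
  then show ?thesis by (rule that)
qed

section \<open>Gaussian convolution of sine modes\<close>

text \<open>Real and imaginary part of the characteristic function of the standard normal
  law.\<close>

lemma std_normal_integral_cos: "(\<integral>z. std_normal_density z * cos (t * z) \<partial>lborel) = exp (- t\<^sup>2 / 2)"
  and std_normal_integral_sin: "(\<integral>z. std_normal_density z * sin (t * z) \<partial>lborel) = 0"
proof -
  interpret real_distribution std_normal_distribution by (rule real_dist_normal_dist)
  have int: "integrable std_normal_distribution (\<lambda>x. iexp (t * x))"
    using integrable_iexp[of "\<lambda>x. t * x"] by simp
  have eq: "(\<integral>x. iexp (t * x) \<partial>std_normal_distribution) = complex_of_real (exp (- t\<^sup>2 / 2))"
    using fun_cong[OF char_std_normal_distribution, of t] by (simp add: char_def flip: exp_of_real)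
  have "Re (\<integral>x. iexp (t * x) \<partial>std_normal_distribution) = (\<integral>x. cos (t * x) \<partial>std_normal_distribution)"
    by (subst integral_Re[OF int, symmetric]) (simp add: Re_exp)
  also have "\<dots> = (\<integral>z. std_normal_density z * cos (t * z) \<partial>lborel)"
    by (subst integral_density) auto
  finally show "(\<integral>z. std_normal_density z * cos (t * z) \<partial>lborel) = exp (- t\<^sup>2 / 2)"
    unfolding eq by simp
  have "Im (\<integral>x. iexp (t * x) \<partial>std_normal_distribution) = (\<integral>x. sin (t * x) \<partial>std_normal_distribution)"
    by (subst integral_Im[OF int, symmetric]) (simp add: Im_exp)
  also have "\<dots> = (\<integral>z. std_normal_density z * sin (t * z) \<partial>lborel)"
    by (subst integral_density) auto
  finally show "(\<integral>z. std_normal_density z * sin (t * z) \<partial>lborel) = 0"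
    unfolding eq by simp
qed

lemma integrable_normal_density_bounded:
  fixes g :: "real \<Rightarrow> real"
  assumes "s > 0" and [measurable]: "g \<in> borel_measurable borel" and "\<And>z. \<bar>g z\<bar> \<le> C"
  shows "integrable lborel (\<lambda>z. normal_density m s z * g z)"
proof (rule Bochner_Integration.integrable_bound)
  show "integrable lborel (\<lambda>z. normal_density m s z * C)"
    using assms by (intro integrable_mult_left) auto
  show "AE z in lborel. norm (normal_density m s z * g z) \<le> norm (normal_density m s z * C)"
    using assms(3) by (intro AE_I2) (auto simp: abs_mult intro!: mult_left_mono order_trans[OF assms(3) abs_ge_self])
qed measurable

lemma normal_density_scale:
  assumes "s > 0"
  shows "s * normal_density 0 s (s * z) = std_normal_density z"
  using assms by (simp add: normal_density_def std_normal_density_def real_sqrt_mult power_mult_distrib field_simps)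

lemma normal_integral_scale:
  fixes f :: "real \<Rightarrow> real"
  assumes "s > 0"
  shows "(\<integral>z. normal_density 0 s z * f z \<partial>lborel) = (\<integral>z. std_normal_density z * f (s * z) \<partial>lborel)"
proof -
  have "(\<integral>z. normal_density 0 s z * f z \<partial>lborel) = \<bar>s\<bar> *\<^sub>R (\<integral>z. normal_density 0 s (0 + s * z) * f (0 + s * z) \<partial>lborel)"
    using assms by (intro lborel_integral_real_affine) auto
  also have "\<dots> = (\<integral>z. s * normal_density 0 s (s * z) * f (s * z) \<partial>lborel)"
    using assms by (simp add: mult.assoc)
  finally show ?thesis unfolding normal_density_scale[OF assms] .
qed

text \<open>By the addition formula only the cosine average survives, so sines are eigenfunctions of
  Gaussian convolution.\<close>

lemma normal_integral_sin:
  assumes "s > 0"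
  shows "(\<integral>z. normal_density 0 s z * sin (\<theta> + \<kappa> * z) \<partial>lborel) = exp (- \<kappa>\<^sup>2 * s\<^sup>2 / 2) * sin \<theta>"
proof -
  have int: "integrable lborel (\<lambda>z. std_normal_density z * cos (\<kappa> * s * z))"
    "integrable lborel (\<lambda>z. std_normal_density z * sin (\<kappa> * s * z))"
    by (rule integrable_normal_density_bounded[where C=1]; simp)+
  have "(\<integral>z. normal_density 0 s z * sin (\<theta> + \<kappa> * z) \<partial>lborel)
      = (\<integral>z. std_normal_density z * sin (\<theta> + \<kappa> * (s * z)) \<partial>lborel)"
    by (rule normal_integral_scale[OF assms])
  also have "\<dots> = (\<integral>z. sin \<theta> * (std_normal_density z * cos (\<kappa> * s * z))
        + cos \<theta> * (std_normal_density z * sin (\<kappa> * s * z)) \<partial>lborel)"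
    by (rule Bochner_Integration.integral_cong) (auto simp: sin_add algebra_simps)
  also have "\<dots> = sin \<theta> * exp (- (\<kappa> * s)\<^sup>2 / 2)"
    by (subst Bochner_Integration.integral_add)
       (use int in \<open>simp_all add: std_normal_integral_cos std_normal_integral_sin\<close>)
  finally show ?thesis by (simp add: power_mult_distrib)
qed

text \<open>Chebyshev's inequality with the fourth moment 3 s^4: beyond \<epsilon> one has 1 <=
  (z/\<epsilon>)^4. With s^2 = 2h this is of order h^2, which is small even after multiplication by
  1/h steps.\<close>

lemma normal_integral_tail_le:
  fixes g :: "real \<Rightarrow> real"
  assumes "s > 0" "\<epsilon> > 0" "C \<ge> 0" and [measurable]: "g \<in> borel_measurable borel"
    and "\<And>z. \<bar>g z\<bar> \<le> C" "\<And>z. \<bar>z\<bar> \<le> \<epsilon> \<Longrightarrow> g z \<le> 0"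
  shows "(\<integral>z. normal_density 0 s z * g z \<partial>lborel) \<le> 3 * C * s ^ 4 / \<epsilon> ^ 4"
proof -
  have m: "has_bochner_integral lborel (\<lambda>z. normal_density 0 s z * z ^ 4) (3 * s ^ 4)"
    using normal_moment_even[OF assms(1), of 0 2] by (simp add: fact_numeral field_simps)
  have m': "has_bochner_integral lborel (\<lambda>z. C / \<epsilon> ^ 4 * (normal_density 0 s z * z ^ 4)) (C / \<epsilon> ^ 4 * (3 * s ^ 4))"
    by (rule has_bochner_integral_mult_right[OF m])
  have "(\<integral>z. normal_density 0 s z * g z \<partial>lborel) \<le> (\<integral>z. C / \<epsilon> ^ 4 * (normal_density 0 s z * z ^ 4) \<partial>lborel)"
  proof (rule integral_mono)
    show "integrable lborel (\<lambda>z. normal_density 0 s z * g z)"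
      by (rule integrable_normal_density_bounded) (use assms in auto)
    show "integrable lborel (\<lambda>z. C / \<epsilon> ^ 4 * (normal_density 0 s z * z ^ 4))" using m' by (rule integrable.intros)
    fix z
    have "g z \<le> C * (z / \<epsilon>) ^ 4"
    proof (cases "\<bar>z\<bar> \<le> \<epsilon>")
      case True
      then show ?thesis using assms(6)[of z] assms(3) by (smt (verit) mult_nonneg_nonneg zero_le_even_power even_numeral)
    next
      case False
      then have "1 \<le> \<bar>z / \<epsilon>\<bar>" using assms(2) by simp
      then have "1 \<le> \<bar>z / \<epsilon>\<bar> ^ 4" by (rule one_le_power)
      then have "1 \<le> (z / \<epsilon>) ^ 4" using power_even_abs[of 4 "z / \<epsilon>"] by simp
      then have "C * 1 \<le> C * (z / \<epsilon>) ^ 4" using assms(3) by (intro mult_left_mono) auto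
      then show ?thesis using assms(5)[of z] by linarith
    qed
    then have "normal_density 0 s z * g z \<le> normal_density 0 s z * (C * (z / \<epsilon>) ^ 4)"
      by (rule mult_left_mono) simp
    then show "normal_density 0 s z * g z \<le> C / \<epsilon> ^ 4 * (normal_density 0 s z * z ^ 4)"
      by (simp add: power_divide mult_ac)
  qed
  also have "\<dots> = C / \<epsilon> ^ 4 * (3 * s ^ 4)" using m' by (rule has_bochner_integral_integral_eq)
  finally show ?thesis by (simp add: mult_ac)
qed

section \<open>Sine modes and one step of the killed walk\<close>

lemma abs_sin_multiple_le: "\<bar>sin (real k * \<theta>)\<bar> \<le> real k * \<bar>sin \<theta>\<bar>"
proof (induction k)
  case (Suc k)
  have "\<bar>sin (real (Suc k) * \<theta>)\<bar> = \<bar>sin (real k * \<theta>) * cos \<theta> + cos (real k * \<theta>) * sin \<theta>\<bar>"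
    by (simp add: algebra_simps sin_add)
  also have "\<dots> \<le> \<bar>sin (real k * \<theta>)\<bar> * \<bar>cos \<theta>\<bar> + \<bar>cos (real k * \<theta>)\<bar> * \<bar>sin \<theta>\<bar>"
    by (simp flip: abs_mult)
  also have "\<dots> \<le> \<bar>sin (real k * \<theta>)\<bar> * 1 + 1 * \<bar>sin \<theta>\<bar>"
    by (intro add_mono mult_mono) auto
  finally show ?case using Suc by (simp add: algebra_simps)
qed simp

text \<open>Separated solution of u_t = u_xx on \<open>[a, b]\<close> with zero boundary values. In
  this normalisation running the heat flow for time h means convolution with variance 2h, hence the
  recurring \<open>sqrt (2 * h)\<close>.\<close>

definition mode :: "real \<Rightarrow> real \<Rightarrow> nat \<Rightarrow> real \<Rightarrow> real \<Rightarrow> real" where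
  "mode a b k x t = exp (- ((real k * pi / (b - a))\<^sup>2) * t) * sin (real k * pi * (x - a) / (b - a))"

definition posmode :: "real \<Rightarrow> real \<Rightarrow> nat \<Rightarrow> real \<Rightarrow> real \<Rightarrow> real" where
  "posmode a b k x t = mode a b k x t + real k * mode a b 1 x t"

lemma measurable_mode [measurable (raw)]:
  assumes [measurable]: "f \<in> borel_measurable N"
  shows "(\<lambda>w. mode a b k (f w) t) \<in> borel_measurable N"
  unfolding mode_def by measurable

lemma measurable_posmode [measurable (raw)]:
  assumes [measurable]: "f \<in> borel_measurable N"
  shows "(\<lambda>w. posmode a b k (f w) t) \<in> borel_measurable N"
  unfolding posmode_def by measurable

lemma abs_mode_le: "t \<ge> 0 \<Longrightarrow> \<bar>mode a b k x t\<bar> \<le> 1"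
  unfolding mode_def abs_mult
  by (rule mult_le_one) auto

lemma abs_posmode_le:
  assumes "t \<ge> 0" "k \<ge> 1"
  shows "\<bar>posmode a b k x t\<bar> \<le> 2 * real k"
proof -
  have "\<bar>posmode a b k x t\<bar> \<le> \<bar>mode a b k x t\<bar> + real k * \<bar>mode a b 1 x t\<bar>"
    unfolding posmode_def by (rule order_trans[OF abs_triangle_ineq]) (simp add: abs_mult)
  also have "\<dots> \<le> 1 + real k * 1" using assms by (intro add_mono mult_left_mono abs_mode_le) auto
  finally show ?thesis using assms by simp
qed

text \<open>Adding \<open>k\<close> times the ground state makes the \<open>k\<close>-th mode nonnegative, because
  \<open>\<bar>sin k\<theta>\<bar> \<le> k sin \<theta>\<close> and the ground state decays slowest.\<close>

lemma posmode_nonneg: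
  assumes "a < b" "t \<ge> 0" "k \<ge> 1" "x \<in> {a..b}"
  shows "posmode a b k x t \<ge> 0"
proof -
  define \<theta> where "\<theta> = pi * (x - a) / (b - a)"
  have \<theta>: "0 \<le> \<theta>" "\<theta> \<le> pi" using assms by (auto simp: \<theta>_def field_simps)
  have s: "sin \<theta> \<ge> 0" using \<theta> by (rule sin_ge_zero)
  have "(pi / (b - a))\<^sup>2 * t * 1 \<le> (pi / (b - a))\<^sup>2 * t * (real k)\<^sup>2"
    using assms by (intro mult_left_mono) (auto simp: one_le_power)
  then have e: "exp (- ((real k * pi / (b - a))\<^sup>2) * t) \<le> exp (- ((pi / (b - a))\<^sup>2) * t)"
    by (simp add: power_mult_distrib power_divide mult_ac)
  have "\<bar>mode a b k x t\<bar> = exp (- ((real k * pi / (b - a))\<^sup>2) * t) * \<bar>sin (real k * \<theta>)\<bar>"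
    by (simp add: mode_def \<theta>_def abs_mult mult_ac)
  also have "\<dots> \<le> exp (- ((pi / (b - a))\<^sup>2) * t) * (real k * \<bar>sin \<theta>\<bar>)"
    by (intro mult_mono e abs_sin_multiple_le) auto
  also have "\<dots> = real k * mode a b 1 x t"
    using s by (simp add: mode_def \<theta>_def)
  finally show ?thesis unfolding posmode_def by linarith
qed

text \<open>The mode is odd about both ends. Its sign in the two neighbouring copies of the interval
  is thus opposite to the sign inside, which is what the subsolution estimate needs.\<close>

lemma mode_reflect:
  assumes "a < b"
  shows "mode a b k (2 * a - x) t = - mode a b k x t"
    "mode a b k (2 * b - x) t = - mode a b k x t"
proof -
  have "real k * pi * (2 * a - x - a) / (b - a) = - (real k * pi * (x - a) / (b - a))"
    using assms by (simp add: field_simps)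
  then show "mode a b k (2 * a - x) t = - mode a b k x t"
    unfolding mode_def by (simp only: sin_minus mult_minus_right)
  have *: "real k * pi * (2 * b - x - a) / (b - a) = 2 * real k * pi - (real k * pi * (x - a) / (b - a))"
    using assms by (simp add: field_simps)
  have "sin (2 * real k * pi - (real k * pi * (x - a) / (b - a))) = - sin (real k * pi * (x - a) / (b - a))"
    by (simp add: sin_diff sin_2npi cos_2npi)
  then show "mode a b k (2 * b - x) t = - mode a b k x t"
    unfolding mode_def * by simp
qed

lemma posmode_reflect:
  assumes "a < b"
  shows "posmode a b k (2 * a - x) t = - posmode a b k x t"
    "posmode a b k (2 * b - x) t = - posmode a b k x t"
  using mode_reflect[OF assms] by (simp_all add: posmode_def)

lemma mode_heat:
  assumes "h > 0"
  shows "(\<integral>z. normal_density 0 (sqrt (2 * h)) z * mode a b k (x + z) t \<partial>lborel) = mode a b k x (t + h)"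
proof -
  define \<kappa> where "\<kappa> = real k * pi / (b - a)"
  have "(\<integral>z. normal_density 0 (sqrt (2 * h)) z * mode a b k (x + z) t \<partial>lborel)
    = (\<integral>z. exp (- \<kappa>\<^sup>2 * t) * (normal_density 0 (sqrt (2 * h)) z * sin (\<kappa> * (x - a) + \<kappa> * z)) \<partial>lborel)"
    by (rule Bochner_Integration.integral_cong)
       (auto simp: mode_def \<kappa>_def algebra_simps add_divide_distrib diff_divide_distrib)
  also have "\<dots> = exp (- \<kappa>\<^sup>2 * t) * (exp (- \<kappa>\<^sup>2 * (sqrt (2 * h))\<^sup>2 / 2) * sin (\<kappa> * (x - a)))"
    using assms by (simp only: integral_mult_right_zero normal_integral_sin real_sqrt_gt_0_iff zero_less_mult_iff zero_less_numeral)
       (simp add: normal_integral_sin)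
  also have "\<dots> = mode a b k x (t + h)"
    using assms by (simp add: mode_def \<kappa>_def algebra_simps flip: exp_add)
  finally show ?thesis .
qed

lemma integrable_normal_mode:
  assumes "h > 0" "t \<ge> 0"
  shows "integrable lborel (\<lambda>z. normal_density 0 (sqrt (2 * h)) z * mode a b k (x + z) t)"
  using assms by (intro integrable_normal_density_bounded[where C=1]) (auto simp: abs_mode_le)

lemma posmode_heat:
  assumes "h > 0" "t \<ge> 0"
  shows "(\<integral>z. normal_density 0 (sqrt (2 * h)) z * posmode a b k (x + z) t \<partial>lborel) = posmode a b k x (t + h)"
proof -
  have "(\<integral>z. normal_density 0 (sqrt (2 * h)) z * posmode a b k (x + z) t \<partial>lborel)
    = (\<integral>z. normal_density 0 (sqrt (2 * h)) z * mode a b k (x + z) t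
        + real k * (normal_density 0 (sqrt (2 * h)) z * mode a b 1 (x + z) t) \<partial>lborel)"
    by (rule Bochner_Integration.integral_cong) (auto simp: posmode_def algebra_simps)
  also have "\<dots> = mode a b k x (t + h) + real k * mode a b 1 x (t + h)"
    using assms integrable_normal_mode by (subst Bochner_Integration.integral_add) (simp_all add: mode_heat)
  finally show ?thesis by (simp add: posmode_def)
qed

text \<open>One step of the walk killed outside \<open>[a, b]\<close>. The mode of a slightly larger interval is a
  supersolution and the mode of \<open>[a, b]\<close> itself a subsolution, up to an error of order \<open>h\<^sup>2\<close>,
  which stays negligible after \<open>1/h\<close> steps.\<close>

lemma killed_step_upper:
  assumes "a < b" "\<epsilon> > 0" "h > 0" "t \<ge> 0" "k \<ge> 1" "x \<in> {a..b}"
  shows "(\<integral>z. normal_density 0 (sqrt (2 * h)) z * (indicator {a..b} (x + z) * posmode (a - \<epsilon>) (b + \<epsilon>) k (x + z) t) \<partial>lborel)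
    \<le> posmode (a - \<epsilon>) (b + \<epsilon>) k x (t + h) + 24 * real k / \<epsilon> ^ 4 * h\<^sup>2"
proof -
  let ?s = "sqrt (2 * h)" and ?f = "\<lambda>z. posmode (a - \<epsilon>) (b + \<epsilon>) k (x + z) t"
  have s: "?s > 0" "?s ^ 4 = 4 * h\<^sup>2" using assms
    by (simp_all add: power4_eq_xxxx power2_eq_square)
  have k: "\<bar>?f z\<bar> \<le> 2 * real k" for z using assms by (intro abs_posmode_le) auto
  have int: "integrable lborel (\<lambda>z. normal_density 0 ?s z * (indicator {a..b} (x + z) * ?f z))"
    "integrable lborel (\<lambda>z. normal_density 0 ?s z * ?f z)"
    using s k by (auto intro!: integrable_normal_density_bounded[where C="2 * real k"] simp: abs_mult split: split_indicator)
  have "(\<integral>z. normal_density 0 ?s z * (indicator {a..b} (x + z) * ?f z) \<partial>lborel) - posmode (a - \<epsilon>) (b + \<epsilon>) k x (t + h)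
     = (\<integral>z. normal_density 0 ?s z * (indicator {a..b} (x + z) * ?f z) - normal_density 0 ?s z * ?f z \<partial>lborel)"
    unfolding posmode_heat[OF assms(3,4), symmetric] by (rule Bochner_Integration.integral_diff[symmetric, OF int])
  also have "\<dots> = (\<integral>z. normal_density 0 ?s z * ((indicator {a..b} (x + z) - 1) * ?f z) \<partial>lborel)"
    by (simp add: algebra_simps)
  \<comment> \<open>A jump of size at most \<epsilon> from a point of \<open>[a, b]\<close> lands
    where the larger mode is nonnegative, so dropping it cannot increase the integral. Only longer
    jumps cost; 3 * 2k * 4h^2 gives the constant 24.\<close>
  also have "\<dots> \<le> 3 * (2 * real k) * ?s ^ 4 / \<epsilon> ^ 4"
  proof (rule normal_integral_tail_le)
    fix z
    show "\<bar>(indicator {a..b} (x + z) - 1) * ?f z\<bar> \<le> 2 * real k" using k[of z] by (auto split: split_indicator)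
    assume "\<bar>z\<bar> \<le> \<epsilon>"
    then have "?f z \<ge> 0" using assms by (intro posmode_nonneg) auto
    then show "(indicator {a..b} (x + z) - 1) * ?f z \<le> 0" by (auto split: split_indicator)
  qed (use s assms in auto)
  finally show ?thesis unfolding s by simp
qed

lemma killed_step_lower:
  assumes "a < b" "h > 0" "t \<ge> 0" "k \<ge> 1" "x \<in> {a..b}"
  shows "(\<integral>z. normal_density 0 (sqrt (2 * h)) z * (indicator {a..b} (x + z) * posmode a b k (x + z) t) \<partial>lborel)
    \<ge> posmode a b k x (t + h) - 24 * real k / (b - a) ^ 4 * h\<^sup>2"
proof -
  let ?s = "sqrt (2 * h)" and ?f = "\<lambda>z. posmode a b k (x + z) t"
  have s: "?s > 0" "?s ^ 4 = 4 * h\<^sup>2" using assms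
    by (simp_all add: power4_eq_xxxx power2_eq_square)
  have k: "\<bar>?f z\<bar> \<le> 2 * real k" for z using assms by (intro abs_posmode_le) auto
  have int: "integrable lborel (\<lambda>z. normal_density 0 ?s z * (indicator {a..b} (x + z) * ?f z))"
    "integrable lborel (\<lambda>z. normal_density 0 ?s z * ?f z)"
    using s k by (auto intro!: integrable_normal_density_bounded[where C="2 * real k"] simp: abs_mult split: split_indicator)
  have "posmode a b k x (t + h) - (\<integral>z. normal_density 0 ?s z * (indicator {a..b} (x + z) * ?f z) \<partial>lborel)
     = (\<integral>z. normal_density 0 ?s z * ?f z - normal_density 0 ?s z * (indicator {a..b} (x + z) * ?f z) \<partial>lborel)"
    unfolding posmode_heat[OF assms(2,3), symmetric] by (rule Bochner_Integration.integral_diff[symmetric, OF int(2,1)])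
  also have "\<dots> = (\<integral>z. normal_density 0 ?s z * ((1 - indicator {a..b} (x + z)) * ?f z) \<partial>lborel)"
    by (simp add: algebra_simps)
  \<comment> \<open>A jump of size at most b - a that leaves the interval ends in an adjacent
    reflected copy, where the mode is nonpositive; killing it only helps the lower bound. The margin
    is therefore b - a, with no enlargement.\<close>
  also have "\<dots> \<le> 3 * (2 * real k) * ?s ^ 4 / (b - a) ^ 4"
  proof (rule normal_integral_tail_le)
    fix z
    show "\<bar>(1 - indicator {a..b} (x + z)) * ?f z\<bar> \<le> 2 * real k" using k[of z] by (auto split: split_indicator)
    assume z: "\<bar>z\<bar> \<le> b - a"
    show "(1 - indicator {a..b} (x + z)) * ?f z \<le> 0"
    proof (cases "x + z \<in> {a..b}")
      case False
      have "?f z \<le> 0"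
      proof (cases "x + z < a")
        case True
        have "posmode a b k (2 * a - (x + z)) t \<ge> 0" using True z assms by (intro posmode_nonneg) auto
        then show ?thesis using posmode_reflect(1)[OF assms(1)] by simp
      next
        case f: False
        have "posmode a b k (2 * b - (x + z)) t \<ge> 0" using f False z assms by (intro posmode_nonneg) auto
        then show ?thesis using posmode_reflect(2)[OF assms(1)] by simp
      qed
      then show ?thesis using False by simp
    qed simp
  qed (use s assms in auto)
  finally show ?thesis unfolding s by simp
qed

text \<open>A one-step Cameron--Martin formula by completing the square: the tilt with exponent -
  mu/sigma^2 turns a Gaussian step with drift into a centred one, up to a factor that depends only
  on the duration. The variance sigma^2 d corresponds to heat time sigma^2 d / 2.\<close>

lemma normal_integral_drift:
  fixes f :: "real \<Rightarrow> real"
  assumes "\<sigma> > 0" "d > 0"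
  shows "(\<integral>z. normal_density 0 (sqrt d) z * (exp (- \<mu> / \<sigma>\<^sup>2 * (x + \<mu> * d + \<sigma> * z)) * f (x + \<mu> * d + \<sigma> * z)) \<partial>lborel)
    = exp (- \<mu>\<^sup>2 / (2 * \<sigma>\<^sup>2) * d) * (exp (- \<mu> / \<sigma>\<^sup>2 * x)
        * (\<integral>z. normal_density 0 (sqrt (2 * (\<sigma>\<^sup>2 / 2 * d))) z * f (x + z) \<partial>lborel))"
proof -
  define s where "s = sqrt (2 * (\<sigma>\<^sup>2 / 2 * d))"
  have s2: "s\<^sup>2 = \<sigma>\<^sup>2 * d" and s: "s = \<sigma> * sqrt d" using assms by (auto simp: s_def real_sqrt_mult power_mult_distrib)
  have *: "normal_density 0 (sqrt d) z * exp (- \<mu> / \<sigma>\<^sup>2 * (x + \<mu> * d + \<sigma> * z))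
     = exp (- \<mu>\<^sup>2 / (2 * \<sigma>\<^sup>2) * d) * exp (- \<mu> / \<sigma>\<^sup>2 * x) * (\<sigma> * normal_density 0 s (\<mu> * d + \<sigma> * z))" for z
  proof -
    \<comment> \<open>The square being completed is (mu d + sigma z)^2, the displacement of the step
      with drift.\<close>
    have e: "- (z\<^sup>2) / (2 * d) + - \<mu> / \<sigma>\<^sup>2 * (x + \<mu> * d + \<sigma> * z)
        = - \<mu>\<^sup>2 / (2 * \<sigma>\<^sup>2) * d + - \<mu> / \<sigma>\<^sup>2 * x + - ((\<mu> * d + \<sigma> * z)\<^sup>2) / (2 * (\<sigma>\<^sup>2 * d))"
      using assms by (simp add: field_simps power2_eq_square)
    have "sqrt (2 * pi * s\<^sup>2) = \<sigma> * sqrt (2 * pi * (sqrt d)\<^sup>2)"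
      unfolding s2 using assms by (simp add: real_sqrt_mult)
    then have "\<sigma> * normal_density 0 s (\<mu> * d + \<sigma> * z) = 1 / sqrt (2 * pi * (sqrt d)\<^sup>2) * exp (- ((\<mu> * d + \<sigma> * z)\<^sup>2) / (2 * (\<sigma>\<^sup>2 * d)))"
      unfolding normal_density_def using assms by (simp add: s2)
    moreover have "normal_density 0 (sqrt d) z = 1 / sqrt (2 * pi * (sqrt d)\<^sup>2) * exp (- (z\<^sup>2) / (2 * d))"
      using assms by (simp add: normal_density_def)
    ultimately show ?thesis using e by (simp add: exp_add[symmetric] mult_ac)
  qed
  have "(\<integral>z. normal_density 0 s z * f (x + z) \<partial>lborel)
     = \<bar>\<sigma>\<bar> *\<^sub>R (\<integral>z. normal_density 0 s (\<mu> * d + \<sigma> * z) * f (x + (\<mu> * d + \<sigma> * z)) \<partial>lborel)"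
    using assms by (intro lborel_integral_real_affine) auto
  also have "\<dots> = (\<integral>z. \<sigma> * normal_density 0 s (\<mu> * d + \<sigma> * z) * f (x + \<mu> * d + \<sigma> * z) \<partial>lborel)"
    using assms by (simp add: mult.assoc add.assoc)
  finally have **: "(\<integral>z. normal_density 0 s z * f (x + z) \<partial>lborel)
    = (\<integral>z. \<sigma> * normal_density 0 s (\<mu> * d + \<sigma> * z) * f (x + \<mu> * d + \<sigma> * z) \<partial>lborel)" .
  show ?thesis
    unfolding s_def[symmetric] unfolding ** unfolding mult.assoc[symmetric] *
    by (simp only: mult.assoc integral_mult_right_zero)
qed

section \<open>The walk killed outside a strip\<close>

locale bm_drift =
  fixes M :: "'a measure" and F :: "real \<Rightarrow> 'a measure" and W :: "real \<Rightarrow> 'a \<Rightarrow> real"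
    and x0 \<mu> \<sigma> :: real
  assumes BM: "std_BM M F W" and sigma: "\<sigma> > 0"
begin

sublocale prob_space M
  using BM by (simp add: std_BM_def)

definition X :: "real \<Rightarrow> 'a \<Rightarrow> real" where
  "X u \<omega> = x0 + \<mu> * u + \<sigma> * W u \<omega>"

definition al :: real where "al = - \<mu> / \<sigma>\<^sup>2"

text \<open>The decay rate paid for the tilt. For mu = r - sigma^2/2 one has \<open>al\<close> =
  \<alpha> and sigma^2/2 * \<beta> = - r - nu.\<close>

definition nu :: real where "nu = \<mu>\<^sup>2 / (2 * \<sigma>\<^sup>2)"

abbreviation tilt :: "real \<Rightarrow> 'a \<Rightarrow> real" where "tilt u \<omega> \<equiv> exp (al * X u \<omega>)"

definition stay :: "real \<Rightarrow> real \<Rightarrow> real \<Rightarrow> real \<Rightarrow> 'a set" where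
  "stay a b s t = {\<omega> \<in> space M. \<forall>u\<in>{s..t}. X u \<omega> \<in> {a<..<b}}"

text \<open>Closed interval here, open in \<open>stay\<close>: a path staying in the open strip
  always survives the grid check, and conversely grid survival in a strictly smaller closed interval
  excludes, for fine grids, an exit from the open one.\<close>

definition walk :: "real \<Rightarrow> real \<Rightarrow> real \<Rightarrow> real \<Rightarrow> nat \<Rightarrow> 'a set" where
  "walk a b s d i = {\<omega> \<in> space M. \<forall>l\<le>i. X (s + real l * d) \<omega> \<in> {a..b}}"

lemma nu_nonneg: "nu \<ge> 0" by (simp add: nu_def)

lemma subalg_F: "0 \<le> t \<Longrightarrow> subalgebra M (F t)"
  using BM by (simp add: std_BM_def)

lemma space_F: "0 \<le> t \<Longrightarrow> space (F t) = space M"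
  using subalg_F[of t] by (simp add: subalgebra_def)

lemma measurable_F_mono:
  assumes "0 \<le> s" "s \<le> t" "f \<in> borel_measurable (F s)"
  shows "f \<in> borel_measurable (F t)"
proof -
  have "subalgebra (F t) (F s)"
    using BM assms space_F[of s] space_F[of t] by (auto simp: subalgebra_def std_BM_def)
  then show ?thesis using assms(3) by (rule measurable_from_subalg)
qed

lemma measurable_F_M: "0 \<le> t \<Longrightarrow> f \<in> borel_measurable (F t) \<Longrightarrow> f \<in> borel_measurable M"
  by (rule measurable_from_subalg[OF subalg_F])

lemma measurable_X: "0 \<le> t \<Longrightarrow> X t \<in> borel_measurable (F t)"
proof -
  assume "0 \<le> t"
  then have [measurable]: "W t \<in> borel_measurable (F t)" using BM by (simp add: std_BM_def)
  show "X t \<in> borel_measurable (F t)" unfolding X_def by measurable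
qed

lemma continuous_X: "\<omega> \<in> space M \<Longrightarrow> continuous_on {0..} (\<lambda>u. X u \<omega>)"
  using BM unfolding X_def by (auto intro!: continuous_intros simp: std_BM_def)

section \<open>Markov property and removal of the drift\<close>

lemma integrable_bounded:
  fixes f :: "'a \<Rightarrow> real"
  assumes "f \<in> borel_measurable M" "\<And>\<omega>. \<omega> \<in> space M \<Longrightarrow> \<bar>f \<omega>\<bar> \<le> C"
  shows "integrable M f"
  using assms by (intro integrable_const_bound[where B=C]) (auto intro!: AE_I2)

text \<open>The pair of \<open>Z\<close> and \<open>X s\<close> is measurable with respect to
  \<open>F s\<close>, hence independent of the next increment; the joint law is a product and Fubini
  integrates the increment out first.\<close>

lemma markov:
  fixes f :: "real \<Rightarrow> real"
  assumes st: "0 \<le> s" "s < t" and Z: "Z \<in> borel_measurable (F s)" "\<And>\<omega>. \<omega> \<in> space M \<Longrightarrow> \<bar>Z \<omega>\<bar> \<le> B"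
    and f [measurable]: "f \<in> borel_measurable borel" and fC: "\<And>x. \<bar>f x\<bar> \<le> C"
  shows "(\<integral>\<omega>. Z \<omega> * f (X t \<omega>) \<partial>M)
    = (\<integral>\<omega>. Z \<omega> * (\<integral>z. normal_density 0 (sqrt (t - s)) z * f (X s \<omega> + \<mu> * (t - s) + \<sigma> * z) \<partial>lborel) \<partial>M)"
proof -
  define D where "D \<omega> = W t \<omega> - W s \<omega>" for \<omega>
  have D: "distributed M lborel D (\<lambda>y. ennreal (normal_density 0 (sqrt (t - s)) y))"
    and ind: "indep_set (sets (F s)) (sets (vimage_algebra (space M) D borel))"
    using BM st unfolding std_BM_def D_def by auto
  have Dm [measurable]: "D \<in> borel_measurable M" using D by (simp add: distributed_def)
  have [measurable]: "Z \<in> borel_measurable M" "X s \<in> borel_measurable M"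
    using measurable_F_M[OF st(1)] Z(1) measurable_X[OF st(1)] by auto
  define U where "U \<omega> = (Z \<omega>, X s \<omega>)" for \<omega>
  have UF: "U \<in> measurable (F s) (borel \<Otimes>\<^sub>M borel)"
    unfolding U_def using Z(1) measurable_X[OF st(1)] by measurable
  have [measurable]: "U \<in> measurable M (borel \<Otimes>\<^sub>M borel)"
    unfolding U_def by measurable
  \<comment> \<open>\<open>indep_var\<close> takes two variables of the same type, so the increment
    is padded with a zero to be a pair like \<open>U\<close>.\<close>
  define D' where "D' \<omega> = (D \<omega>, 0 :: real)" for \<omega>
  have [measurable]: "D' \<in> measurable M (borel \<Otimes>\<^sub>M borel)"
    unfolding D'_def by measurable
  have iv: "indep_var (borel \<Otimes>\<^sub>M borel) U (borel \<Otimes>\<^sub>M borel) D'"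
    unfolding indep_var_eq
  proof (intro conjI)
    have 1: "sigma_sets (space M) {U -` A \<inter> space M |A. A \<in> sets (borel \<Otimes>\<^sub>M borel)} \<subseteq> sets (F s)"
    proof -
      have "{U -` A \<inter> space M |A. A \<in> sets (borel \<Otimes>\<^sub>M borel)} \<subseteq> sets (F s)"
        using measurable_sets[OF UF] space_F[OF st(1)] by auto
      then show ?thesis using sets.sigma_sets_subset[of _ "F s"] space_F[OF st(1)] by simp
    qed
    have 2: "sigma_sets (space M) {D' -` A \<inter> space M |A. A \<in> sets (borel \<Otimes>\<^sub>M borel)} \<subseteq> sets (vimage_algebra (space M) D borel)"
    proof -
      have [measurable]: "D \<in> borel_measurable (vimage_algebra (space M) D borel)"
        by (rule measurable_vimage_algebra1) auto
      have "D' \<in> measurable (vimage_algebra (space M) D borel) (borel \<Otimes>\<^sub>M borel)"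
        unfolding D'_def by measurable
      then have "{D' -` A \<inter> space M |A. A \<in> sets (borel \<Otimes>\<^sub>M borel)} \<subseteq> sets (vimage_algebra (space M) D borel)"
        using measurable_sets[of D' "vimage_algebra (space M) D borel" "borel \<Otimes>\<^sub>M borel"] by auto
      then show ?thesis using sets.sigma_sets_subset[of _ "vimage_algebra (space M) D borel"] by simp
    qed
    show "indep_set (sigma_sets (space M) {U -` A \<inter> space M |A. A \<in> sets (borel \<Otimes>\<^sub>M borel)})
      (sigma_sets (space M) {D' -` A \<inter> space M |A. A \<in> sets (borel \<Otimes>\<^sub>M borel)})"
      using ind 1 2 unfolding indep_set_def
      by (rule_tac indep_sets_mono_sets) (auto split: bool.splits)
  qed measurable
  let ?g = "\<lambda>w. fst (fst w) * f (snd (fst w) + \<mu> * (t - s) + \<sigma> * fst (snd w))"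
  let ?PU = "distr M (borel \<Otimes>\<^sub>M borel) U" and ?PD = "distr M (borel \<Otimes>\<^sub>M borel) D'"
  have gm [measurable]: "?g \<in> borel_measurable ((borel \<Otimes>\<^sub>M borel) \<Otimes>\<^sub>M (borel \<Otimes>\<^sub>M borel))" by measurable
  interpret PU: prob_space ?PU by (rule prob_space_distr) measurable
  interpret PD: prob_space ?PD by (rule prob_space_distr) measurable
  interpret P: pair_sigma_finite ?PU ?PD ..
  have eq: "?PU \<Otimes>\<^sub>M ?PD = distr M ((borel \<Otimes>\<^sub>M borel) \<Otimes>\<^sub>M (borel \<Otimes>\<^sub>M borel)) (\<lambda>\<omega>. (U \<omega>, D' \<omega>))"
    using iv unfolding indep_var_distribution_eq by simp
  have XD: "X t \<omega> = X s \<omega> + \<mu> * (t - s) + \<sigma> * D \<omega>" for \<omega>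
    by (simp add: X_def D_def algebra_simps)
  have int: "integrable M (\<lambda>\<omega>. ?g (U \<omega>, D' \<omega>))"
  proof (rule integrable_bounded)
    fix \<omega> assume "\<omega> \<in> space M"
    show "\<bar>?g (U \<omega>, D' \<omega>)\<bar> \<le> B * C"
      unfolding abs_mult using Z(2)[OF \<open>\<omega> \<in> space M\<close>] fC by (intro mult_mono) (auto simp: U_def)
  qed measurable
  have int2: "integrable (?PU \<Otimes>\<^sub>M ?PD) ?g"
    unfolding eq using int by (subst integrable_distr_eq) auto
  have PD: "(\<integral>y. ?g (u, y) \<partial>?PD) = fst u * (\<integral>z. normal_density 0 (sqrt (t - s)) z * f (snd u + \<mu> * (t - s) + \<sigma> * z) \<partial>lborel)" for u
  proof -
    have "(\<integral>y. ?g (u, y) \<partial>?PD) = (\<integral>\<omega>. f (snd u + \<mu> * (t - s) + \<sigma> * D \<omega>) \<partial>M) * fst u"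
      by (subst integral_distr) (auto simp: D'_def)
    also have "(\<integral>\<omega>. f (snd u + \<mu> * (t - s) + \<sigma> * D \<omega>) \<partial>M)
       = (\<integral>z. normal_density 0 (sqrt (t - s)) z * f (snd u + \<mu> * (t - s) + \<sigma> * z) \<partial>lborel)"
      using distributed_integral[OF D, of "\<lambda>z. f (snd u + \<mu> * (t - s) + \<sigma> * z)"] by simp
    finally show ?thesis by simp
  qed
  have "(\<integral>\<omega>. Z \<omega> * f (X t \<omega>) \<partial>M) = (\<integral>\<omega>. ?g (U \<omega>, D' \<omega>) \<partial>M)"
    by (simp add: XD U_def D'_def)
  also have "\<dots> = (\<integral>w. ?g w \<partial>(?PU \<Otimes>\<^sub>M ?PD))"
    unfolding eq by (subst integral_distr) auto
  also have "\<dots> = (\<integral>u. (\<integral>y. ?g (u, y) \<partial>?PD) \<partial>?PU)"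
    by (rule P.integral_fst'[OF int2, symmetric])
  also have "\<dots> = (\<integral>u. fst u * (\<integral>z. normal_density 0 (sqrt (t - s)) z * f (snd u + \<mu> * (t - s) + \<sigma> * z) \<partial>lborel) \<partial>?PU)"
    unfolding PD ..
  also have "\<dots> = (\<integral>\<omega>. fst (U \<omega>) * (\<integral>z. normal_density 0 (sqrt (t - s)) z * f (snd (U \<omega>) + \<mu> * (t - s) + \<sigma> * z) \<partial>lborel) \<partial>M)"
    by (subst integral_distr) auto
  finally show ?thesis by (simp add: U_def)
qed

text \<open>The tilt turns the step of the drifted motion into a pure heat step of duration
  sigma^2/2 (t - s), with exp(- nu (t - s)) as its price.\<close>

lemma markov_exp:
  fixes f :: "real \<Rightarrow> real"
  assumes st: "0 \<le> s" "s < t" and Z: "Z \<in> borel_measurable (F s)" "\<And>\<omega>. \<omega> \<in> space M \<Longrightarrow> \<bar>Z \<omega>\<bar> \<le> B"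
    and f [measurable]: "f \<in> borel_measurable borel" and fC: "\<And>x. \<bar>exp (al * x) * f x\<bar> \<le> C"
  shows "(\<integral>\<omega>. Z \<omega> * (tilt t \<omega> * f (X t \<omega>)) \<partial>M)
    = exp (- nu * (t - s)) * (\<integral>\<omega>. Z \<omega> * (tilt s \<omega>
        * (\<integral>z. normal_density 0 (sqrt (2 * (\<sigma>\<^sup>2 / 2 * (t - s)))) z * f (X s \<omega> + z) \<partial>lborel)) \<partial>M)"
proof -
  have "(\<integral>\<omega>. Z \<omega> * (tilt t \<omega> * f (X t \<omega>)) \<partial>M)
    = (\<integral>\<omega>. Z \<omega> * (\<integral>z. normal_density 0 (sqrt (t - s)) z *
       (exp (al * (X s \<omega> + \<mu> * (t - s) + \<sigma> * z)) * f (X s \<omega> + \<mu> * (t - s) + \<sigma> * z)) \<partial>lborel) \<partial>M)"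
    by (rule markov[OF st Z, of "\<lambda>x. exp (al * x) * f x"]) (use fC in auto)
  also have "\<dots> = (\<integral>\<omega>. Z \<omega> * (exp (- nu * (t - s)) * (tilt s \<omega>
        * (\<integral>z. normal_density 0 (sqrt (2 * (\<sigma>\<^sup>2 / 2 * (t - s)))) z * f (X s \<omega> + z) \<partial>lborel))) \<partial>M)"
    using normal_integral_drift[OF sigma, of "t - s" \<mu> _ f] st by (simp add: al_def nu_def)
  also have "\<dots> = (\<integral>\<omega>. exp (- nu * (t - s)) * (Z \<omega> * (tilt s \<omega>
        * (\<integral>z. normal_density 0 (sqrt (2 * (\<sigma>\<^sup>2 / 2 * (t - s)))) z * f (X s \<omega> + z) \<partial>lborel))) \<partial>M)"
    by (simp only: mult.left_commute)
  finally show ?thesis by simp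
qed

section \<open>Iterating the killed step along a grid\<close>

lemma walk_sets:
  assumes "0 \<le> s" "0 < d"
  shows "walk a b s d i \<in> sets (F (s + real i * d))"
proof -
  have *: "0 \<le> s + real i * d" using assms by simp
  have [measurable]: "X (s + real l * d) \<in> borel_measurable (F (s + real i * d))" if "l \<in> {..i}" for l
    by (rule measurable_F_mono[OF _ _ measurable_X]) (use assms that in \<open>auto intro!: mult_right_mono\<close>)
  have "walk a b s d i = {\<omega> \<in> space (F (s + real i * d)). \<forall>l\<in>{..i}. X (s + real l * d) \<omega> \<in> {a..b}}"
    using space_F[OF *] by (auto simp: walk_def)
  also have "\<dots> \<in> sets (F (s + real i * d))" by measurable
  finally show ?thesis .
qed

lemma walk_sets_end:
  assumes "0 \<le> s" "s < t" "N \<ge> 1"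
  shows "walk a b s ((t - s) / real N) N \<in> sets (F t)"
proof -
  have "s + real N * ((t - s) / real N) = t" using assms by simp
  then show ?thesis using walk_sets[OF assms(1), of "(t - s) / real N" a b N] assms by simp
qed

lemma sets_F_M: "0 \<le> t \<Longrightarrow> A \<in> sets (F t) \<Longrightarrow> A \<in> sets M"
  using subalg_F[of t] by (auto simp: subalgebra_def)

lemma indicator_walk_Suc:
  "indicator (walk a b s d (Suc i)) \<omega> = (indicator (walk a b s d i) \<omega> * indicator {a..b} (X (s + real (Suc i) * d) \<omega>) :: real)"
  by (auto simp: walk_def le_Suc_eq split: split_indicator)

lemma walk_end: "\<omega> \<in> walk a b s d i \<Longrightarrow> X (s + real i * d) \<omega> \<in> {a..b}"
  by (simp add: walk_def)

text \<open>Each step of the walk is exchanged for a heat step in the second argument of \<psi>, at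
  the cost of the one-step error \<open>e\<close>. Keeping \<psi> abstract serves both directions: a
  mode of a larger interval gives the upper bound, the negative of a mode the lower one.\<close>

lemma killed_walk_le:
  fixes \<psi> :: "real \<Rightarrow> real \<Rightarrow> real"
  assumes s: "0 \<le> s" and d: "0 < d" and Z: "Z \<in> borel_measurable (F s)" "\<And>\<omega>. 0 \<le> Z \<omega>" "\<And>\<omega>. Z \<omega> \<le> B"
    and \<psi> [measurable]: "\<And>t. (\<lambda>x. \<psi> x t) \<in> borel_measurable borel"
    and C: "\<And>x t. 0 \<le> t \<Longrightarrow> \<bar>\<psi> x t\<bar> \<le> C"
    and E: "\<And>x. x \<in> {a..b} \<Longrightarrow> exp (al * x) \<le> E" "0 \<le> E"
    and e: "0 \<le> e"
    and step: "\<And>x t. 0 \<le> t \<Longrightarrow> x \<in> {a..b} \<Longrightarrow>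
      (\<integral>z. normal_density 0 (sqrt (2 * (\<sigma>\<^sup>2 / 2 * d))) z * (indicator {a..b} (x + z) * \<psi> (x + z) t) \<partial>lborel)
        \<le> \<psi> x (t + \<sigma>\<^sup>2 / 2 * d) + e"
    and t: "0 \<le> t"
  shows "exp (nu * (real i * d)) * (\<integral>\<omega>. (Z \<omega> * indicator (walk a b s d i) \<omega>) * (tilt (s + real i * d) \<omega> * \<psi> (X (s + real i * d) \<omega>) t) \<partial>M)
    \<le> (\<integral>\<omega>. (Z \<omega> * indicator (walk a b s d 0) \<omega>) * (tilt s \<omega> * \<psi> (X s \<omega>) (t + real i * (\<sigma>\<^sup>2 / 2 * d))) \<partial>M)
      + real i * (e * (B * E) * exp (nu * (real i * d)))"
  using t
proof (induction i arbitrary: t)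
  case 0
  then show ?case by simp
next
  case (Suc i)
  define u where "u = s + real i * d"
  define u' where "u' = s + real (Suc i) * d"
  define h where "h = \<sigma>\<^sup>2 / 2 * d"
  define J where "J \<omega> = Z \<omega> * indicator (walk a b s d i) \<omega>" for \<omega>
  have u: "0 \<le> u" "u < u'" "u' - u = d" using s d by (auto simp: u_def u'_def algebra_simps)
  have B: "0 \<le> B" using Z(2,3) order_trans by blast
  have Jm: "J \<in> borel_measurable (F u)"
    unfolding J_def using borel_measurable_indicator[OF walk_sets[OF s d, of a b i]] measurable_F_mono[OF s _ Z(1), of u] d
    by (intro borel_measurable_times) (auto simp: u_def)
  have [measurable]: "J \<in> borel_measurable M" "X u \<in> borel_measurable M" "X u' \<in> borel_measurable M"
    using measurable_F_M[OF u(1) Jm] measurable_F_M[OF _ measurable_X] u by auto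
  have J: "0 \<le> J \<omega>" "J \<omega> \<le> B" for \<omega> using Z(2,3)[of \<omega>] B by (auto simp: J_def split: split_indicator)
  \<comment> \<open>The tilt is unbounded on the whole space, but \<open>J\<close> vanishes unless
    the walk is in \<open>[a, b]\<close> at time \<open>u\<close>.\<close>
  have JE: "J \<omega> * tilt u \<omega> \<le> B * E" for \<omega>
  proof (cases "\<omega> \<in> walk a b s d i")
    case True
    then show ?thesis using E(1)[OF walk_end[OF True]] J Z(2,3)[of \<omega>] by (intro mult_mono) (auto simp: u_def B)
  next
    case False
    then show ?thesis using B E(2) by (simp add: J_def)
  qed
  have h: "0 \<le> h" using d by (simp add: h_def)
  have C0: "0 \<le> C" using C[OF Suc.prems, of 0] abs_ge_zero order_trans by blast
  \<comment> \<open>The check at the new grid point goes into the test function, so that the weight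
    \<open>J\<close> is already known at time \<open>u\<close> and the Markov property
    applies.\<close>
  define \<phi> where "\<phi> x = indicator {a..b} x * \<psi> x t" for x
  have [measurable]: "\<phi> \<in> borel_measurable borel" unfolding \<phi>_def by measurable
  have Jint: "integrable M (\<lambda>\<omega>. J \<omega> * (tilt u \<omega> * g \<omega>))"
    if [measurable]: "g \<in> borel_measurable M" and "\<And>\<omega>. \<bar>g \<omega>\<bar> \<le> G" for g G
  proof (rule integrable_bounded)
    fix \<omega>
    have "\<bar>J \<omega> * (tilt u \<omega> * g \<omega>)\<bar> = J \<omega> * tilt u \<omega> * \<bar>g \<omega>\<bar>" using J by (simp add: abs_mult)
    also have "\<dots> \<le> B * E * G" using JE[of \<omega>] B E(2) that(2)[of \<omega>]
      by (rule_tac mult_mono) auto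
    finally show "\<bar>J \<omega> * (tilt u \<omega> * g \<omega>)\<bar> \<le> B * E * G" .
  qed measurable
  have "exp (nu * (real (Suc i) * d)) * (\<integral>\<omega>. (Z \<omega> * indicator (walk a b s d (Suc i)) \<omega>) * (tilt u' \<omega> * \<psi> (X u' \<omega>) t) \<partial>M)
    = exp (nu * (real (Suc i) * d)) * (\<integral>\<omega>. J \<omega> * (tilt u' \<omega> * \<phi> (X u' \<omega>)) \<partial>M)"
    by (simp only: indicator_walk_Suc J_def \<phi>_def u'_def mult_ac)
  also have "(\<integral>\<omega>. J \<omega> * (tilt u' \<omega> * \<phi> (X u' \<omega>)) \<partial>M)
    = exp (- nu * d) * (\<integral>\<omega>. J \<omega> * (tilt u \<omega> * (\<integral>z. normal_density 0 (sqrt (2 * h)) z * \<phi> (X u \<omega> + z) \<partial>lborel)) \<partial>M)"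
    unfolding u(3)[symmetric] h_def
  proof (rule markov_exp[OF u(1,2) Jm])
    show "\<bar>J \<omega>\<bar> \<le> B" for \<omega> using J[of \<omega>] by simp
    show "\<bar>exp (al * x) * \<phi> x\<bar> \<le> \<bar>E\<bar> * C" for x
    proof (cases "x \<in> {a..b}")
      case True
      then show ?thesis unfolding abs_mult \<phi>_def using E(1)[OF True] C[OF Suc.prems, of x]
        by (intro mult_mono) auto
    next
      case False
      then show ?thesis using C[OF Suc.prems, of x] by (simp add: \<phi>_def)
    qed
  qed measurable
  \<comment> \<open>The growth in the prefactor exactly pays for the decay caused by one tilted
    step.\<close>
  also have "exp (nu * (real (Suc i) * d)) * (exp (- nu * d) * A) = exp (nu * (real i * d)) * A" for A
  proof -
    have "exp (nu * (real (Suc i) * d)) * exp (- nu * d) = exp (nu * (real i * d))"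
      by (simp add: algebra_simps flip: exp_add)
    then show ?thesis by (simp only: mult.assoc[symmetric])
  qed
  also have "exp (nu * (real i * d)) * (\<integral>\<omega>. J \<omega> * (tilt u \<omega> * (\<integral>z. normal_density 0 (sqrt (2 * h)) z * \<phi> (X u \<omega> + z) \<partial>lborel)) \<partial>M)
     \<le> exp (nu * (real i * d)) * (\<integral>\<omega>. J \<omega> * (tilt u \<omega> * \<psi> (X u \<omega>) (t + h)) + J \<omega> * (tilt u \<omega> * e) \<partial>M)"
  proof (intro mult_left_mono integral_mono)
    show "integrable M (\<lambda>\<omega>. J \<omega> * (tilt u \<omega> * (\<integral>z. normal_density 0 (sqrt (2 * h)) z * \<phi> (X u \<omega> + z) \<partial>lborel)))"
    proof (rule Jint)
      have "\<bar>\<integral>z. normal_density 0 (sqrt (2 * h)) z * \<phi> (X u \<omega> + z) \<partial>lborel\<bar> \<le> (\<integral>z. normal_density 0 (sqrt (2 * h)) z * C \<partial>lborel)" for \<omega>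
        by (rule abs_integral_le_of_bound)
           (use d sigma C[OF Suc.prems] C0 in \<open>auto simp: abs_mult \<phi>_def h_def intro!: mult_left_mono split: split_indicator\<close>)
      then show "\<bar>\<integral>z. normal_density 0 (sqrt (2 * h)) z * \<phi> (X u \<omega> + z) \<partial>lborel\<bar> \<le> (\<integral>z. normal_density 0 (sqrt (2 * h)) z * C \<partial>lborel)" for \<omega> .
    qed measurable
    show "integrable M (\<lambda>\<omega>. J \<omega> * (tilt u \<omega> * \<psi> (X u \<omega>) (t + h)) + J \<omega> * (tilt u \<omega> * e))"
      using Suc.prems h by (intro Bochner_Integration.integrable_add Jint[of _ C] Jint[of _ e]) (auto intro!: C simp: e)
    fix \<omega>
    show "J \<omega> * (tilt u \<omega> * (\<integral>z. normal_density 0 (sqrt (2 * h)) z * \<phi> (X u \<omega> + z) \<partial>lborel))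
      \<le> J \<omega> * (tilt u \<omega> * \<psi> (X u \<omega>) (t + h)) + J \<omega> * (tilt u \<omega> * e)"
    proof (cases "\<omega> \<in> walk a b s d i")
      case True
      then have "X u \<omega> \<in> {a..b}" unfolding u_def by (rule walk_end)
      from step[OF Suc.prems this]
      have "J \<omega> * (tilt u \<omega> * (\<integral>z. normal_density 0 (sqrt (2 * h)) z * \<phi> (X u \<omega> + z) \<partial>lborel))
        \<le> J \<omega> * (tilt u \<omega> * (\<psi> (X u \<omega>) (t + h) + e))"
        using J by (intro mult_left_mono) (auto simp: h_def \<phi>_def)
      then show ?thesis by (simp add: algebra_simps)
    qed (simp add: J_def)
  qed simp
  also have "\<dots> = exp (nu * (real i * d)) * (\<integral>\<omega>. J \<omega> * (tilt u \<omega> * \<psi> (X u \<omega>) (t + h)) \<partial>M)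
      + exp (nu * (real i * d)) * (\<integral>\<omega>. J \<omega> * (tilt u \<omega> * e) \<partial>M)"
  proof -
    have i1: "integrable M (\<lambda>\<omega>. J \<omega> * (tilt u \<omega> * \<psi> (X u \<omega>) (t + h)))"
      using Suc.prems h by (intro Jint[of _ C]) (auto intro!: C)
    have i2: "integrable M (\<lambda>\<omega>. J \<omega> * (tilt u \<omega> * e))"
      using e by (intro Jint[of _ e]) auto
    show ?thesis
      unfolding Bochner_Integration.integral_add[OF i1 i2] by (rule distrib_left)
  qed
  also have "\<dots> \<le> ((\<integral>\<omega>. (Z \<omega> * indicator (walk a b s d 0) \<omega>) * (tilt s \<omega> * \<psi> (X s \<omega>) (t + h + real i * (\<sigma>\<^sup>2 / 2 * d))) \<partial>M)
      + real i * (e * (B * E) * exp (nu * (real i * d)))) + exp (nu * (real i * d)) * (e * (B * E))"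
  proof (intro add_mono mult_left_mono)
    show "exp (nu * (real i * d)) * (\<integral>\<omega>. J \<omega> * (tilt u \<omega> * \<psi> (X u \<omega>) (t + h)) \<partial>M)
      \<le> (\<integral>\<omega>. (Z \<omega> * indicator (walk a b s d 0) \<omega>) * (tilt s \<omega> * \<psi> (X s \<omega>) (t + h + real i * (\<sigma>\<^sup>2 / 2 * d))) \<partial>M)
      + real i * (e * (B * E) * exp (nu * (real i * d)))"
      unfolding J_def u_def using Suc.prems h by (intro Suc.IH) auto
    have "(\<integral>\<omega>. J \<omega> * (tilt u \<omega> * e) \<partial>M) \<le> (\<integral>\<omega>. e * (B * E) \<partial>M)"
    proof (rule integral_mono)
      show "J \<omega> * (tilt u \<omega> * e) \<le> e * (B * E)" for \<omega>
        using mult_left_mono[OF JE e] by (simp add: mult_ac)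
    qed (use e in \<open>auto intro!: Jint[of _ e]\<close>)
    then show "(\<integral>\<omega>. J \<omega> * (tilt u \<omega> * e) \<partial>M) \<le> e * (B * E)" by (simp add: prob_space)
  qed simp
  also have "\<dots> = (\<integral>\<omega>. (Z \<omega> * indicator (walk a b s d 0) \<omega>) * (tilt s \<omega> * \<psi> (X s \<omega>) (t + real (Suc i) * (\<sigma>\<^sup>2 / 2 * d))) \<partial>M)
      + real (Suc i) * (e * (B * E) * exp (nu * (real i * d)))"
  proof -
    have *: "t + h + real i * (\<sigma>\<^sup>2 / 2 * d) = t + real (Suc i) * (\<sigma>\<^sup>2 / 2 * d)"
      by (simp add: h_def field_simps)
    show ?thesis unfolding * by (simp only: of_nat_Suc ring_distribs mult_1_left ac_simps)
  qed
  also have "\<dots> \<le> (\<integral>\<omega>. (Z \<omega> * indicator (walk a b s d 0) \<omega>) * (tilt s \<omega> * \<psi> (X s \<omega>) (t + real (Suc i) * (\<sigma>\<^sup>2 / 2 * d))) \<partial>M)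
      + real (Suc i) * (e * (B * E) * exp (nu * (real (Suc i) * d)))"
  proof -
    have "0 \<le> B * E" using B E(2) by simp
    moreover have "nu * (real i * d) \<le> nu * (real (Suc i) * d)"
      using nu_nonneg d by (intro mult_left_mono mult_right_mono) auto
    ultimately show ?thesis using e by (intro add_left_mono mult_left_mono) auto
  qed
  finally show ?case unfolding u'_def .
qed

end

section \<open>From the grid walk to the continuous path\<close>

lemma tendsto_posmode:
  assumes "u \<longlonglongrightarrow> a" "v \<longlonglongrightarrow> b" "a < b"
  shows "(\<lambda>m. posmode (u m) (v m) k x t) \<longlonglongrightarrow> posmode a b k x t"
  unfolding posmode_def mode_def using assms by (intro tendsto_intros) auto

lemma exp_strip_bound:
  fixes c :: real
  assumes "x \<in> {a..b}"
  shows "exp (c * x) \<le> exp (\<bar>c\<bar> * (\<bar>a\<bar> + \<bar>b\<bar>))"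
proof -
  have "c * x \<le> \<bar>c\<bar> * \<bar>x\<bar>" by (simp flip: abs_mult)
  also have "\<dots> \<le> \<bar>c\<bar> * (\<bar>a\<bar> + \<bar>b\<bar>)" using assms by (intro mult_left_mono) auto
  finally show ?thesis by simp
qed

context bm_drift
begin

text \<open>Near the exit time the path stays within the distance between the two strips, by
  continuity; any grid point close enough to that time is then seen outside the smaller
  strip.\<close>

lemma grid_exit:
  assumes \<omega>: "\<omega> \<in> space M" and st: "0 \<le> s" "s < t" and u: "u \<in> {s..t}" "X u \<omega> \<notin> {a<..<b}"
    and ab: "a < a'" "b' < b"
  shows "\<forall>\<^sub>F N in sequentially. \<omega> \<notin> walk a' b' s ((t - s) / real N) N"
proof -
  define \<eta> where "\<eta> = min (a' - a) (b - b')"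
  have "\<eta> > 0" using ab by (simp add: \<eta>_def)
  moreover have "u \<in> {0..}" using u st by auto
  ultimately obtain \<delta> where \<delta>: "\<delta> > 0" "\<And>u'. u' \<in> {0..} \<Longrightarrow> dist u' u < \<delta> \<Longrightarrow> dist (X u' \<omega>) (X u \<omega>) < \<eta>"
    using continuous_X[OF \<omega>] unfolding continuous_on_iff by metis
  obtain N0 :: nat where N0: "(t - s) / \<delta> < real N0" using reals_Archimedean2 by blast
  show ?thesis
  proof (rule eventually_sequentiallyI)
    fix N assume N: "N0 \<le> N"
    define d where "d = (t - s) / real N"
    have "0 < (t - s) / \<delta>" using st \<delta> by simp
    then have N': "0 < real N" "(t - s) / \<delta> < real N" using N0 N by linarith+
    have d: "0 < d" "d < \<delta>" using st \<delta>(1) N' by (auto simp: d_def field_simps)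
    \<comment> \<open>The last grid point not after \<open>u\<close>, less than one mesh away from
      it.\<close>
    define l where "l = nat \<lfloor>(u - s) / d\<rfloor>"
    have ge: "0 \<le> (u - s) / d" using u d by simp
    then have l: "real l \<le> (u - s) / d" "(u - s) / d < real l + 1"
      unfolding l_def by (auto simp: of_nat_nat)
    have "(u - s) / d \<le> (t - s) / d" using u d by (intro divide_right_mono) auto
    also have "\<dots> = real N" using st N' by (simp add: d_def)
    finally have lN: "l \<le> N" using l(1) by simp
    have "real l * d \<le> u - s" "u - s < real l * d + d" using l d by (auto simp: field_simps)
    then have "dist (s + real l * d) u < \<delta>" using d by (simp add: dist_real_def)
    then have "dist (X (s + real l * d) \<omega>) (X u \<omega>) < \<eta>" using st d by (intro \<delta>(2)) auto
    then have "X (s + real l * d) \<omega> \<notin> {a'..b'}"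
      using u(2) by (auto simp: dist_real_def \<eta>_def)
    then show "\<omega> \<notin> walk a' b' s ((t - s) / real N) N"
      using lN unfolding walk_def d_def[symmetric] by auto
  qed
qed

text \<open>A continuous path attains its extremes on the compact time interval, so it keeps a
  positive distance from the open strip's ends.\<close>

lemma stay_strip:
  assumes "\<omega> \<in> stay a b s t" "0 \<le> s" "s \<le> t"
  obtains m :: nat where "\<And>u. u \<in> {s..t} \<Longrightarrow> X u \<omega> \<in> {a + inverse (real (Suc m))..b - inverse (real (Suc m))}"
proof -
  have \<omega>: "\<omega> \<in> space M" using assms by (simp add: stay_def)
  have c: "continuous_on {s..t} (\<lambda>u. X u \<omega>)"
    by (rule continuous_on_subset[OF continuous_X[OF \<omega>]]) (use assms in auto)
  obtain u1 where u1: "u1 \<in> {s..t}" "\<And>u. u \<in> {s..t} \<Longrightarrow> X u1 \<omega> \<le> X u \<omega>"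
    using continuous_attains_inf[OF compact_Icc _ c] assms by auto
  obtain u2 where u2: "u2 \<in> {s..t}" "\<And>u. u \<in> {s..t} \<Longrightarrow> X u \<omega> \<le> X u2 \<omega>"
    using continuous_attains_sup[OF compact_Icc _ c] assms by auto
  have "0 < min (X u1 \<omega> - a) (b - X u2 \<omega>)" using u1(1) u2(1) assms by (auto simp: stay_def)
  then obtain m where m: "inverse (real (Suc m)) < min (X u1 \<omega> - a) (b - X u2 \<omega>)"
    using reals_Archimedean by blast
  show thesis
  proof (rule that[of m])
    fix u assume "u \<in> {s..t}"
    then show "X u \<omega> \<in> {a + inverse (real (Suc m))..b - inverse (real (Suc m))}"
      using m u1(2)[of u] u2(2)[of u] by auto
  qed
qed

lemma stay_subset_walk:
  assumes "\<And>u. u \<in> {s..t} \<Longrightarrow> X u \<omega> \<in> {a..b}" "\<omega> \<in> space M" "s \<le> t" "N \<ge> 1"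
  shows "\<omega> \<in> walk a b s ((t - s) / real N) N"
proof -
  have "s + real l * ((t - s) / real N) \<in> {s..t}" if "l \<le> N" for l
  proof -
    have "real l * ((t - s) / real N) \<le> real N * ((t - s) / real N)"
      using that assms by (intro mult_right_mono) auto
    then show ?thesis using assms by auto
  qed
  then show ?thesis using assms by (auto simp: walk_def)
qed

text \<open>The uncountable condition over all times becomes countable: some margin 1/(m + 1) such
  that every grid sees the path inside the reduced strip.\<close>

lemma stay_sets:
  assumes "0 \<le> s" "s < t"
  shows "stay a b s t \<in> sets (F t)"
proof -
  \<comment> \<open>\<open>Suc N\<close> keeps the number of grid steps positive, so that the mesh
    is a genuine one.\<close>
  let ?w = "\<lambda>m N. walk (a + inverse (real (Suc m))) (b - inverse (real (Suc m))) s ((t - s) / real (Suc N)) (Suc N)"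
  have "?w m N \<in> sets (F t)" for m N
    using assms by (intro walk_sets_end) auto
  then have "(\<Union>m. \<Inter>N. ?w m N) \<in> sets (F t)" by (intro sets.countable_UN sets.countable_INT) auto
  also have "(\<Union>m. \<Inter>N. ?w m N) = stay a b s t"
  proof (intro equalityI subsetI)
    fix \<omega> assume "\<omega> \<in> (\<Union>m. \<Inter>N. ?w m N)"
    then obtain m where m: "\<And>N. \<omega> \<in> ?w m N" by blast
    from m[of 0] have \<omega>: "\<omega> \<in> space M" unfolding walk_def by blast
    show "\<omega> \<in> stay a b s t"
    proof (rule ccontr)
      assume "\<omega> \<notin> stay a b s t"
      then obtain u where u: "u \<in> {s..t}" "X u \<omega> \<notin> {a<..<b}" using \<omega> by (auto simp: stay_def)
      have "\<forall>\<^sub>F N in sequentially. \<omega> \<notin> walk (a + inverse (real (Suc m))) (b - inverse (real (Suc m))) s ((t - s) / real N) N"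
        by (rule grid_exit[OF \<omega> assms u]) auto
      then obtain N0 where "\<And>N. N \<ge> N0 \<Longrightarrow> \<omega> \<notin> walk (a + inverse (real (Suc m))) (b - inverse (real (Suc m))) s ((t - s) / real N) N"
        unfolding eventually_sequentially by blast
      from this[of "Suc N0"] m[of N0] show False by simp
    qed
  next
    fix \<omega> assume s: "\<omega> \<in> stay a b s t"
    then obtain m where "\<And>u. u \<in> {s..t} \<Longrightarrow> X u \<omega> \<in> {a + inverse (real (Suc m))..b - inverse (real (Suc m))}"
      using stay_strip assms by (metis less_imp_le)
    then have "\<omega> \<in> ?w m N" for N
      using s assms by (intro stay_subset_walk) (auto simp: stay_def)
    then show "\<omega> \<in> (\<Union>m. \<Inter>N. ?w m N)" by blast
  qed
  finally show ?thesis .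
qed

lemma stay_end: "\<omega> \<in> stay a b s t \<Longrightarrow> s \<le> t \<Longrightarrow> X t \<omega> \<in> {a<..<b}"
  by (simp add: stay_def)

lemma indicator_walk_0: "\<omega> \<in> space M \<Longrightarrow> indicator (walk a b s d 0) \<omega> = (indicator {a..b} (X s \<omega>) :: real)"
  by (auto simp: walk_def split: split_indicator)

text \<open>N steps with an error of order 1/N^2 each leave a total of order 1/N.\<close>

lemma killed_walk_error:
  fixes t s e0 c :: real
  shows "real N * (e0 * (\<sigma>\<^sup>2 / 2 * ((t - s) / real N))\<^sup>2 * c) = (e0 * (\<sigma>\<^sup>2 / 2 * (t - s))\<^sup>2 * c) / real N"
  by (cases "N = 0") (simp_all add: power2_eq_square field_simps)

text \<open>The weight \<open>Y\<close> confines the path to the strip at time \<open>u\<close>,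
  where the otherwise unbounded tilt is bounded.\<close>

lemma integrable_strip:
  assumes [measurable]: "Y \<in> borel_measurable M" "X u \<in> borel_measurable M" "g \<in> borel_measurable borel"
    and "\<And>\<omega>. \<omega> \<in> space M \<Longrightarrow> \<bar>Y \<omega>\<bar> \<le> B" "\<And>\<omega>. \<omega> \<in> space M \<Longrightarrow> Y \<omega> \<noteq> 0 \<Longrightarrow> X u \<omega> \<in> {a..b}" "\<And>x. x \<in> {a..b} \<Longrightarrow> \<bar>g x\<bar> \<le> C"
  shows "integrable M (\<lambda>\<omega>. Y \<omega> * (tilt u \<omega> * g (X u \<omega>)))"
proof (rule integrable_bounded)
  fix \<omega> assume \<omega>: "\<omega> \<in> space M"
  then have B: "0 \<le> B" using assms(4)[of \<omega>] by linarith
  show "\<bar>Y \<omega> * (tilt u \<omega> * g (X u \<omega>))\<bar> \<le> B * (exp (\<bar>al\<bar> * (\<bar>a\<bar> + \<bar>b\<bar>)) * \<bar>C\<bar>)"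
  proof (cases "Y \<omega> = 0")
    case False
    then have x: "X u \<omega> \<in> {a..b}" using assms(5)[OF \<omega>] by blast
    show ?thesis unfolding abs_mult
      using assms(4)[OF \<omega>] exp_strip_bound[OF x, of al] assms(6)[OF x] B by (intro mult_mono) auto
  qed (use B in simp)
qed measurable

lemma integrable_strip_ind:
  assumes "Z \<in> borel_measurable M" "X u \<in> borel_measurable M" "g \<in> borel_measurable borel" "A \<in> sets M"
    and "\<And>\<omega>. 0 \<le> Z \<omega>" "\<And>\<omega>. Z \<omega> \<le> B" "\<And>\<omega>. \<omega> \<in> A \<Longrightarrow> X u \<omega> \<in> {a..b}" "\<And>x. x \<in> {a..b} \<Longrightarrow> \<bar>g x\<bar> \<le> C"
  shows "integrable M (\<lambda>\<omega>. (Z \<omega> * indicator A \<omega>) * (tilt u \<omega> * g (X u \<omega>)))"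
proof (rule integrable_strip)
  fix \<omega>
  have "0 \<le> B" using assms(5,6) order_trans by blast
  then show "\<bar>Z \<omega> * indicator A \<omega>\<bar> \<le> B" using assms(5,6)[of \<omega>] by (simp add: indicator_def)
  show "X u \<omega> \<in> {a..b}" if "Z \<omega> * indicator A \<omega> \<noteq> 0"
    using that assms(7)[of \<omega>] by (cases "\<omega> \<in> A") simp_all
qed (use assms in auto)

text \<open>Survival of the path implies survival of every grid walk, and the mode is nonnegative
  there, so \<open>stay\<close> may be replaced by \<open>walk\<close>. The margin \<epsilon> stays
  fixed while the mesh tends to zero, since the error constant grows like \<epsilon>^(-4).\<close>

lemma stay_posmode_upper:
  assumes st: "0 \<le> s" "s < t" and Z: "Z \<in> borel_measurable (F s)" "\<And>\<omega>. 0 \<le> Z \<omega>" "\<And>\<omega>. Z \<omega> \<le> B"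
    and ab: "a < b" and k: "k \<ge> 1" and \<epsilon>: "\<epsilon> > 0"
  shows "exp (nu * (t - s)) * (\<integral>\<omega>. (Z \<omega> * indicator (stay a b s t) \<omega>) * (tilt t \<omega> * posmode (a - \<epsilon>) (b + \<epsilon>) k (X t \<omega>) 0) \<partial>M)
    \<le> (\<integral>\<omega>. (Z \<omega> * indicator {a..b} (X s \<omega>)) * (tilt s \<omega> * posmode (a - \<epsilon>) (b + \<epsilon>) k (X s \<omega>) (\<sigma>\<^sup>2 / 2 * (t - s))) \<partial>M)"
    (is "?L \<le> ?R")
proof -
  let ?\<psi> = "posmode (a - \<epsilon>) (b + \<epsilon>) k"
  define E where "E = exp (\<bar>al\<bar> * (\<bar>a\<bar> + \<bar>b\<bar>))"
  define c where "c = 24 * real k / \<epsilon> ^ 4 * (\<sigma>\<^sup>2 / 2 * (t - s))\<^sup>2 * (B * E * exp (nu * (t - s)))"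
  have t: "0 \<le> t" using st by simp
  have [measurable]: "Z \<in> borel_measurable M" "X t \<in> borel_measurable M" "X s \<in> borel_measurable M"
    using measurable_F_M[OF st(1) Z(1)] measurable_F_M[OF st(1) measurable_X[OF st(1)]] measurable_F_M[OF t measurable_X[OF t]] by auto
  have [measurable]: "stay a b s t \<in> sets M"
    by (rule sets_F_M[OF t stay_sets[OF st]])
  have stay_bd: "a \<le> X t \<omega> \<and> X t \<omega> \<le> b" if "\<omega> \<in> stay a b s t" for \<omega>
    using stay_end[OF that] st by simp
  have "?L \<le> ?R + c / real N" if N: "N \<ge> 1" for N
  proof -
    define d where "d = (t - s) / real N"
    have d: "d > 0" "s + real N * d = t" "real N * d = t - s" using N st by (auto simp: d_def)
    have [measurable]: "walk a b s d N \<in> sets M"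
      unfolding d_def using sets_F_M[OF t walk_sets_end[OF st N]] .
    have kw: "exp (nu * (real N * d)) * (\<integral>\<omega>. (Z \<omega> * indicator (walk a b s d N) \<omega>) * (tilt (s + real N * d) \<omega> * ?\<psi> (X (s + real N * d) \<omega>) 0) \<partial>M)
      \<le> (\<integral>\<omega>. (Z \<omega> * indicator (walk a b s d 0) \<omega>) * (tilt s \<omega> * ?\<psi> (X s \<omega>) (0 + real N * (\<sigma>\<^sup>2 / 2 * d))) \<partial>M)
      + real N * (24 * real k / \<epsilon> ^ 4 * (\<sigma>\<^sup>2 / 2 * d)\<^sup>2 * (B * E) * exp (nu * (real N * d)))"
    proof (rule killed_walk_le[OF st(1) d(1) Z, where C="2 * real k"])
      show "\<bar>?\<psi> x t\<bar> \<le> 2 * real k" if "0 \<le> t" for x t using abs_posmode_le[OF that k] .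
      show "exp (al * x) \<le> E" if "x \<in> {a..b}" for x unfolding E_def using that by (rule exp_strip_bound)
      fix x t :: real assume xt: "0 \<le> t" "x \<in> {a..b}"
      show "(\<integral>z. normal_density 0 (sqrt (2 * (\<sigma>\<^sup>2 / 2 * d))) z * (indicator {a..b} (x + z) * ?\<psi> (x + z) t) \<partial>lborel)
        \<le> ?\<psi> x (t + \<sigma>\<^sup>2 / 2 * d) + 24 * real k / \<epsilon> ^ 4 * (\<sigma>\<^sup>2 / 2 * d)\<^sup>2"
        using sigma d by (intro killed_step_upper[OF ab \<epsilon> _ xt(1) k xt(2)]) auto
    qed (use \<epsilon> in \<open>auto simp: E_def\<close>)
    have "?L \<le> exp (nu * (t - s)) * (\<integral>\<omega>. (Z \<omega> * indicator (walk a b s d N) \<omega>) * (tilt t \<omega> * ?\<psi> (X t \<omega>) 0) \<partial>M)"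
    proof (intro mult_left_mono integral_mono)
      show "integrable M (\<lambda>\<omega>. (Z \<omega> * indicator (stay a b s t) \<omega>) * (tilt t \<omega> * ?\<psi> (X t \<omega>) 0))"
        by (rule integrable_strip_ind[where a=a and b=b and B=B and C="2 * real k"])
           (use Z(2,3) stay_bd abs_posmode_le[OF _ k] in \<open>auto\<close>)
      show "integrable M (\<lambda>\<omega>. (Z \<omega> * indicator (walk a b s d N) \<omega>) * (tilt t \<omega> * ?\<psi> (X t \<omega>) 0))"
        by (rule integrable_strip_ind[where a=a and b=b and B=B and C="2 * real k"])
           (use Z(2,3) walk_end[of _ a b s d N, unfolded d(2)] abs_posmode_le[OF _ k] in \<open>auto\<close>)
      fix \<omega> assume "\<omega> \<in> space M"
      show "(Z \<omega> * indicator (stay a b s t) \<omega>) * (tilt t \<omega> * ?\<psi> (X t \<omega>) 0)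
        \<le> (Z \<omega> * indicator (walk a b s d N) \<omega>) * (tilt t \<omega> * ?\<psi> (X t \<omega>) 0)"
      proof (cases "\<omega> \<in> walk a b s d N")
        case True
        then have "X t \<omega> \<in> {a..b}" using walk_end[OF True] d by simp
        then have "0 \<le> ?\<psi> (X t \<omega>) 0" using ab \<epsilon> k by (intro posmode_nonneg) auto
        then show ?thesis using Z(2)[of \<omega>] True by (intro mult_right_mono mult_left_mono) (auto split: split_indicator)
      next
        case False
        then have "\<omega> \<notin> stay a b s t"
          using stay_subset_walk[of s t \<omega> a b N] N st \<open>\<omega> \<in> space M\<close> by (force simp: stay_def d_def)
        then show ?thesis using False by simp
      qed
    qed simp
    also have "\<dots> \<le> (\<integral>\<omega>. (Z \<omega> * indicator (walk a b s d 0) \<omega>) * (tilt s \<omega> * ?\<psi> (X s \<omega>) (0 + real N * (\<sigma>\<^sup>2 / 2 * d))) \<partial>M)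
      + real N * (24 * real k / \<epsilon> ^ 4 * (\<sigma>\<^sup>2 / 2 * d)\<^sup>2 * (B * E) * exp (nu * (t - s)))"
      using kw unfolding d(2) unfolding d(3) .
    also have "real N * (24 * real k / \<epsilon> ^ 4 * (\<sigma>\<^sup>2 / 2 * d)\<^sup>2 * (B * E) * exp (nu * (t - s))) = c / real N"
      unfolding d_def c_def killed_walk_error[symmetric] by (simp only: mult.assoc)
    also have "(\<integral>\<omega>. (Z \<omega> * indicator (walk a b s d 0) \<omega>) * (tilt s \<omega> * ?\<psi> (X s \<omega>) (0 + real N * (\<sigma>\<^sup>2 / 2 * d))) \<partial>M) = ?R"
    proof -
      have "0 + real N * (\<sigma>\<^sup>2 / 2 * d) = \<sigma>\<^sup>2 / 2 * (t - s)" unfolding d(3)[symmetric] by simp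
      then show ?thesis by (intro Bochner_Integration.integral_cong) (auto simp only: indicator_walk_0)
    qed
    finally show ?thesis .
  qed
  moreover have "(\<lambda>N. ?R + c / real N) \<longlonglongrightarrow> ?R + 0"
    by (intro tendsto_intros tendsto_divide_0[OF tendsto_const] filterlim_real_sequentially filterlim_at_top_imp_at_infinity)
  ultimately show ?thesis using LIMSEQ_le_const[of "\<lambda>N. ?R + c / real N" "?R + 0" ?L] by auto
qed

text \<open>Grid survival overestimates path survival, so the comparison is with a strictly larger
  strip: walks that survive in \<open>[a', b']\<close> although the path left \<open>(a, b)\<close>
  disappear in the limit.\<close>

lemma stay_posmode_lower:
  assumes st: "0 \<le> s" "s < t" and Z: "Z \<in> borel_measurable (F s)" "\<And>\<omega>. 0 \<le> Z \<omega>" "\<And>\<omega>. Z \<omega> \<le> B"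
    and ab: "a < a'" "a' < b'" "b' < b" and k: "k \<ge> 1"
  shows "(\<integral>\<omega>. (Z \<omega> * indicator {a'..b'} (X s \<omega>)) * (tilt s \<omega> * posmode a' b' k (X s \<omega>) (\<sigma>\<^sup>2 / 2 * (t - s))) \<partial>M)
    \<le> exp (nu * (t - s)) * (\<integral>\<omega>. (Z \<omega> * indicator (stay a b s t) \<omega>) * (tilt t \<omega> * (indicator {a'..b'} (X t \<omega>) * posmode a' b' k (X t \<omega>) 0)) \<partial>M)"
    (is "?L \<le> ?R")
proof -
  let ?\<psi> = "posmode a' b' k"
  define E where "E = exp (\<bar>al\<bar> * (\<bar>a'\<bar> + \<bar>b'\<bar>))"
  define c where "c = 24 * real k / (b' - a') ^ 4 * (\<sigma>\<^sup>2 / 2 * (t - s))\<^sup>2 * (B * E * exp (nu * (t - s)))"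
  have t: "0 \<le> t" using st by simp
  have B: "0 \<le> B" using Z(2,3) order_trans by blast
  have [measurable]: "Z \<in> borel_measurable M" "X t \<in> borel_measurable M" "X s \<in> borel_measurable M"
    using measurable_F_M[OF st(1) Z(1)] measurable_F_M[OF st(1) measurable_X[OF st(1)]] measurable_F_M[OF t measurable_X[OF t]] by auto
  have [measurable]: "stay a b s t \<in> sets M"
    by (rule sets_F_M[OF t stay_sets[OF st]])
  have stay_bd: "a \<le> X t \<omega> \<and> X t \<omega> \<le> b" if "\<omega> \<in> stay a b s t" for \<omega>
    using stay_end[OF that] st by simp
  define w where "w N = walk a' b' s ((t - s) / real (Suc N)) (Suc N)" for N
  have w: "s + real (Suc N) * ((t - s) / real (Suc N)) = t" "0 < (t - s) / real (Suc N)"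
    "real (Suc N) * ((t - s) / real (Suc N)) = t - s" for N using st by auto
  have w_end: "X t \<omega> \<in> {a'..b'}" if "\<omega> \<in> w N" for \<omega> N
    using walk_end[of \<omega> a' b' s "(t - s) / real (Suc N)" "Suc N"] that unfolding w_def w(1) by blast
  have [measurable]: "w N \<in> sets M" for N
    unfolding w_def by (rule sets_F_M[OF t walk_sets_end[OF st]]) simp
  \<comment> \<open>The contribution of the walks that pass every grid check of the inner strip
    while the path leaves the outer one in between.\<close>
  let ?D = "\<lambda>N. (\<integral>\<omega>. (Z \<omega> * indicator (w N - stay a b s t) \<omega>) * (tilt t \<omega> * ?\<psi> (X t \<omega>) 0) \<partial>M)"
  have "?L \<le> ?R + exp (nu * (t - s)) * ?D N + c / real (Suc N)" for N
  proof -
    define d where "d = (t - s) / real (Suc N)"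
    have d: "d > 0" "s + real (Suc N) * d = t" "real (Suc N) * d = t - s" using w[of N] by (auto simp: d_def)
    have i1: "integrable M (\<lambda>\<omega>. (Z \<omega> * indicator (w N) \<omega>) * (tilt t \<omega> * ?\<psi> (X t \<omega>) 0))"
      by (rule integrable_strip_ind[where a=a' and b=b' and B=B and C="2 * real k"])
         (use Z(2,3) w_end[of _ N] abs_posmode_le[OF _ k] in \<open>auto\<close>)
    have i2: "integrable M (\<lambda>\<omega>. (Z \<omega> * indicator (w N - stay a b s t) \<omega>) * (tilt t \<omega> * ?\<psi> (X t \<omega>) 0))"
      by (rule integrable_strip_ind[where a=a' and b=b' and B=B and C="2 * real k"])
         (use Z(2,3) w_end[of _ N] abs_posmode_le[OF _ k] in \<open>auto\<close>)
    have i3: "integrable M (\<lambda>\<omega>. (Z \<omega> * indicator (stay a b s t) \<omega>) * (tilt t \<omega> * (indicator {a'..b'} (X t \<omega>) * ?\<psi> (X t \<omega>) 0)))"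
      by (rule integrable_strip_ind[where a=a and b=b and B=B and C="2 * real k" and g="\<lambda>x. indicator {a'..b'} x * ?\<psi> x 0"])
         (use Z(2,3) stay_bd abs_posmode_le[OF _ k] in \<open>auto split: split_indicator\<close>)
    \<comment> \<open>The subsolution inequality is fed to \<open>killed_walk_le\<close> through the
      negative of the mode.\<close>
    have "exp (nu * (real (Suc N) * d)) * (\<integral>\<omega>. (Z \<omega> * indicator (walk a' b' s d (Suc N)) \<omega>) * (tilt (s + real (Suc N) * d) \<omega> * - ?\<psi> (X (s + real (Suc N) * d) \<omega>) 0) \<partial>M)
     \<le> (\<integral>\<omega>. (Z \<omega> * indicator (walk a' b' s d 0) \<omega>) * (tilt s \<omega> * - ?\<psi> (X s \<omega>) (0 + real (Suc N) * (\<sigma>\<^sup>2 / 2 * d))) \<partial>M)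
      + real (Suc N) * (24 * real k / (b' - a') ^ 4 * (\<sigma>\<^sup>2 / 2 * d)\<^sup>2 * (B * E) * exp (nu * (real (Suc N) * d)))"
    proof (rule killed_walk_le[OF st(1) d(1) Z, where C="2 * real k"])
      show "\<bar>- ?\<psi> x t\<bar> \<le> 2 * real k" if "0 \<le> t" for x t using abs_posmode_le[OF that k] by simp
      show "exp (al * x) \<le> E" if "x \<in> {a'..b'}" for x unfolding E_def using that by (rule exp_strip_bound)
      fix x t :: real assume xt: "0 \<le> t" "x \<in> {a'..b'}"
      show "(\<integral>z. normal_density 0 (sqrt (2 * (\<sigma>\<^sup>2 / 2 * d))) z * (indicator {a'..b'} (x + z) * - ?\<psi> (x + z) t) \<partial>lborel)
        \<le> - ?\<psi> x (t + \<sigma>\<^sup>2 / 2 * d) + 24 * real k / (b' - a') ^ 4 * (\<sigma>\<^sup>2 / 2 * d)\<^sup>2"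
        using killed_step_lower[OF ab(2) _ xt(1) k xt(2), of "\<sigma>\<^sup>2 / 2 * d"] sigma d by simp
    qed (use ab in \<open>auto simp: E_def\<close>)
    moreover have "real (Suc N) * (24 * real k / (b' - a') ^ 4 * (\<sigma>\<^sup>2 / 2 * d)\<^sup>2 * (B * E) * exp (nu * (t - s))) = c / real (Suc N)"
      unfolding d_def c_def killed_walk_error[symmetric] by (simp only: mult.assoc)
    moreover have "(\<integral>\<omega>. (Z \<omega> * indicator (walk a' b' s d 0) \<omega>) * (tilt s \<omega> * - ?\<psi> (X s \<omega>) (0 + real (Suc N) * (\<sigma>\<^sup>2 / 2 * d))) \<partial>M) = - ?L"
    proof -
      have "0 + real (Suc N) * (\<sigma>\<^sup>2 / 2 * d) = \<sigma>\<^sup>2 / 2 * (t - s)" unfolding d(3)[symmetric] by simp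
      then show ?thesis
        unfolding mult_minus_right integral_minus
        by (intro arg_cong[where f=uminus] Bochner_Integration.integral_cong) (auto simp only: indicator_walk_0)
    qed
    ultimately have "?L \<le> exp (nu * (t - s)) * (\<integral>\<omega>. (Z \<omega> * indicator (w N) \<omega>) * (tilt t \<omega> * ?\<psi> (X t \<omega>) 0) \<partial>M) + c / real (Suc N)"
      unfolding d(2) unfolding d(3) unfolding mult_minus_right integral_minus d_def w_def by linarith
    also have "exp (nu * (t - s)) * (\<integral>\<omega>. (Z \<omega> * indicator (w N) \<omega>) * (tilt t \<omega> * ?\<psi> (X t \<omega>) 0) \<partial>M)
      \<le> exp (nu * (t - s)) * (\<integral>\<omega>. (Z \<omega> * indicator (stay a b s t) \<omega>) * (tilt t \<omega> * (indicator {a'..b'} (X t \<omega>) * ?\<psi> (X t \<omega>) 0))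
         + (Z \<omega> * indicator (w N - stay a b s t) \<omega>) * (tilt t \<omega> * ?\<psi> (X t \<omega>) 0) \<partial>M)"
    proof (intro mult_left_mono integral_mono Bochner_Integration.integrable_add i1 i2 i3)
      fix \<omega> assume "\<omega> \<in> space M"
      have "0 \<le> ?\<psi> (X t \<omega>) 0" if "X t \<omega> \<in> {a'..b'}" using ab k that by (intro posmode_nonneg) auto
      then show "(Z \<omega> * indicator (w N) \<omega>) * (tilt t \<omega> * ?\<psi> (X t \<omega>) 0)
        \<le> (Z \<omega> * indicator (stay a b s t) \<omega>) * (tilt t \<omega> * (indicator {a'..b'} (X t \<omega>) * ?\<psi> (X t \<omega>) 0))
         + (Z \<omega> * indicator (w N - stay a b s t) \<omega>) * (tilt t \<omega> * ?\<psi> (X t \<omega>) 0)"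
        using Z(2)[of \<omega>] w_end[of \<omega> N] by (auto split: split_indicator intro!: mult_nonneg_nonneg)
    qed simp
    also have "\<dots> = ?R + exp (nu * (t - s)) * ?D N"
      unfolding Bochner_Integration.integral_add[OF i3 i2] by (rule distrib_left)
    finally show ?thesis by simp
  qed
  moreover have "(\<lambda>N. ?R + exp (nu * (t - s)) * ?D N + c / real (Suc N)) \<longlonglongrightarrow> ?R + exp (nu * (t - s)) * 0 + 0"
  proof (intro tendsto_intros)
    show "(\<lambda>N. c / real (Suc N)) \<longlonglongrightarrow> 0"
      using LIMSEQ_Suc[OF lim_const_over_n[of c]] by simp
    have "?D \<longlonglongrightarrow> (\<integral>\<omega>. 0 \<partial>M)"
    proof (rule integral_dominated_convergence[where w="\<lambda>_. B * (E * (2 * real k))"])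
      show "AE \<omega> in M. (\<lambda>N. (Z \<omega> * indicator (w N - stay a b s t) \<omega>) * (tilt t \<omega> * ?\<psi> (X t \<omega>) 0)) \<longlonglongrightarrow> 0"
      proof (intro AE_I2 tendsto_eventually)
        fix \<omega> assume \<omega>: "\<omega> \<in> space M"
        show "\<forall>\<^sub>F N in sequentially. (Z \<omega> * indicator (w N - stay a b s t) \<omega>) * (tilt t \<omega> * ?\<psi> (X t \<omega>) 0) = 0"
        proof (cases "\<omega> \<in> stay a b s t")
          case False
          then obtain u where "u \<in> {s..t}" "X u \<omega> \<notin> {a<..<b}" using \<omega> by (auto simp: stay_def)
          from grid_exit[OF \<omega> st this ab(1,3)] have "\<forall>\<^sub>F N in sequentially. \<omega> \<notin> w N"
            unfolding w_def by (subst eventually_sequentially_Suc)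
          then show ?thesis by eventually_elim simp
        qed simp
      qed
      fix N
      show "AE \<omega> in M. norm ((Z \<omega> * indicator (w N - stay a b s t) \<omega>) * (tilt t \<omega> * ?\<psi> (X t \<omega>) 0)) \<le> B * (E * (2 * real k))"
      proof (intro AE_I2)
        fix \<omega> assume \<omega>: "\<omega> \<in> space M"
        show "norm ((Z \<omega> * indicator (w N - stay a b s t) \<omega>) * (tilt t \<omega> * ?\<psi> (X t \<omega>) 0)) \<le> B * (E * (2 * real k))"
        proof (cases "\<omega> \<in> w N")
          case True
          have "\<bar>Z \<omega> * indicator (w N - stay a b s t) \<omega>\<bar> \<le> B"
            using Z(2,3)[of \<omega>] B by (auto split: split_indicator)
          moreover have "tilt t \<omega> \<le> E" unfolding E_def by (rule exp_strip_bound[OF w_end[OF True]])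
          ultimately show ?thesis unfolding real_norm_def abs_mult[of _ "tilt t \<omega> * ?\<psi> (X t \<omega>) 0"] abs_mult[of "tilt t \<omega>"]
            using abs_posmode_le[OF _ k, of 0 a' b' "X t \<omega>"] B by (intro mult_mono) (auto simp: E_def)
        qed (use B in \<open>simp add: E_def\<close>)
      qed
    qed auto
    then show "?D \<longlonglongrightarrow> 0" by simp
  qed
  ultimately show ?thesis using LIMSEQ_le_const[of "\<lambda>N. ?R + exp (nu * (t - s)) * ?D N + c / real (Suc N)" "?R + exp (nu * (t - s)) * 0 + 0" ?L] by auto
qed

end

section \<open>Sine modes determine a functional\<close>

lemma mode_at_ends: "a < b \<Longrightarrow> mode a b k a t = 0" "a < b \<Longrightarrow> mode a b k b t = 0"
  by (simp_all add: mode_def)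

lemma posmode_at_ends: "a < b \<Longrightarrow> posmode a b k a t = 0" "a < b \<Longrightarrow> posmode a b k b t = 0"
  by (simp_all add: posmode_def mode_at_ends)

lemma tendsto_inverse_Suc_add: "(\<lambda>m. c + inverse (real (Suc m))) \<longlonglongrightarrow> c" "(\<lambda>m. c - inverse (real (Suc m))) \<longlonglongrightarrow> c"
  using tendsto_add[OF tendsto_const LIMSEQ_inverse_real_of_nat, of c] tendsto_diff[OF tendsto_const LIMSEQ_inverse_real_of_nat, of c]
  by simp_all

text \<open>At an interior point the indicator is eventually 1. At an endpoint it is always 0, and
  so is the limit, because modes vanish at the ends.\<close>

lemma tendsto_inner_posmode:
  fixes a b :: real
  assumes "a < b" "x \<in> {a..b}"
  defines "\<epsilon> \<equiv> \<lambda>m. inverse (real (Suc m))"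
  shows "(\<lambda>m. indicator {a + \<epsilon> m..b - \<epsilon> m} x * posmode (a + \<epsilon> m) (b - \<epsilon> m) k x t) \<longlonglongrightarrow> posmode a b k x t"
proof (cases "x = a \<or> x = b")
  case True
  have "x \<notin> {a + \<epsilon> m..b - \<epsilon> m}" for m using True assms(1)
  proof -
    have "\<epsilon> m > 0" by (simp add: \<epsilon>_def)
    then show ?thesis using True by auto
  qed
  moreover have "posmode a b k x t = 0" using True posmode_at_ends[OF assms(1)] by auto
  ultimately show ?thesis by simp
next
  case False
  then have x: "a < x" "x < b" using assms by auto
  have "\<forall>\<^sub>F m in sequentially. a + \<epsilon> m < x" "\<forall>\<^sub>F m in sequentially. x < b - \<epsilon> m"
    unfolding \<epsilon>_def using order_tendstoD(2)[OF tendsto_inverse_Suc_add(1) x(1)] order_tendstoD(1)[OF tendsto_inverse_Suc_add(2) x(2)] by auto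
  then have ev: "\<forall>\<^sub>F m in sequentially. indicator {a + \<epsilon> m..b - \<epsilon> m} x * posmode (a + \<epsilon> m) (b - \<epsilon> m) k x t = posmode (a + \<epsilon> m) (b - \<epsilon> m) k x t"
    by eventually_elim simp
  have "(\<lambda>m. posmode (a + \<epsilon> m) (b - \<epsilon> m) k x t) \<longlonglongrightarrow> posmode a b k x t"
    unfolding \<epsilon>_def by (rule tendsto_posmode[OF tendsto_inverse_Suc_add assms(1)])
  then show ?thesis by (rule iffD2[OF tendsto_cong[OF ev]])
qed

lemma continuous_bounded_Icc:
  fixes f :: "real \<Rightarrow> real"
  assumes "continuous_on UNIV f"
  obtains C where "C \<ge> 0" "\<And>x. x \<in> {a..b} \<Longrightarrow> \<bar>f x\<bar> \<le> C"
proof -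
  have "bounded (f ` {a..b})"
    by (intro compact_imp_bounded compact_continuous_image continuous_on_subset[OF assms]) auto
  then obtain C where "\<forall>x\<in>{a..b}. \<bar>f x\<bar> \<le> C" unfolding bounded_iff by auto
  then show thesis by (intro that[of "\<bar>C\<bar>"]) force+
qed

section \<open>Orthogonality of the sines and the Dirichlet kernel\<close>

lemma integral_cos_multiple:
  fixes L :: real
  assumes "L > 0"
  shows "(LINT z:{0..L}|lborel. cos (of_int m * pi * z / L)) = (if m = 0 then L else 0)"
proof (cases "m = 0")
  case False
  have "(LINT z:{0..L}|lborel. cos (of_int m * pi * z / L)) = L / (of_int m * pi) * sin (of_int m * pi * L / L) - L / (of_int m * pi) * sin (of_int m * pi * 0 / L)"
    unfolding set_lebesgue_integral_def real_scaleR_def mult.commute[of "indicator {0..L} _"]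
    by (rule integral_FTC_Icc_real) (use assms False in \<open>auto intro!: derivative_eq_intros continuous_intros\<close>)
  also have "\<dots> = 0" using assms sin_npi_int[of m] by (simp add: mult.commute)
  finally show ?thesis using False by simp
qed (use assms in \<open>simp add: set_lebesgue_integral_def\<close>)

lemma integral_sin_sin:
  fixes L :: real
  assumes "L > 0"
  shows "(LINT z:{0..L}|lborel. sin (real j * pi * z / L) * sin (real k * pi * z / L)) = (if j = k \<and> k \<noteq> 0 then L / 2 else 0)"
proof -
  have *: "sin (real j * pi * z / L) * sin (real k * pi * z / L) =
     1/2 * cos (of_int (int j - int k) * pi * z / L) - 1/2 * cos (of_int (int j + int k) * pi * z / L)" for z
    by (simp add: sin_times_sin diff_divide_distrib add_divide_distrib algebra_simps)
  have i: "set_integrable lborel {0..L} (\<lambda>z. 1/2 * cos (of_int m * pi * z / L))" for m :: int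
    by (intro borel_integrable_atLeastAtMost' continuous_intros) (use assms in auto)
  show ?thesis
    unfolding * set_integral_diff(2)[OF i i] set_integral_mult_right integral_cos_multiple[OF assms] by auto
qed

text \<open>Termwise integration, justified by the uniform summable bound; orthogonality leaves only
  the summand with index \<open>k\<close>. For \<open>k = 0\<close> both sides vanish.\<close>

lemma dker_eigen:
  fixes L \<tau> :: real
  assumes "L > 0" "\<tau> > 0"
  shows "(LINT z:{0..L}|lborel. dker L \<tau> z x * sin (real k * pi * z / L)) = mode 0 L k x \<tau>"
proof -
  let ?e = "\<lambda>i. exp (- ((real i * pi / L)\<^sup>2) * \<tau>)"
  let ?t = "\<lambda>i z. 2 / L * sin (real i * pi * z / L) * sin (real i * pi * x / L) * ?e i"
  let ?f = "\<lambda>i z. indicator {0..L} z * (?t i z * sin (real k * pi * z / L))"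
  have bd: "norm (?f i z) \<le> indicator {0..L} z * (2 / L * ?e i)" for i z
  proof -
    have "norm (?t i z * sin (real k * pi * z / L)) \<le> 2 / L * ?e i * 1"
      unfolding norm_mult[of "?t i z"]
      by (rule mult_mono) (use dker_term_bound[OF assms(1)] assms in auto)
    then show ?thesis by (auto split: split_indicator)
  qed
  have int: "integrable lborel (?f i)" for i
  proof (rule Bochner_Integration.integrable_bound)
    show "integrable lborel (\<lambda>z. indicator {0..L} z * (2 / L * ?e i))"
      by (intro integrable_mult_left integrable_real_indicator) (auto simp: emeasure_lborel_Icc_eq)
    show "AE z in lborel. norm (?f i z) \<le> norm (indicator {0..L} z * (2 / L * ?e i))"
      using assms by (intro AE_I2 order_trans[OF bd]) (auto simp: abs_mult split: split_indicator)
  qed measurable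
  have "(LINT z:{0..L}|lborel. dker L \<tau> z x * sin (real k * pi * z / L)) = (\<integral>z. (\<Sum>i. ?f i z) \<partial>lborel)"
    unfolding set_lebesgue_integral_def dker_def
    by (intro Bochner_Integration.integral_cong refl)
       (simp only: real_scaleR_def suminf_mult2[OF summable_dker[OF assms]] suminf_mult[OF summable_mult2[OF summable_dker[OF assms]]])
  also have "\<dots> = (\<Sum>i. (\<integral>z. ?f i z \<partial>lborel))"
  proof (rule integral_suminf[OF int])
    show "AE z in lborel. summable (\<lambda>i. norm (?f i z))"
    proof (rule AE_I2)
      fix z
      show "summable (\<lambda>i. norm (?f i z))"
        by (rule summable_comparison_test'[OF summable_mult[OF summable_dker_bound[OF assms], of "indicator {0..L} z"], of 0])
           (use bd[of z] in simp)
    qed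
    have "norm (\<integral>z. norm (?f i z) \<partial>lborel) \<le> L * (2 / L * ?e i)" for i
    proof -
      have "\<bar>\<integral>z. norm (?f i z) \<partial>lborel\<bar> \<le> (\<integral>z. indicator {0..L} z * (2 / L * ?e i) \<partial>lborel)"
        by (rule abs_integral_le_of_bound)
           (use bd[of _ i] in \<open>auto intro!: integrable_mult_left integrable_real_indicator simp: emeasure_lborel_Icc_eq\<close>)
      then show ?thesis using assms by simp
    qed
    then show "summable (\<lambda>i. \<integral>z. norm (?f i z) \<partial>lborel)"
      by (intro summable_comparison_test'[OF summable_mult[OF summable_dker_bound[OF assms], of L], of 0]) auto
  qed
  also have "\<dots> = (\<Sum>i. if i = k then mode 0 L k x \<tau> else 0)"
  proof (intro suminf_cong)
    fix i
    have "(\<integral>z. ?f i z \<partial>lborel) = (\<integral>z. (2 / L * sin (real i * pi * x / L) * ?e i) * (indicator {0..L} z *\<^sub>R (sin (real i * pi * z / L) * sin (real k * pi * z / L))) \<partial>lborel)"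
      by (rule Bochner_Integration.integral_cong) auto
    also have "\<dots> = (2 / L * sin (real i * pi * x / L) * ?e i) * (LINT z:{0..L}|lborel. sin (real i * pi * z / L) * sin (real k * pi * z / L))"
      unfolding set_lebesgue_integral_def by (rule integral_mult_right_zero)
    also have "\<dots> = (if i = k then mode 0 L k x \<tau> else 0)"
      unfolding integral_sin_sin[OF assms(1)] using assms(1) by (auto simp: mode_def)
    finally show "(\<integral>z. ?f i z \<partial>lborel) = (if i = k then mode 0 L k x \<tau> else 0)" .
  qed
  also have "\<dots> = mode 0 L k x \<tau>"
    using sums_single[of k "\<lambda>_. mode 0 L k x \<tau>"] by (simp add: sums_iff)
  finally show ?thesis .
qed

text \<open>Sine multiples times polynomials in the cosine are combinations of sine multiples, so by
  Stone--Weierstrass a functional that is continuous under bounded pointwise convergence on the open interval is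
  determined by its values on the sine multiples.\<close>

lemma functional_eq_0_of_sines:
  fixes \<Phi> :: "(real \<Rightarrow> real) \<Rightarrow> real" and L :: real
  assumes L: "L > 0"
    and lin: "\<And>c f g. continuous_on UNIV f \<Longrightarrow> continuous_on UNIV g \<Longrightarrow> \<Phi> (\<lambda>x. c * f x + g x) = c * \<Phi> f + \<Phi> g"
    and dct: "\<And>fm f C. (\<And>m. continuous_on UNIV (fm m)) \<Longrightarrow> continuous_on UNIV f \<Longrightarrow>
        (\<And>m x. x \<in> {0..L} \<Longrightarrow> \<bar>fm m x\<bar> \<le> C) \<Longrightarrow> (\<And>x. x \<in> {0<..<L} \<Longrightarrow> (\<lambda>m. fm m x) \<longlonglongrightarrow> f x) \<Longrightarrow>
        (\<lambda>m. \<Phi> (fm m)) \<longlonglongrightarrow> \<Phi> f"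
    and sines: "\<And>k. \<Phi> (\<lambda>x. sin (real k * pi * x / L)) = 0"
    and f: "continuous_on UNIV f"
  shows "\<Phi> f = 0"
proof -
  define \<theta> where "\<theta> x = pi * x / L" for x
  have cont\<theta> [continuous_intros]: "continuous_on UNIV \<theta>" unfolding \<theta>_def using L by (intro continuous_intros) auto
  have sines': "\<Phi> (\<lambda>x. sin (real k * \<theta> x)) = 0" for k using sines[of k] by (simp add: \<theta>_def mult.assoc)
  have sum0: "\<Phi> (\<lambda>x. \<Sum>i\<in>I. c i * g i x) = 0" if "finite I" "\<And>i. i \<in> I \<Longrightarrow> continuous_on UNIV (g i)" "\<And>i. i \<in> I \<Longrightarrow> \<Phi> (g i) = 0"
    for I :: "nat set" and c g using that
  proof (induction I rule: finite_induct)
    case empty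
    show ?case using lin[of "\<lambda>_. 0" "\<lambda>_. 0" 1] by simp
  next
    case (insert i I)
    have "\<Phi> (\<lambda>x. c i * g i x + (\<Sum>i\<in>I. c i * g i x)) = c i * \<Phi> (g i) + \<Phi> (\<lambda>x. \<Sum>i\<in>I. c i * g i x)"
      by (rule lin) (use insert.prems in \<open>auto intro!: continuous_intros\<close>)
    then show ?case using insert by simp
  qed
  \<comment> \<open>Each cosine factor turns a sine multiple into half the sum of its two
    neighbours. For k = 0 the function is zero, so the missing neighbour below is harmless.\<close>
  have trig: "\<Phi> (\<lambda>x. sin (real k * \<theta> x) * cos (\<theta> x) ^ i) = 0" for i k
  proof (induction i arbitrary: k)
    case 0
    then show ?case using sines' by simp
  next
    case (Suc i)
    show ?case
    proof (cases k)
      case 0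
      then show ?thesis using sum0[of "{}"] by simp
    next
      case (Suc l)
      have eq: "sin (real k * \<theta> x) * cos (\<theta> x) ^ Suc i
        = 1/2 * (sin (real (Suc k) * \<theta> x) * cos (\<theta> x) ^ i) + 1/2 * (sin (real l * \<theta> x) * cos (\<theta> x) ^ i)" for x
      proof -
        have "sin (real k * \<theta> x) * cos (\<theta> x) = (sin (real k * \<theta> x + \<theta> x) + sin (real k * \<theta> x - \<theta> x)) / 2"
          by (rule sin_times_cos)
        moreover have "real k * \<theta> x + \<theta> x = real (Suc k) * \<theta> x" "real k * \<theta> x - \<theta> x = real l * \<theta> x"
          using Suc by (auto simp: algebra_simps)
        ultimately have "sin (real k * \<theta> x) * cos (\<theta> x) = (sin (real (Suc k) * \<theta> x) + sin (real l * \<theta> x)) / 2" by simp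
        then have "sin (real k * \<theta> x) * cos (\<theta> x) * cos (\<theta> x) ^ i = (sin (real (Suc k) * \<theta> x) + sin (real l * \<theta> x)) / 2 * cos (\<theta> x) ^ i" by simp
        then show ?thesis by (simp add: algebra_simps add_divide_distrib)
      qed
      moreover have "\<Phi> (\<lambda>x. 1/2 * (sin (real (Suc k) * \<theta> x) * cos (\<theta> x) ^ i) + 1/2 * (sin (real l * \<theta> x) * cos (\<theta> x) ^ i))
          = 1/2 * \<Phi> (\<lambda>x. sin (real (Suc k) * \<theta> x) * cos (\<theta> x) ^ i) + \<Phi> (\<lambda>x. 1/2 * (sin (real l * \<theta> x) * cos (\<theta> x) ^ i))"
        by (rule lin) (auto intro!: continuous_intros)
      moreover have "\<Phi> (\<lambda>x. 1/2 * (sin (real l * \<theta> x) * cos (\<theta> x) ^ i) + 0) = 1/2 * \<Phi> (\<lambda>x. sin (real l * \<theta> x) * cos (\<theta> x) ^ i) + \<Phi> (\<lambda>_. 0)"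
        by (rule lin) (auto intro!: continuous_intros)
      ultimately show ?thesis unfolding eq Suc.IH using sum0[of "{}"] by simp
    qed
  qed
  \<comment> \<open>On \<open>[0, L]\<close> the cosine of \<theta> is a coordinate, so a continuous
    g becomes a function on \<open>[-1, 1]\<close> and is uniformly approximated by polynomials in
    the cosine. The factor sin \<theta> brings the products into the span treated by
    \<open>trig\<close>.\<close>
  have step1: "\<Phi> (\<lambda>x. sin (\<theta> x) * g x) = 0" if g: "continuous_on UNIV g" for g
  proof -
    have "continuous_on {-1..1} (\<lambda>y. g (L / pi * arccos y))"
      by (intro continuous_on_compose2[OF g] continuous_intros continuous_on_arccos') auto
    note c = this
    have "\<exists>q. real_polynomial_function q \<and> (\<forall>y\<in>{-1..1}. \<bar>g (L / pi * arccos y) - q y\<bar> < inverse (real (Suc m)))" for m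
    proof -
      have "0 < inverse (real (Suc m))" by simp
      from Stone_Weierstrass_real_polynomial_function[OF compact_Icc c this] show ?thesis by metis
    qed
    then obtain q where q: "\<And>m. real_polynomial_function (q m)"
      and qg: "\<And>m y. y \<in> {-1..1} \<Longrightarrow> \<bar>g (L / pi * arccos y) - q m y\<bar> < inverse (real (Suc m))" by metis
    have qg': "\<bar>g x - q m (cos (\<theta> x))\<bar> < inverse (real (Suc m))" if "x \<in> {0..L}" for m x
    proof -
      have "0 \<le> \<theta> x" "\<theta> x \<le> pi" using that L by (auto simp: \<theta>_def field_simps)
      then have "L / pi * arccos (cos (\<theta> x)) = x" using L by (simp add: arccos_cos \<theta>_def)
      then show ?thesis using qg[of "cos (\<theta> x)" m] by simp
    qed
    have contq: "continuous_on UNIV (\<lambda>x. sin (\<theta> x) * q m (cos (\<theta> x)))" for m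
      using continuous_on_polymonial_function[of "q m" UNIV] q[of m] 
      by (auto intro!: continuous_intros continuous_on_compose2[of UNIV "q m"] simp: real_polynomial_function_eq)
    have "\<Phi> (\<lambda>x. sin (\<theta> x) * q m (cos (\<theta> x))) = 0" for m
    proof -
      obtain a N where qa: "q m = (\<lambda>x. \<Sum>i\<le>N. a i * x ^ i)" using q[of m] unfolding real_polynomial_function_iff_sum by blast
      have eq: "(\<lambda>x. sin (\<theta> x) * q m (cos (\<theta> x))) = (\<lambda>x. \<Sum>i\<in>{..N}. a i * (sin (real 1 * \<theta> x) * cos (\<theta> x) ^ i))"
        unfolding qa by (auto simp: sum_distrib_left algebra_simps)
      show ?thesis unfolding eq by (rule sum0) (use trig[of 1] in \<open>auto intro!: continuous_intros\<close>)
    qed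
    moreover have "(\<lambda>m. \<Phi> (\<lambda>x. sin (\<theta> x) * q m (cos (\<theta> x)))) \<longlonglongrightarrow> \<Phi> (\<lambda>x. sin (\<theta> x) * g x)"
    proof -
      obtain C where C: "\<And>x. x \<in> {0..L} \<Longrightarrow> \<bar>g x\<bar> \<le> C" using continuous_bounded_Icc[OF g] by blast
      show ?thesis
      proof (rule dct[where C="C + 1"])
        fix m x assume x: "x \<in> {0..L}"
        have "inverse (real (Suc m)) \<le> 1" by (simp add: inverse_le_1_iff)
        then have "\<bar>q m (cos (\<theta> x))\<bar> \<le> C + 1" using qg'[OF x, of m] C[OF x] by linarith
        then have "\<bar>sin (\<theta> x)\<bar> * \<bar>q m (cos (\<theta> x))\<bar> \<le> 1 * (C + 1)" by (intro mult_mono) auto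
        then show "\<bar>sin (\<theta> x) * q m (cos (\<theta> x))\<bar> \<le> C + 1" by (simp add: abs_mult)
      next
        fix x assume "x \<in> {0<..<L}"
        then have x: "x \<in> {0..L}" by auto
        have "(\<lambda>m. q m (cos (\<theta> x)) - g x) \<longlonglongrightarrow> 0"
        proof (rule Lim_null_comparison[OF _ LIMSEQ_inverse_real_of_nat])
          show "\<forall>\<^sub>F m in sequentially. norm (q m (cos (\<theta> x)) - g x) \<le> inverse (real (Suc m))"
            using qg'[OF x] by (intro always_eventually allI) (smt (verit) real_norm_def)
        qed
        then have "(\<lambda>m. q m (cos (\<theta> x))) \<longlonglongrightarrow> g x" by (simp add: LIM_zero_iff)
        then show "(\<lambda>m. sin (\<theta> x) * q m (cos (\<theta> x))) \<longlonglongrightarrow> sin (\<theta> x) * g x" by (intro tendsto_intros)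
      qed (use contq g in \<open>auto intro!: continuous_intros\<close>)
    qed
    ultimately show ?thesis using LIMSEQ_unique[of "\<lambda>_. 0" 0] by simp
  qed
  \<comment> \<open>A regularised reciprocal of the sine: sin \<theta> times \<rho> lies in
    \<open>[0, 1]\<close> and tends to 1 inside the interval but not at its ends. This is why
    convergence is asked for only on the open interval.\<close>
  define \<rho> where "\<rho> m x = sin (\<theta> x) / ((sin (\<theta> x))\<^sup>2 + inverse (real (Suc m)))" for m x
  have den: "(sin (\<theta> x))\<^sup>2 + inverse (real (Suc m)) > 0" for m x by (intro add_nonneg_pos) auto
  have cont\<rho>: "continuous_on UNIV (\<lambda>x. f x * \<rho> m x)" for m
    unfolding \<rho>_def using den[of _ m] by (intro continuous_intros f) (auto simp: less_imp_neq[THEN not_sym])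
  obtain C where C: "\<And>x. x \<in> {0..L} \<Longrightarrow> \<bar>f x\<bar> \<le> C" using continuous_bounded_Icc[OF f] by blast
  have "(\<lambda>m. \<Phi> (\<lambda>x. sin (\<theta> x) * (f x * \<rho> m x))) \<longlonglongrightarrow> \<Phi> f"
  proof (rule dct[where C=C])
    fix m x assume x: "x \<in> {0..L}"
    have "sin (\<theta> x) * \<rho> m x = (sin (\<theta> x))\<^sup>2 / ((sin (\<theta> x))\<^sup>2 + inverse (real (Suc m)))"
      by (simp add: \<rho>_def power2_eq_square)
    then have "sin (\<theta> x) * \<rho> m x \<ge> 0" "sin (\<theta> x) * \<rho> m x \<le> 1"
      using den[of x m] by (simp_all only: divide_nonneg_pos zero_le_power2 divide_le_eq_1_pos) simp_all
    then have "\<bar>f x\<bar> * \<bar>sin (\<theta> x) * \<rho> m x\<bar> \<le> C * 1" using C[OF x] by (intro mult_mono) auto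
    then show "\<bar>sin (\<theta> x) * (f x * \<rho> m x)\<bar> \<le> C" by (simp add: abs_mult mult_ac)
  next
    fix x assume x: "x \<in> {0<..<L}"
    have "sin (\<theta> x) > 0" using x L by (intro sin_gt_zero) (auto simp: \<theta>_def field_simps)
    then have "(\<lambda>m. sin (\<theta> x) * (f x * \<rho> m x)) \<longlonglongrightarrow> sin (\<theta> x) * (f x * (sin (\<theta> x) / ((sin (\<theta> x))\<^sup>2 + 0)))"
      unfolding \<rho>_def by (intro tendsto_intros LIMSEQ_inverse_real_of_nat) auto
    then show "(\<lambda>m. sin (\<theta> x) * (f x * \<rho> m x)) \<longlonglongrightarrow> f x" using \<open>sin (\<theta> x) > 0\<close> by (simp add: power2_eq_square)
  next
    show "continuous_on UNIV (\<lambda>x. sin (\<theta> x) * (f x * \<rho> m x))" for m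
      by (intro continuous_on_mult cont\<rho> continuous_intros cont\<theta>)
  qed (rule f)
  then show ?thesis unfolding step1[OF cont\<rho>] using LIMSEQ_unique[of "\<lambda>_. 0" 0] by simp
qed

section \<open>Survival in a strip\<close>

context bm_drift
begin

lemma strip_limit:
  assumes [measurable]: "Z \<in> borel_measurable M" "X u \<in> borel_measurable M" "A \<in> sets M"
      "\<And>m. g m \<in> borel_measurable borel" "g' \<in> borel_measurable borel"
    and Z: "\<And>\<omega>. 0 \<le> Z \<omega>" "\<And>\<omega>. Z \<omega> \<le> B" and A: "\<And>\<omega>. \<omega> \<in> A \<Longrightarrow> X u \<omega> \<in> {a..b}"
    and C: "\<And>m x. x \<in> {a..b} \<Longrightarrow> \<bar>g m x\<bar> \<le> C"
    and lim: "\<And>\<omega>. \<omega> \<in> A \<Longrightarrow> (\<lambda>m. g m (X u \<omega>)) \<longlonglongrightarrow> g' (X u \<omega>)"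
  shows "(\<lambda>m. \<integral>\<omega>. (Z \<omega> * indicator A \<omega>) * (tilt u \<omega> * g m (X u \<omega>)) \<partial>M)
    \<longlonglongrightarrow> (\<integral>\<omega>. (Z \<omega> * indicator A \<omega>) * (tilt u \<omega> * g' (X u \<omega>)) \<partial>M)"
proof (rule integral_dominated_convergence)
  let ?w = "\<lambda>\<omega>. (Z \<omega> * indicator A \<omega>) * (tilt u \<omega> * \<bar>C\<bar>)"
  show "integrable M ?w"
    by (rule integrable_strip_ind[where a=a and b=b and B=B and C="\<bar>C\<bar>" and g="\<lambda>_. \<bar>C\<bar>"]) (use Z A in auto)
  show "AE \<omega> in M. (\<lambda>m. (Z \<omega> * indicator A \<omega>) * (tilt u \<omega> * g m (X u \<omega>))) \<longlonglongrightarrow> (Z \<omega> * indicator A \<omega>) * (tilt u \<omega> * g' (X u \<omega>))"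
  proof (intro AE_I2)
    fix \<omega>
    show "(\<lambda>m. (Z \<omega> * indicator A \<omega>) * (tilt u \<omega> * g m (X u \<omega>))) \<longlonglongrightarrow> (Z \<omega> * indicator A \<omega>) * (tilt u \<omega> * g' (X u \<omega>))"
      using lim[of \<omega>] by (cases "\<omega> \<in> A") (auto intro!: tendsto_intros)
  qed
  fix m
  show "AE \<omega> in M. norm ((Z \<omega> * indicator A \<omega>) * (tilt u \<omega> * g m (X u \<omega>))) \<le> ?w \<omega>"
  proof (intro AE_I2)
    fix \<omega>
    show "norm ((Z \<omega> * indicator A \<omega>) * (tilt u \<omega> * g m (X u \<omega>))) \<le> ?w \<omega>"
    proof (cases "\<omega> \<in> A")
      case True
      have "\<bar>g m (X u \<omega>)\<bar> \<le> \<bar>C\<bar>" using C[OF A[OF True], of m] by linarith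
      then show ?thesis using Z(1)[of \<omega>] True by (auto simp: abs_mult intro!: mult_left_mono)
    qed simp
  qed
qed measurable

text \<open>The upper bound is used on intervals shrinking to \<open>[a, b]\<close> from outside,
  the lower bound on intervals growing to it from inside; both limits agree.\<close>

lemma stay_posmode:
  assumes st: "0 \<le> s" "s < t" and Z: "Z \<in> borel_measurable (F s)" "\<And>\<omega>. 0 \<le> Z \<omega>" "\<And>\<omega>. Z \<omega> \<le> B"
    and ab: "a < b" and k: "k \<ge> 1"
  shows "exp (nu * (t - s)) * (\<integral>\<omega>. (Z \<omega> * indicator (stay a b s t) \<omega>) * (tilt t \<omega> * posmode a b k (X t \<omega>) 0) \<partial>M)
    = (\<integral>\<omega>. (Z \<omega> * indicator (X s -` {a..b} \<inter> space M) \<omega>) * (tilt s \<omega> * posmode a b k (X s \<omega>) (\<sigma>\<^sup>2 / 2 * (t - s))) \<partial>M)"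
    (is "?L = ?R")
proof (rule antisym)
  have t: "0 \<le> t" using st by simp
  have [measurable]: "Z \<in> borel_measurable M" "X t \<in> borel_measurable M" "X s \<in> borel_measurable M"
    using measurable_F_M[OF st(1) Z(1)] measurable_F_M[OF st(1) measurable_X[OF st(1)]] measurable_F_M[OF t measurable_X[OF t]] by auto
  have [measurable]: "stay a b s t \<in> sets M"
    by (rule sets_F_M[OF t stay_sets[OF st]])
  define \<tau> where "\<tau> = \<sigma>\<^sup>2 / 2 * (t - s)"
  have \<tau>: "0 \<le> \<tau>" using st by (simp add: \<tau>_def)
  define \<epsilon> where "\<epsilon> m = inverse (real (Suc m))" for m
  have \<epsilon>: "\<epsilon> m > 0" for m by (simp add: \<epsilon>_def)
  have ind: "\<omega> \<in> space M \<Longrightarrow> indicator (X s -` {a..b} \<inter> space M) \<omega> = (indicator {a..b} (X s \<omega>) :: real)" for \<omega>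
    by (simp add: indicator_def)
  show "?L \<le> ?R"
  proof (rule LIMSEQ_le)
    show "(\<lambda>m. exp (nu * (t - s)) * (\<integral>\<omega>. (Z \<omega> * indicator (stay a b s t) \<omega>) * (tilt t \<omega> * posmode (a - \<epsilon> m) (b + \<epsilon> m) k (X t \<omega>) 0) \<partial>M)) \<longlonglongrightarrow> ?L"
    proof (intro tendsto_intros strip_limit[where a=a and b=b and B=B and C="2 * real k"] Z(2,3))
      show "X t \<omega> \<in> {a..b}" if "\<omega> \<in> stay a b s t" for \<omega> using stay_end[OF that] st by auto
      show "\<bar>posmode (a - \<epsilon> m) (b + \<epsilon> m) k x 0\<bar> \<le> 2 * real k" for m x using abs_posmode_le[OF _ k] by simp
      show "(\<lambda>m. posmode (a - \<epsilon> m) (b + \<epsilon> m) k (X t \<omega>) 0) \<longlonglongrightarrow> posmode a b k (X t \<omega>) 0" for \<omega>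
        unfolding \<epsilon>_def by (rule tendsto_posmode[OF tendsto_inverse_Suc_add(2,1) ab])
    qed measurable
    show "(\<lambda>m. \<integral>\<omega>. (Z \<omega> * indicator (X s -` {a..b} \<inter> space M) \<omega>) * (tilt s \<omega> * posmode (a - \<epsilon> m) (b + \<epsilon> m) k (X s \<omega>) (\<sigma>\<^sup>2 / 2 * (t - s))) \<partial>M) \<longlonglongrightarrow> ?R"
      unfolding \<tau>_def[symmetric]
    proof (intro strip_limit[where a=a and b=b and B=B and C="2 * real k"] Z(2,3))
      show "\<bar>posmode (a - \<epsilon> m) (b + \<epsilon> m) k x \<tau>\<bar> \<le> 2 * real k" for m x using abs_posmode_le[OF \<tau> k] by simp
      show "(\<lambda>m. posmode (a - \<epsilon> m) (b + \<epsilon> m) k (X s \<omega>) \<tau>) \<longlonglongrightarrow> posmode a b k (X s \<omega>) \<tau>" for \<omega>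
        unfolding \<epsilon>_def by (rule tendsto_posmode[OF tendsto_inverse_Suc_add(2,1) ab])
    qed auto
    have "exp (nu * (t - s)) * (\<integral>\<omega>. (Z \<omega> * indicator (stay a b s t) \<omega>) * (tilt t \<omega> * posmode (a - \<epsilon> m) (b + \<epsilon> m) k (X t \<omega>) 0) \<partial>M)
      \<le> (\<integral>\<omega>. (Z \<omega> * indicator (X s -` {a..b} \<inter> space M) \<omega>) * (tilt s \<omega> * posmode (a - \<epsilon> m) (b + \<epsilon> m) k (X s \<omega>) (\<sigma>\<^sup>2 / 2 * (t - s))) \<partial>M)" for m
    proof -
      have "(\<integral>\<omega>. (Z \<omega> * indicator (X s -` {a..b} \<inter> space M) \<omega>) * (tilt s \<omega> * posmode (a - \<epsilon> m) (b + \<epsilon> m) k (X s \<omega>) (\<sigma>\<^sup>2 / 2 * (t - s))) \<partial>M)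
        = (\<integral>\<omega>. (Z \<omega> * indicator {a..b} (X s \<omega>)) * (tilt s \<omega> * posmode (a - \<epsilon> m) (b + \<epsilon> m) k (X s \<omega>) (\<sigma>\<^sup>2 / 2 * (t - s))) \<partial>M)"
        by (rule Bochner_Integration.integral_cong) (auto simp only: ind)
      then show ?thesis using stay_posmode_upper[OF st Z ab k \<epsilon>[of m]] by simp
    qed
    then show "\<exists>N. \<forall>m\<ge>N. exp (nu * (t - s)) * (\<integral>\<omega>. (Z \<omega> * indicator (stay a b s t) \<omega>) * (tilt t \<omega> * posmode (a - \<epsilon> m) (b + \<epsilon> m) k (X t \<omega>) 0) \<partial>M)
      \<le> (\<integral>\<omega>. (Z \<omega> * indicator (X s -` {a..b} \<inter> space M) \<omega>) * (tilt s \<omega> * posmode (a - \<epsilon> m) (b + \<epsilon> m) k (X s \<omega>) (\<sigma>\<^sup>2 / 2 * (t - s))) \<partial>M)"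
      by blast
  qed
  let ?g = "\<lambda>m \<tau> x. indicator {a + \<epsilon> m..b - \<epsilon> m} x * posmode (a + \<epsilon> m) (b - \<epsilon> m) k x \<tau>"
  have gb: "\<bar>?g m \<tau> x\<bar> \<le> 2 * real k" if "0 \<le> \<tau>" for m \<tau> x
    using abs_posmode_le[OF that k] by (auto split: split_indicator)
  show "?R \<le> ?L"
  proof (rule LIMSEQ_le)
    show "(\<lambda>m. exp (nu * (t - s)) * (\<integral>\<omega>. (Z \<omega> * indicator (stay a b s t) \<omega>) * (tilt t \<omega> * ?g m 0 (X t \<omega>)) \<partial>M)) \<longlonglongrightarrow> ?L"
    proof (intro tendsto_intros strip_limit[where a=a and b=b and B=B and C="2 * real k" and g="\<lambda>m x. ?g m 0 x"] Z(2,3))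
      show X: "X t \<omega> \<in> {a..b}" if "\<omega> \<in> stay a b s t" for \<omega> using stay_end[OF that] st by auto
      show "(\<lambda>m. ?g m 0 (X t \<omega>)) \<longlonglongrightarrow> posmode a b k (X t \<omega>) 0" if "\<omega> \<in> stay a b s t" for \<omega>
        unfolding \<epsilon>_def by (rule tendsto_inner_posmode[OF ab X[OF that]])
    qed (auto intro!: gb)
    show "(\<lambda>m. \<integral>\<omega>. (Z \<omega> * indicator (X s -` {a..b} \<inter> space M) \<omega>) * (tilt s \<omega> * ?g m \<tau> (X s \<omega>)) \<partial>M) \<longlonglongrightarrow> ?R"
      unfolding \<tau>_def[symmetric]
    proof (intro strip_limit[where a=a and b=b and B=B and C="2 * real k" and g="\<lambda>m x. ?g m \<tau> x"] Z(2,3))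
      show "(\<lambda>m. ?g m \<tau> (X s \<omega>)) \<longlonglongrightarrow> posmode a b k (X s \<omega>) \<tau>" if "\<omega> \<in> X s -` {a..b} \<inter> space M" for \<omega>
        unfolding \<epsilon>_def using that by (intro tendsto_inner_posmode[OF ab]) auto
    qed (auto intro!: gb[OF \<tau>])
    have "(\<lambda>m. (b - \<epsilon> m) - (a + \<epsilon> m)) \<longlonglongrightarrow> b - a"
      unfolding \<epsilon>_def by (intro tendsto_diff tendsto_inverse_Suc_add)
    then have "\<forall>\<^sub>F m in sequentially. 0 < (b - \<epsilon> m) - (a + \<epsilon> m)"
      using ab by (intro order_tendstoD(1)) auto
    \<comment> \<open>The lower bound needs a nondegenerate inner interval, which holds only from
      some index on.\<close>
    then obtain N where N: "\<And>m. m \<ge> N \<Longrightarrow> a + \<epsilon> m < b - \<epsilon> m" unfolding eventually_sequentially by fastforce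
    have "(\<integral>\<omega>. (Z \<omega> * indicator (X s -` {a..b} \<inter> space M) \<omega>) * (tilt s \<omega> * ?g m \<tau> (X s \<omega>)) \<partial>M)
      \<le> exp (nu * (t - s)) * (\<integral>\<omega>. (Z \<omega> * indicator (stay a b s t) \<omega>) * (tilt t \<omega> * ?g m 0 (X t \<omega>)) \<partial>M)" if "m \<ge> N" for m
    proof -
      have "(\<integral>\<omega>. (Z \<omega> * indicator (X s -` {a..b} \<inter> space M) \<omega>) * (tilt s \<omega> * ?g m \<tau> (X s \<omega>)) \<partial>M)
       = (\<integral>\<omega>. (Z \<omega> * indicator {a + \<epsilon> m..b - \<epsilon> m} (X s \<omega>)) * (tilt s \<omega> * posmode (a + \<epsilon> m) (b - \<epsilon> m) k (X s \<omega>) \<tau>) \<partial>M)"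
        using \<epsilon>[of m] by (intro Bochner_Integration.integral_cong) (auto simp: indicator_def)
      then show ?thesis using stay_posmode_lower[OF st Z _ N[OF that] _ k, of a b] \<epsilon>[of m] by (simp add: \<tau>_def)
    qed
    then show "\<exists>N. \<forall>m\<ge>N. (\<integral>\<omega>. (Z \<omega> * indicator (X s -` {a..b} \<inter> space M) \<omega>) * (tilt s \<omega> * ?g m \<tau> (X s \<omega>)) \<partial>M)
      \<le> exp (nu * (t - s)) * (\<integral>\<omega>. (Z \<omega> * indicator (stay a b s t) \<omega>) * (tilt t \<omega> * ?g m 0 (X t \<omega>)) \<partial>M)"
      by blast
  qed
qed

text \<open>The kernel is identified weakly: the difference of the two sides is a functional of
  \<open>f\<close>, and on sines both are explicit, the right one because the kernel acts diagonally
  on them.\<close>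

lemma stay_heat:
  fixes L :: real and f :: "real \<Rightarrow> real"
  assumes st: "0 \<le> s" "s < t" and Z: "Z \<in> borel_measurable (F s)" "\<And>\<omega>. 0 \<le> Z \<omega>" "\<And>\<omega>. Z \<omega> \<le> B"
    and L: "L > 0" and f: "continuous_on UNIV f"
  shows "exp (nu * (t - s)) * (\<integral>\<omega>. (Z \<omega> * indicator (stay 0 L s t) \<omega>) * (tilt t \<omega> * f (X t \<omega>)) \<partial>M)
    = (\<integral>\<omega>. (Z \<omega> * indicator (X s -` {0..L} \<inter> space M) \<omega>) * (tilt s \<omega>
        * (LINT z:{0..L}|lborel. dker L (\<sigma>\<^sup>2 / 2 * (t - s)) z (X s \<omega>) * f z)) \<partial>M)"
proof -
  have t: "0 \<le> t" using st by simp
  have [measurable]: "Z \<in> borel_measurable M" "X t \<in> borel_measurable M" "X s \<in> borel_measurable M"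
    using measurable_F_M[OF st(1) Z(1)] measurable_F_M[OF st(1) measurable_X[OF st(1)]] measurable_F_M[OF t measurable_X[OF t]] by auto
  have [measurable]: "stay 0 L s t \<in> sets M"
    by (rule sets_F_M[OF t stay_sets[OF st]])
  have stay_bd: "X t \<omega> \<in> {0..L}" if "\<omega> \<in> stay 0 L s t" for \<omega>
    using stay_end[OF that] st by auto
  define \<tau> where "\<tau> = \<sigma>\<^sup>2 / 2 * (t - s)"
  have \<tau>: "0 < \<tau>" using st sigma by (simp add: \<tau>_def)
  obtain D where D: "D \<ge> 0" "\<And>z x. \<bar>dker L \<tau> z x\<bar> \<le> D" using dker_bounded[OF L \<tau>] by blast
  define K where "K f x = (LINT z:{0..L}|lborel. dker L \<tau> z x * f z)" for f :: "real \<Rightarrow> real" and x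
  have Km [measurable]: "K f \<in> borel_measurable borel" if "continuous_on UNIV f" for f
  proof -
    have [measurable]: "f \<in> borel_measurable borel" using that by (rule borel_measurable_continuous_onI)
    show ?thesis unfolding K_def set_lebesgue_integral_def by measurable
  qed
  have Kb: "\<bar>K f x\<bar> \<le> L * (D * C)" if "\<And>x. x \<in> {0..L} \<Longrightarrow> \<bar>f x\<bar> \<le> C" for f x C
    unfolding K_def
  proof (rule abs_set_integral_Icc_le)
    fix z assume "z \<in> {0..L}"
    then show "\<bar>dker L \<tau> z x * f z\<bar> \<le> D * C" unfolding abs_mult using D that by (intro mult_mono) auto
  qed (use L in simp)
  have Ki: "set_integrable lborel {0..L} (\<lambda>z. dker L \<tau> z x * f z)" if f: "continuous_on UNIV f" for f x
  proof -
    have [measurable]: "f \<in> borel_measurable borel" using f by (rule borel_measurable_continuous_onI)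
    obtain C where C: "C \<ge> 0" "\<And>x. x \<in> {0..L} \<Longrightarrow> \<bar>f x\<bar> \<le> C" using continuous_bounded_Icc[OF f] by blast
    show ?thesis unfolding set_integrable_def
    proof (rule Bochner_Integration.integrable_bound)
      show "integrable lborel (\<lambda>z. indicator {0..L} z * (D * C))"
        by (intro integrable_mult_left integrable_real_indicator) (auto simp: emeasure_lborel_Icc_eq)
      show "AE z in lborel. norm (indicator {0..L} z *\<^sub>R (dker L \<tau> z x * f z)) \<le> norm (indicator {0..L} z * (D * C))"
        using C D by (intro AE_I2) (auto simp: abs_mult split: split_indicator intro!: mult_mono)
    qed measurable
  qed
  have Klin: "K (\<lambda>z. c * f z + g z) x = c * K f x + K g x" if "continuous_on UNIV f" "continuous_on UNIV g" for c f g x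
  proof -
    have "K (\<lambda>z. c * f z + g z) x = (LINT z:{0..L}|lborel. c * (dker L \<tau> z x * f z) + dker L \<tau> z x * g z)"
      unfolding K_def by (simp add: algebra_simps)
    also have "\<dots> = c * K f x + K g x"
      unfolding K_def by (subst set_integral_add(2)) (use Ki that in auto)
    finally show ?thesis .
  qed
  define \<Phi>1 where "\<Phi>1 f = (\<integral>\<omega>. (Z \<omega> * indicator (stay 0 L s t) \<omega>) * (tilt t \<omega> * f (X t \<omega>)) \<partial>M)" for f
  define \<Phi>2 where "\<Phi>2 f = (\<integral>\<omega>. (Z \<omega> * indicator (X s -` {0..L} \<inter> space M) \<omega>) * (tilt s \<omega> * K f (X s \<omega>)) \<partial>M)" for f
  have i1: "integrable M (\<lambda>\<omega>. (Z \<omega> * indicator (stay 0 L s t) \<omega>) * (tilt t \<omega> * f (X t \<omega>)))" if f: "continuous_on UNIV f" for f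
  proof -
    obtain C where C: "C \<ge> 0" "\<And>x. x \<in> {0..L} \<Longrightarrow> \<bar>f x\<bar> \<le> C" using continuous_bounded_Icc[OF f] by blast
    show ?thesis
      by (rule integrable_strip_ind[where a=0 and b=L and B=B and C=C])
         (use Z(2,3) stay_bd C borel_measurable_continuous_onI[OF f] in auto)
  qed
  have i2: "integrable M (\<lambda>\<omega>. (Z \<omega> * indicator (X s -` {0..L} \<inter> space M) \<omega>) * (tilt s \<omega> * K f (X s \<omega>)))" if f: "continuous_on UNIV f" for f
  proof -
    obtain C where C: "C \<ge> 0" "\<And>x. x \<in> {0..L} \<Longrightarrow> \<bar>f x\<bar> \<le> C" using continuous_bounded_Icc[OF f] by blast
    show ?thesis
      by (rule integrable_strip_ind[where a=0 and b=L and B=B and C="L * (D * C)"])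
         (use Z(2,3) C Kb[of f C] Km[OF f] in auto)
  qed
  have lin1: "\<Phi>1 (\<lambda>x. c * f x + g x) = c * \<Phi>1 f + \<Phi>1 g" if fg: "continuous_on UNIV f" "continuous_on UNIV g" for c f g
  proof -
    have "\<Phi>1 (\<lambda>x. c * f x + g x) = (\<integral>\<omega>. c * ((Z \<omega> * indicator (stay 0 L s t) \<omega>) * (tilt t \<omega> * f (X t \<omega>)))
        + (Z \<omega> * indicator (stay 0 L s t) \<omega>) * (tilt t \<omega> * g (X t \<omega>)) \<partial>M)"
      unfolding \<Phi>1_def by (simp add: algebra_simps)
    also have "\<dots> = c * \<Phi>1 f + \<Phi>1 g"
      unfolding \<Phi>1_def by (subst Bochner_Integration.integral_add) (use i1 fg in auto)
    finally show ?thesis .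
  qed
  have lin2: "\<Phi>2 (\<lambda>x. c * f x + g x) = c * \<Phi>2 f + \<Phi>2 g" if fg: "continuous_on UNIV f" "continuous_on UNIV g" for c f g
  proof -
    have "\<Phi>2 (\<lambda>x. c * f x + g x) = (\<integral>\<omega>. c * ((Z \<omega> * indicator (X s -` {0..L} \<inter> space M) \<omega>) * (tilt s \<omega> * K f (X s \<omega>)))
        + (Z \<omega> * indicator (X s -` {0..L} \<inter> space M) \<omega>) * (tilt s \<omega> * K g (X s \<omega>)) \<partial>M)"
      unfolding \<Phi>2_def Klin[OF fg] by (simp add: algebra_simps)
    also have "\<dots> = c * \<Phi>2 f + \<Phi>2 g"
      unfolding \<Phi>2_def by (subst Bochner_Integration.integral_add) (use i2 fg in auto)
    finally show ?thesis .
  qed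
  let ?\<Phi> = "\<lambda>f. exp (nu * (t - s)) * \<Phi>1 f - \<Phi>2 f"
  have "?\<Phi> f = 0"
  proof (rule functional_eq_0_of_sines[OF L, where \<Phi>="?\<Phi>"])
    fix c f g assume fg: "continuous_on UNIV (f :: real \<Rightarrow> real)" "continuous_on UNIV (g :: real \<Rightarrow> real)"
    show "?\<Phi> (\<lambda>x. c * f x + g x) = c * ?\<Phi> f + ?\<Phi> g"
      unfolding lin1[OF fg] lin2[OF fg] by (simp add: algebra_simps)
  next
    fix fm :: "nat \<Rightarrow> real \<Rightarrow> real" and f :: "real \<Rightarrow> real" and C
    assume fm: "\<And>m. continuous_on UNIV (fm m)" and f: "continuous_on UNIV f"
      and C: "\<And>m x. x \<in> {0..L} \<Longrightarrow> \<bar>fm m x\<bar> \<le> C" and lim: "\<And>x. x \<in> {0<..<L} \<Longrightarrow> (\<lambda>m. fm m x) \<longlonglongrightarrow> f x"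
    have [measurable]: "\<And>m. fm m \<in> borel_measurable borel" "f \<in> borel_measurable borel"
      using fm f by (auto intro: borel_measurable_continuous_onI)
    have "(\<lambda>m. \<Phi>1 (fm m)) \<longlonglongrightarrow> \<Phi>1 f"
      unfolding \<Phi>1_def
    proof (rule strip_limit[where a=0 and b=L and C=C and B=B])
      show "(\<lambda>m. fm m (X t \<omega>)) \<longlonglongrightarrow> f (X t \<omega>)" if "\<omega> \<in> stay 0 L s t" for \<omega>
        using stay_end[OF that] st by (intro lim) auto
    qed (use Z(2,3) stay_bd C in auto)
    moreover have "(\<lambda>m. \<Phi>2 (fm m)) \<longlonglongrightarrow> \<Phi>2 f"
      unfolding \<Phi>2_def
    proof (rule strip_limit[where a=0 and b=L and C="L * (D * C)" and B=B])
      show "(\<lambda>m. K (fm m) (X s \<omega>)) \<longlonglongrightarrow> K f (X s \<omega>)" for \<omega>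
        unfolding K_def set_lebesgue_integral_def
      proof (rule integral_dominated_convergence[where w="\<lambda>z. indicator {0..L} z * (D * C)"])
        show "integrable lborel (\<lambda>z. indicator {0..L} z * (D * C))"
          by (intro integrable_mult_left integrable_real_indicator) (auto simp: emeasure_lborel_Icc_eq)
        show "AE z in lborel. (\<lambda>m. indicator {0..L} z *\<^sub>R (dker L \<tau> z (X s \<omega>) * fm m z)) \<longlonglongrightarrow> indicator {0..L} z *\<^sub>R (dker L \<tau> z (X s \<omega>) * f z)"
        proof -
          \<comment> \<open>Convergence is known only on the open interval; its two ends form a null
            set for the kernel integral.\<close>
          have "AE z in lborel. z \<noteq> 0 \<and> z \<noteq> L"
            using AE_lborel_singleton[of 0] AE_lborel_singleton[of L] by eventually_elim auto
          then show ?thesis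
          proof eventually_elim
            fix z assume "z \<noteq> 0 \<and> z \<noteq> L"
            then show "(\<lambda>m. indicator {0..L} z *\<^sub>R (dker L \<tau> z (X s \<omega>) * fm m z)) \<longlonglongrightarrow> indicator {0..L} z *\<^sub>R (dker L \<tau> z (X s \<omega>) * f z)"
              using lim[of z] by (cases "z \<in> {0..L}") (auto intro!: tendsto_intros)
          qed
        qed
        show "AE z in lborel. norm (indicator {0..L} z *\<^sub>R (dker L \<tau> z (X s \<omega>) * fm m z)) \<le> indicator {0..L} z * (D * C)" for m
          using D C[of _ m] by (intro AE_I2) (auto simp: abs_mult split: split_indicator intro!: mult_mono)
      qed measurable
      show "\<bar>K (fm m) x\<bar> \<le> L * (D * C)" for m x using C by (rule Kb)
    qed (use Z(2,3) Km[OF fm] Km[OF f] in auto)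
    ultimately show "(\<lambda>m. ?\<Phi> (fm m)) \<longlonglongrightarrow> ?\<Phi> f" by (intro tendsto_intros)
  next
    fix k
    have ck: "continuous_on UNIV (\<lambda>x. sin (real k * pi * x / L))" for k using L by (intro continuous_intros) auto
    have mode: "mode 0 L k x 0 = sin (real k * pi * x / L)" for k x by (simp add: mode_def)
    have Ks: "K (\<lambda>x. sin (real k * pi * x / L)) x = mode 0 L k x \<tau>" for k x
      unfolding K_def by (rule dker_eigen[OF L \<tau>])
    define s1 where "s1 k = ?\<Phi> (\<lambda>x. sin (real k * pi * x / L))" for k
    \<comment> \<open>\<open>stay_posmode\<close> yields only combinations with the ground state. At
      k = 1 it says 2 * s1 1 = 0, and then the other indices follow.\<close>
    have lin: "s1 k + real k * s1 1 = 0" if "k \<ge> 1" for k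
    proof -
      have p1: "\<Phi>1 (\<lambda>x. posmode 0 L k x 0) = real k * \<Phi>1 (\<lambda>x. sin (real 1 * pi * x / L)) + \<Phi>1 (\<lambda>x. sin (real k * pi * x / L))"
        unfolding lin1[OF ck ck, symmetric] posmode_def mode by (simp add: add.commute)
      have p2: "(\<integral>\<omega>. (Z \<omega> * indicator (X s -` {0..L} \<inter> space M) \<omega>) * (tilt s \<omega> * posmode 0 L k (X s \<omega>) \<tau>) \<partial>M)
          = real k * \<Phi>2 (\<lambda>x. sin (real 1 * pi * x / L)) + \<Phi>2 (\<lambda>x. sin (real k * pi * x / L))"
        unfolding lin2[OF ck ck, symmetric] unfolding \<Phi>2_def Klin[OF ck ck] Ks posmode_def by (simp add: add.commute)
      have "exp (nu * (t - s)) * \<Phi>1 (\<lambda>x. posmode 0 L k x 0) = (\<integral>\<omega>. (Z \<omega> * indicator (X s -` {0..L} \<inter> space M) \<omega>) * (tilt s \<omega> * posmode 0 L k (X s \<omega>) \<tau>) \<partial>M)"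
        unfolding \<Phi>1_def \<tau>_def by (rule stay_posmode[OF st Z L that])
      then show ?thesis unfolding p1 p2 s1_def by (simp add: algebra_simps)
    qed
    have "s1 1 = 0" using lin[of 1] by simp
    moreover have "s1 0 = 0"
    proof -
      have "\<Phi>1 (\<lambda>_. 0) = 0" "\<Phi>2 (\<lambda>_. 0) = 0" by (simp_all add: \<Phi>1_def \<Phi>2_def K_def)
      then show ?thesis by (simp add: s1_def)
    qed
    ultimately have "s1 k = 0" using lin[of k] by (cases "k = 0") auto
    then show "?\<Phi> (\<lambda>x. sin (real k * pi * x / L)) = 0" by (simp add: s1_def)
  qed (rule f)
  then show ?thesis unfolding \<Phi>1_def \<Phi>2_def K_def \<tau>_def by simp
qed

end

section \<open>Backward induction over the barrier periods\<close>

text \<open>After a change of variable the point enters only through the continuous density, so a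
  bounded measurable \<open>f\<close> suffices. This is what makes the free solution a legitimate
  datum for \<open>stay_heat\<close>, which asks for continuity.\<close>

lemma continuous_normal_convolution:
  fixes f :: "real \<Rightarrow> real"
  assumes "s > 0" and [measurable]: "f \<in> borel_measurable borel" and "\<And>x. \<bar>f x\<bar> \<le> C" "\<And>x. x \<notin> {0..L} \<Longrightarrow> f x = 0"
  shows "continuous_on UNIV (\<lambda>x. \<integral>z. normal_density 0 s z * f (x + z) \<partial>lborel)"
proof -
  \<comment> \<open>The substitution w = x + z moves the point from \<open>f\<close> to the
    density.\<close>
  have eq: "(\<integral>z. normal_density 0 s z * f (x + z) \<partial>lborel) = (\<integral>w. normal_density 0 s (w - x) * f w \<partial>lborel)" for x
    using lborel_integral_real_affine[of 1 "\<lambda>w. normal_density 0 s (w - x) * f w" x] by simp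
  define D where "D = 1 / sqrt (2 * pi * s\<^sup>2)"
  have D0: "0 \<le> D" by (simp add: D_def)
  have D: "normal_density 0 s y \<le> D" for y
  proof -
    have "D * exp (- (y - 0)\<^sup>2 / (2 * s\<^sup>2)) \<le> D * 1" using D0 by (intro mult_left_mono) auto
    then show ?thesis by (simp add: normal_density_def D_def)
  qed
  have C: "0 \<le> C" using assms(3)[of 0] abs_ge_zero order_trans by blast
  show ?thesis
    unfolding eq continuous_on_sequentially
  proof (intro allI ballI impI, elim conjE)
    fix u x assume u: "u \<longlonglongrightarrow> (x :: real)"
    show "((\<lambda>x. \<integral>w. normal_density 0 s (w - x) * f w \<partial>lborel) \<circ> u) \<longlonglongrightarrow> (\<integral>w. normal_density 0 s (w - x) * f w \<partial>lborel)"
      unfolding comp_def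
    proof (rule integral_dominated_convergence[where w="\<lambda>w. indicator {0..L} w * (D * C)"])
      show "integrable lborel (\<lambda>w. indicator {0..L} w * (D * C))"
        by (intro integrable_mult_left integrable_real_indicator) (auto simp: emeasure_lborel_Icc_eq)
      show "AE w in lborel. (\<lambda>m. normal_density 0 s (w - u m) * f w) \<longlonglongrightarrow> normal_density 0 s (w - x) * f w"
        unfolding normal_density_def using u assms(1) by (intro AE_I2 tendsto_intros) auto
      show "AE w in lborel. norm (normal_density 0 s (w - u m) * f w) \<le> indicator {0..L} w * (D * C)" for m
      proof (rule AE_I2)
        fix w
        show "norm (normal_density 0 s (w - u m) * f w) \<le> indicator {0..L} w * (D * C)"
        proof (cases "w \<in> {0..L}")
          case True
          then show ?thesis using D D0 assms(3)[of w] C by (auto simp: abs_mult intro!: mult_mono)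
        qed (use assms(4) in simp)
      qed
    qed measurable
  qed
qed

text \<open>Rescaling y by \<open>sd\<close> turns the moving cut-off into the fixed requirement
  that the Gaussian step land in \<open>[0, L]\<close>.\<close>

lemma U_free_normal:
  fixes L a p t :: real and tau :: "nat \<Rightarrow> real" and j n :: nat
  assumes "L > 0" "p > 0" "tau n = 0" "t > tau (n - j) + p"
  shows "U_free L a p tau n j x t = (\<integral>z. normal_density 0 (sqrt (2 * (t - (tau (n - j) + p)))) z
      * (indicator {0..L} (x + z) * U_barrier L a p tau n j (x + z) (tau (n - j) + p)) \<partial>lborel)"
proof -
  define sd where "sd = sqrt (2 * (t - (tau (n - j) + p)))"
  have sd: "sd > 0" using assms by (simp add: sd_def)
  have "indicator {- x / sd .. (L - x) / sd} y = (indicator {0..L} (x + sd * y) :: real)" for y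
    using sd by (auto simp: indicator_def field_simps)
  then show ?thesis
    unfolding U_free_eq[where tau=tau and n=n, OF assms(1-3)] normal_integral_scale[OF sd, folded sd_def] sd_def[symmetric]
      normal_integral_scale[OF sd]
    by (simp add: mult_ac)
qed

lemma continuous_U_free:
  fixes L a p t :: real and tau :: "nat \<Rightarrow> real" and j n :: nat
  assumes "L > 0" "p > 0" "tau n = 0" "t > tau (n - j) + p"
  shows "continuous_on UNIV (\<lambda>x. U_free L a p tau n j x t)"
proof -
  have c: "tau (n - j) + p > tau (n - j)" using assms by simp
  obtain C where C: "\<And>x. \<bar>U_barrier L a p tau n j x (tau (n - j) + p)\<bar> \<le> C"
    using U_barrier_bounded[OF assms(1,2) c assms(3)] by blast
  have C0: "0 \<le> C" using C[of 0] abs_ge_zero order_trans by blast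
  note measurable_U_barrier[OF assms(1,2) c assms(3), measurable]
  show ?thesis
    unfolding U_free_normal[where tau=tau and n=n, OF assms]
    by (rule continuous_normal_convolution[where C=C and L=L
         and f="\<lambda>x. indicator {0..L} x * U_barrier L a p tau n j x (tau (n - j) + p)"])
       (use assms C C0 in \<open>auto simp: abs_mult split: split_indicator\<close>)
qed

section \<open>Conditional expectation on an event\<close>

lemma (in bm_drift) stay_sets_le:
  assumes "0 \<le> s" "s \<le> t"
  shows "stay a b s t \<in> sets (F t)"
proof (cases "s = t")
  case True
  have [measurable]: "X t \<in> borel_measurable (F t)" using assms True by (intro measurable_X) simp
  have "stay a b s t = X t -` {a<..<b} \<inter> space (F t)"
    using True space_F[of t] assms by (auto simp: stay_def)
  then show ?thesis by simp
qed (use assms stay_sets in auto)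

lemma (in bm_drift) sets_F_mono:
  assumes "0 \<le> s" "s \<le> t" "A \<in> sets (F s)"
  shows "A \<in> sets (F t)"
  using BM assms by (auto simp: std_BM_def)

text \<open>The indicator of \<open>A\<close> is pulled out of the conditional expectation, and the
  localised version is characterised by testing. Only the product of \<open>g\<close> with that
  indicator must be integrable. \<open>Y\<close> is tied to an indicator on the space alone, as the
  payoff is defined by a condition on all points of the type.\<close>

lemma (in bm_drift) cond_exp_on_event:
  fixes g :: "'a \<Rightarrow> real"
  assumes t: "0 \<le> t" and A: "A \<in> sets (F t)" and S: "S \<in> sets M" and Y: "\<And>\<omega>. \<omega> \<in> space M \<Longrightarrow> Y \<omega> = indicator S \<omega>"
    and g: "g \<in> borel_measurable (F t)" and gi: "integrable M (\<lambda>\<omega>. indicator A \<omega> * g \<omega>)"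
    and eq: "\<And>D. D \<in> sets (F t) \<Longrightarrow> (\<integral>\<omega>. indicator (D \<inter> A) \<omega> * indicator S \<omega> \<partial>M) = (\<integral>\<omega>. indicator (D \<inter> A) \<omega> * g \<omega> \<partial>M)"
  shows "AE \<omega> in M. \<omega> \<in> A \<longrightarrow> real_cond_exp M (F t) Y \<omega> = g \<omega>"
proof -
  interpret fs: finite_measure_subalgebra M "F t"
    by unfold_locales (rule subalg_F[OF t])
  have [measurable]: "A \<in> sets M" "S \<in> sets M" using sets_F_M[OF t A] S by auto
  have Ym [measurable]: "Y \<in> borel_measurable M"
    using Y by (subst measurable_cong[where g="indicator S"]) auto
  have Y1: "integrable M (\<lambda>\<omega>. indicator A \<omega> * Y \<omega>)"
    by (rule integrable_bounded[where C=1]) (auto simp: Y split: split_indicator)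
  have 1: "AE \<omega> in M. real_cond_exp M (F t) (\<lambda>\<omega>. indicator A \<omega> * Y \<omega>) \<omega> = indicator A \<omega> * real_cond_exp M (F t) Y \<omega>"
    using A Y1 by (intro fs.real_cond_exp_mult) auto
  have 2: "AE \<omega> in M. real_cond_exp M (F t) (\<lambda>\<omega>. indicator A \<omega> * Y \<omega>) \<omega> = indicator A \<omega> * g \<omega>"
  proof (rule fs.real_cond_exp_charact[OF _ Y1 gi])
    show "(\<lambda>\<omega>. indicator A \<omega> * g \<omega>) \<in> borel_measurable (F t)" using A g by measurable
    fix D assume D: "D \<in> sets (F t)"
    have "(\<integral>\<omega>\<in>D. indicator A \<omega> * Y \<omega> \<partial>M) = (\<integral>\<omega>. indicator (D \<inter> A) \<omega> * indicator S \<omega> \<partial>M)"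
      unfolding set_lebesgue_integral_def
      by (rule Bochner_Integration.integral_cong) (auto simp: Y split: split_indicator)
    also have "\<dots> = (\<integral>\<omega>. indicator (D \<inter> A) \<omega> * g \<omega> \<partial>M)" by (rule eq[OF D])
    also have "\<dots> = (\<integral>\<omega>\<in>D. indicator A \<omega> * g \<omega> \<partial>M)"
      unfolding set_lebesgue_integral_def
      by (rule Bochner_Integration.integral_cong) (auto split: split_indicator)
    finally show "(\<integral>\<omega>\<in>D. indicator A \<omega> * Y \<omega> \<partial>M) = (\<integral>\<omega>\<in>D. indicator A \<omega> * g \<omega> \<partial>M)" .
  qed
  from 1 2 show ?thesis by eventually_elim auto
qed

section \<open>Backward recursion of the contract value\<close>

locale barrier_periods = bm_drift M F W x0 \<mu> \<sigma>
  for M :: "'a measure" and F :: "real \<Rightarrow> 'a measure" and W :: "real \<Rightarrow> 'a \<Rightarrow> real" and x0 \<mu> \<sigma> :: real +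
  fixes L P :: real and n :: nat and T :: "nat \<Rightarrow> real"
  assumes L: "0 < L" and P: "0 < P" and n: "1 \<le> n" and T0: "0 < T 0"
    and gap: "\<And>i. Suc i < n \<Longrightarrow> T i + P < T (Suc i)"
begin

text \<open>Truncated subtraction makes \<open>tau 0\<close> equal to \<open>tau 1\<close>, not
  infinite; the gap before the first period is therefore recognised by
  \<open>Suc j = n\<close>.\<close>

definition tau :: "nat \<Rightarrow> real" where "tau i = \<sigma>\<^sup>2 / 2 * (T (n - 1) - T (i - 1))"

definition p :: real where "p = \<sigma>\<^sup>2 / 2 * P"

definition clock :: "real \<Rightarrow> real" where "clock t = \<sigma>\<^sup>2 / 2 * (T (n - 1) + P - t)"

abbreviation UB :: "nat \<Rightarrow> real \<Rightarrow> real \<Rightarrow> real" where "UB \<equiv> U_barrier L al p tau n"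

abbreviation UF :: "nat \<Rightarrow> real \<Rightarrow> real \<Rightarrow> real" where "UF \<equiv> U_free L al p tau n"

abbreviation fwd :: "real \<Rightarrow> real" where "fwd t \<equiv> exp (- nu * (T (n - 1) + P - t))"

text \<open>Periods are counted back from maturity, in step with the index j of the
  solution.\<close>

definition surv :: "nat \<Rightarrow> 'a set" where
  "surv j = {\<omega> \<in> space M. \<forall>i\<in>{n - j..<n}. \<omega> \<in> stay 0 L (T i) (T i + P)}"

lemma p_pos: "0 < p" using P sigma by (simp add: p_def)

lemma tau_n: "tau n = 0" by (simp add: tau_def)

lemma T_gap: "i < k \<Longrightarrow> k < n \<Longrightarrow> T i + P < T k"
proof (induction k)
  case (Suc k)
  show ?case
  proof (cases "i = k")
    case False
    then have "T i + P < T k" using Suc by simp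
    then show ?thesis using gap[of k] Suc.prems P by linarith
  qed (use gap Suc.prems in simp)
qed simp

lemma T_pos: "i < n \<Longrightarrow> 0 < T i"
  using T_gap[of 0 i] T0 P by (cases "i = 0") auto

lemma surv_sets: "surv j \<in> sets M"
proof -
  have [measurable]: "stay 0 L (T i) (T i + P) \<in> sets M" if "i \<in> {n - j..<n}" for i
    using T_pos[of i] P that by (intro sets_F_M[OF _ stay_sets]) auto
  show ?thesis unfolding surv_def by measurable
qed

lemma surv_0: "surv 0 = space M" by (simp add: surv_def)

lemma surv_Suc:
  assumes "j < n"
  shows "surv (Suc j) = stay 0 L (T (n - Suc j)) (T (n - Suc j) + P) \<inter> surv j"
proof -
  have "{n - Suc j..<n} = insert (n - Suc j) {n - j..<n}" using assms by auto
  then show ?thesis by (auto simp: surv_def stay_def)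
qed

lemma clock_at:
  assumes "j < n"
  shows "clock (T (n - Suc j)) = tau (n - j) + p" "clock (T (n - Suc j) + P) = tau (n - j)"
  by (simp_all add: clock_def tau_def p_def algebra_simps)

lemma clock_diff: "clock s - clock t = \<sigma>\<^sup>2 / 2 * (t - s)"
  unfolding clock_def right_diff_distrib[symmetric] by simp

lemma clock_less: "clock s < clock t \<longleftrightarrow> t < s"
  using sigma by (simp add: clock_def)

text \<open>One Gaussian step from \<open>t\<close> to the start of the next barrier period, where
  the value is known. A weight known at \<open>t\<close> is also a weight for that later
  time.\<close>

lemma value_free_step:
  assumes j: "j < n"
    and IH: "\<And>Z. Z \<in> borel_measurable (F (T (n - Suc j))) \<Longrightarrow> (\<And>\<omega>. 0 \<le> Z \<omega>) \<Longrightarrow> (\<And>\<omega>. Z \<omega> \<le> B) \<Longrightarrow>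
      (\<integral>\<omega>. Z \<omega> * indicator (stay 0 L (T (n - Suc j)) (T (n - Suc j) + P) \<inter> surv j) \<omega> \<partial>M)
      = fwd (T (n - Suc j)) * (\<integral>\<omega>. Z \<omega> * (tilt (T (n - Suc j)) \<omega>
          * (indicator {0..L} (X (T (n - Suc j)) \<omega>) * UB j (X (T (n - Suc j)) \<omega>) (clock (T (n - Suc j))))) \<partial>M)"
    and t: "0 \<le> t" "t < T (n - Suc j)" and Z: "Z \<in> borel_measurable (F t)" "\<And>\<omega>. 0 \<le> Z \<omega>" "\<And>\<omega>. Z \<omega> \<le> B"
  shows "(\<integral>\<omega>. Z \<omega> * indicator (surv (Suc j)) \<omega> \<partial>M)
      = fwd t * (\<integral>\<omega>. Z \<omega> * (tilt t \<omega> * UF j (X t \<omega>) (clock t)) \<partial>M)"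
proof -
  let ?s = "T (n - Suc j)" and ?c = "tau (n - j) + p"
  define f where "f x = indicator {0..L} x * UB j x ?c" for x
  have c: "?c > tau (n - j)" using p_pos by simp
  note measurable_U_barrier[where tau=tau, OF L p_pos c tau_n, of al, measurable]
  obtain C where C: "\<And>x. \<bar>UB j x ?c\<bar> \<le> C"
    using U_barrier_bounded[where tau=tau, OF L p_pos c tau_n] by blast
  have C0: "0 \<le> C" using C[of 0] abs_ge_zero order_trans by blast
  have fm: "f \<in> borel_measurable borel" unfolding f_def by measurable
  have fb: "\<bar>exp (al * x) * f x\<bar> \<le> exp (\<bar>al\<bar> * (\<bar>0\<bar> + \<bar>L\<bar>)) * C" for x
    using exp_strip_bound[of x 0 L al] C[of x] C0
    by (cases "x \<in> {0..L}") (auto simp: f_def abs_mult intro!: mult_mono)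
  have ct: "clock t - ?c = \<sigma>\<^sup>2 / 2 * (?s - t)" using clock_at(1)[OF j] clock_diff[of t ?s] by simp
  have ct': "clock t > ?c" using clock_less[of ?s t] clock_at(1)[OF j] t by simp
  have "(\<integral>\<omega>. Z \<omega> * indicator (surv (Suc j)) \<omega> \<partial>M)
    = fwd ?s * (\<integral>\<omega>. Z \<omega> * (tilt ?s \<omega> * f (X ?s \<omega>)) \<partial>M)"
    unfolding surv_Suc[OF j] f_def clock_at(1)[OF j, symmetric]
    by (rule IH) (use Z t measurable_F_mono[OF t(1) _ Z(1)] in auto)
  also have "(\<integral>\<omega>. Z \<omega> * (tilt ?s \<omega> * f (X ?s \<omega>)) \<partial>M)
    = exp (- nu * (?s - t)) * (\<integral>\<omega>. Z \<omega> * (tilt t \<omega>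
        * (\<integral>z. normal_density 0 (sqrt (2 * (\<sigma>\<^sup>2 / 2 * (?s - t)))) z * f (X t \<omega> + z) \<partial>lborel)) \<partial>M)"
    using Z by (intro markov_exp[OF t Z(1) _ fm fb, where B=B]) auto
  also have "(\<lambda>\<omega>. \<integral>z. normal_density 0 (sqrt (2 * (\<sigma>\<^sup>2 / 2 * (?s - t)))) z * f (X t \<omega> + z) \<partial>lborel)
    = (\<lambda>\<omega>. UF j (X t \<omega>) (clock t))"
    unfolding U_free_normal[where tau=tau, OF L p_pos tau_n ct'] ct f_def ..
  also have "fwd ?s * (exp (- nu * (?s - t)) * A) = fwd t * A" for A
    unfolding mult.assoc[symmetric] exp_add[symmetric] by (simp add: algebra_simps)
  finally show ?thesis .
qed

text \<open>The payoff 1 is written as tilt times exp(- al x), so the terminal datum of the heat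
  problem is exp(- al x); this is the origin of the exponential factor in
  \<open>g_0\<close>.\<close>

lemma value_barrier_0:
  assumes t: "T (n - 1) \<le> t" "t < T (n - 1) + P" and Z: "Z \<in> borel_measurable (F t)" "\<And>\<omega>. 0 \<le> Z \<omega>" "\<And>\<omega>. Z \<omega> \<le> B"
  shows "(\<integral>\<omega>. Z \<omega> * indicator (stay 0 L t (T (n - 1) + P) \<inter> surv 0) \<omega> \<partial>M)
      = fwd t * (\<integral>\<omega>. Z \<omega> * (tilt t \<omega>
          * (indicator {0..L} (X t \<omega>) * UB 0 (X t \<omega>) (clock t))) \<partial>M)"
proof -
  let ?e = "T (n - 1) + P"
  have t0: "0 \<le> t" using T_pos[of "n - 1"] n t by simp
  have ct: "clock t > 0" using t sigma by (simp add: clock_def)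
  have c: "continuous_on UNIV (\<lambda>x. exp (- al * x))" by (intro continuous_intros)
  have "exp (nu * (?e - t)) * (\<integral>\<omega>. Z \<omega> * indicator (stay 0 L t ?e \<inter> surv 0) \<omega> \<partial>M)
    = exp (nu * (?e - t)) * (\<integral>\<omega>. (Z \<omega> * indicator (stay 0 L t ?e) \<omega>) * (tilt ?e \<omega> * exp (- al * X ?e \<omega>)) \<partial>M)"
  proof -
    have "stay 0 L t ?e \<inter> surv 0 = stay 0 L t ?e" by (auto simp: surv_0 stay_def)
    then show ?thesis by (simp flip: exp_add)
  qed
  also have "\<dots> = (\<integral>\<omega>. (Z \<omega> * indicator (X t -` {0..L} \<inter> space M) \<omega>) * (tilt t \<omega>
        * (LINT z:{0..L}|lborel. dker L (\<sigma>\<^sup>2 / 2 * (?e - t)) z (X t \<omega>) * exp (- al * z))) \<partial>M)"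
    by (rule stay_heat[OF t0 t(2) Z L c])
  also have "\<dots> = (\<integral>\<omega>. Z \<omega> * (tilt t \<omega>
          * (indicator {0..L} (X t \<omega>) * UB 0 (X t \<omega>) (clock t))) \<partial>M)"
    unfolding U_barrier_0[where tau=tau, OF L p_pos tau_n ct] clock_def[symmetric]
    by (intro Bochner_Integration.integral_cong) (auto simp: mult.commute split: split_indicator)
  finally have eq: "exp (nu * (?e - t)) * (\<integral>\<omega>. Z \<omega> * indicator (stay 0 L t ?e \<inter> surv 0) \<omega> \<partial>M)
    = (\<integral>\<omega>. Z \<omega> * (tilt t \<omega> * (indicator {0..L} (X t \<omega>) * UB 0 (X t \<omega>) (clock t))) \<partial>M)" .
  have "A = exp (- nu * (?e - t)) * (exp (nu * (?e - t)) * A)" for A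
    unfolding mult.assoc[symmetric] exp_add[symmetric] by simp
  then show ?thesis unfolding eq[symmetric] .
qed

text \<open>Survival of the rest of the current period becomes part of the weight, the free value is
  inserted at the end of the period, and \<open>stay_heat\<close> brings it back to
  \<open>t\<close>. The positive gap before the next period makes that datum continuous.\<close>

lemma value_barrier_Suc:
  assumes j: "Suc j < n"
    and IH: "\<And>t Z. 0 \<le> t \<Longrightarrow> t < T (n - Suc j) \<Longrightarrow> Z \<in> borel_measurable (F t) \<Longrightarrow> (\<And>\<omega>. 0 \<le> Z \<omega>) \<Longrightarrow> (\<And>\<omega>. Z \<omega> \<le> B) \<Longrightarrow>
      (\<integral>\<omega>. Z \<omega> * indicator (surv (Suc j)) \<omega> \<partial>M)
      = fwd t * (\<integral>\<omega>. Z \<omega> * (tilt t \<omega> * UF j (X t \<omega>) (clock t)) \<partial>M)"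
    and t: "T (n - Suc (Suc j)) \<le> t" "t < T (n - Suc (Suc j)) + P" and Z: "Z \<in> borel_measurable (F t)" "\<And>\<omega>. 0 \<le> Z \<omega>" "\<And>\<omega>. Z \<omega> \<le> B"
  shows "(\<integral>\<omega>. Z \<omega> * indicator (stay 0 L t (T (n - Suc (Suc j)) + P) \<inter> surv (Suc j)) \<omega> \<partial>M)
      = fwd t * (\<integral>\<omega>. Z \<omega> * (tilt t \<omega>
          * (indicator {0..L} (X t \<omega>) * UB (Suc j) (X t \<omega>) (clock t))) \<partial>M)"
proof -
  let ?e = "T (n - Suc (Suc j)) + P"
  have t0: "0 \<le> t" using T_pos[of "n - Suc (Suc j)"] n t by simp
  have e: "0 \<le> ?e" "?e < T (n - Suc j)" using t0 t T_gap[of "n - Suc (Suc j)" "n - Suc j"] j by auto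
  have B: "0 \<le> B" using Z(2,3) order_trans by blast
  have ce: "clock ?e = tau (n - Suc j)" using clock_at(2)[OF j] .
  have ct: "clock t > tau (n - Suc j)" unfolding ce[symmetric] clock_less using t by simp
  have ce': "tau (n - Suc j) > tau (n - j) + p"
    unfolding ce[symmetric] clock_at(1)[OF Suc_lessD[OF j], symmetric] clock_less using e by simp
  have c: "continuous_on UNIV (\<lambda>x. UF j x (tau (n - Suc j)))"
    by (rule continuous_U_free[where tau=tau, OF L p_pos tau_n ce'])
  \<comment> \<open>Survival up to \<open>?e\<close> is known at time \<open>?e\<close>, so the
    product is an admissible weight there.\<close>
  define Z' where "Z' \<omega> = Z \<omega> * indicator (stay 0 L t ?e) \<omega>" for \<omega>
  have [measurable]: "stay 0 L t ?e \<in> sets (F ?e)" by (rule stay_sets[OF t0 t(2)])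
  have [measurable]: "Z \<in> borel_measurable (F ?e)" by (rule measurable_F_mono[OF t0 _ Z(1)]) (use t in simp)
  have "(\<integral>\<omega>. Z \<omega> * indicator (stay 0 L t ?e \<inter> surv (Suc j)) \<omega> \<partial>M) = (\<integral>\<omega>. Z' \<omega> * indicator (surv (Suc j)) \<omega> \<partial>M)"
    by (rule Bochner_Integration.integral_cong) (auto simp: Z'_def split: split_indicator)
  also have "\<dots> = fwd ?e * (\<integral>\<omega>. Z' \<omega> * (tilt ?e \<omega> * UF j (X ?e \<omega>) (clock ?e)) \<partial>M)"
  proof (rule IH[OF e])
    show "Z' \<in> borel_measurable (F ?e)" unfolding Z'_def by measurable
    show "0 \<le> Z' \<omega>" "Z' \<omega> \<le> B" for \<omega> using Z(2,3)[of \<omega>] B by (auto simp: Z'_def split: split_indicator)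
  qed
  also have "(\<integral>\<omega>. Z' \<omega> * (tilt ?e \<omega> * UF j (X ?e \<omega>) (clock ?e)) \<partial>M)
    = exp (- nu * (?e - t)) * (exp (nu * (?e - t)) * (\<integral>\<omega>. (Z \<omega> * indicator (stay 0 L t ?e) \<omega>) * (tilt ?e \<omega> * UF j (X ?e \<omega>) (tau (n - Suc j))) \<partial>M))"
    unfolding mult.assoc[symmetric] exp_add[symmetric] ce Z'_def by simp
  also have "exp (nu * (?e - t)) * (\<integral>\<omega>. (Z \<omega> * indicator (stay 0 L t ?e) \<omega>) * (tilt ?e \<omega> * UF j (X ?e \<omega>) (tau (n - Suc j))) \<partial>M)
    = (\<integral>\<omega>. (Z \<omega> * indicator (X t -` {0..L} \<inter> space M) \<omega>) * (tilt t \<omega>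
        * (LINT z:{0..L}|lborel. dker L (\<sigma>\<^sup>2 / 2 * (?e - t)) z (X t \<omega>) * UF j z (tau (n - Suc j)))) \<partial>M)"
    by (rule stay_heat[OF t0 t(2) Z L c])
  also have "\<dots> = (\<integral>\<omega>. Z \<omega> * (tilt t \<omega>
          * (indicator {0..L} (X t \<omega>) * UB (Suc j) (X t \<omega>) (clock t))) \<partial>M)"
  proof -
    have eq: "clock t - tau (n - Suc j) = \<sigma>\<^sup>2 / 2 * (?e - t)" unfolding ce[symmetric] clock_diff ..
    show ?thesis
      unfolding U_barrier_Suc[where tau=tau, OF L p_pos tau_n ct] eq
      by (intro Bochner_Integration.integral_cong) (auto split: split_indicator)
  qed
  also have "fwd ?e * (exp (- nu * (?e - t)) * A) = fwd t * A" for A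
    unfolding mult.assoc[symmetric] exp_add[symmetric] by (simp add: algebra_simps)
  finally show ?thesis .
qed

text \<open>The induction alternates the two kinds of steps: level j, taken at the very start of its
  period, gives the free formula in the preceding gap, and this gives level j + 1.\<close>

lemma value_barrier:
  assumes "j < n" "T (n - Suc j) \<le> t" "t < T (n - Suc j) + P"
    and "Z \<in> borel_measurable (F t)" "\<And>\<omega>. 0 \<le> Z \<omega>" "\<And>\<omega>. Z \<omega> \<le> B"
  shows "(\<integral>\<omega>. Z \<omega> * indicator (stay 0 L t (T (n - Suc j) + P) \<inter> surv j) \<omega> \<partial>M)
      = fwd t * (\<integral>\<omega>. Z \<omega> * (tilt t \<omega>
          * (indicator {0..L} (X t \<omega>) * UB j (X t \<omega>) (clock t))) \<partial>M)"
  using assms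
proof (induction j arbitrary: t Z)
  case 0
  then show ?case using value_barrier_0[of t Z B] by simp
next
  case (Suc j)
  show ?case
  proof (rule value_barrier_Suc[OF Suc.prems(1) _ Suc.prems(2-6)])
    fix t Z assume *: "0 \<le> t" "t < T (n - Suc j)" "Z \<in> borel_measurable (F t)" "\<And>\<omega>. 0 \<le> Z \<omega>" "\<And>\<omega>. Z \<omega> \<le> B"
    show "(\<integral>\<omega>. Z \<omega> * indicator (surv (Suc j)) \<omega> \<partial>M)
      = fwd t * (\<integral>\<omega>. Z \<omega> * (tilt t \<omega> * UF j (X t \<omega>) (clock t)) \<partial>M)"
    proof (rule value_free_step[OF _ _ *])
      fix Z assume "Z \<in> borel_measurable (F (T (n - Suc j)))" "\<And>\<omega>. 0 \<le> Z \<omega>" "\<And>\<omega>. Z \<omega> \<le> B"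
      then show "(\<integral>\<omega>. Z \<omega> * indicator (stay 0 L (T (n - Suc j)) (T (n - Suc j) + P) \<inter> surv j) \<omega> \<partial>M)
      = fwd (T (n - Suc j)) * (\<integral>\<omega>. Z \<omega> * (tilt (T (n - Suc j)) \<omega>
          * (indicator {0..L} (X (T (n - Suc j)) \<omega>) * UB j (X (T (n - Suc j)) \<omega>) (clock (T (n - Suc j))))) \<partial>M)"
        using Suc.prems(1) P by (intro Suc.IH) auto
    qed (use Suc.prems in simp)
  qed
qed

lemma value_free:
  assumes j: "j < n" and t: "0 \<le> t" "t < T (n - Suc j)"
    and Z: "Z \<in> borel_measurable (F t)" "\<And>\<omega>. 0 \<le> Z \<omega>" "\<And>\<omega>. Z \<omega> \<le> B"
  shows "(\<integral>\<omega>. Z \<omega> * indicator (surv (Suc j)) \<omega> \<partial>M)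
      = fwd t * (\<integral>\<omega>. Z \<omega> * (tilt t \<omega> * UF j (X t \<omega>) (clock t)) \<partial>M)"
  by (rule value_free_step[OF j value_barrier[OF j] t Z]) (use P in auto)

section \<open>Reduction of the payoff on the surviving event\<close>

definition alive_at :: "real \<Rightarrow> 'a set" where
  "alive_at t = {\<omega> \<in> space M. \<forall>u\<in>{0..t} \<inter> (\<Union>i<n. {T i..T i + P}). X u \<omega> \<in> {0<..<L}}"

lemma alive_at_sets:
  assumes "0 \<le> t"
  shows "alive_at t \<in> sets (F t)"
proof -
  define I where "I = {i. i < n \<and> T i \<le> t}"
  have "finite I" by (simp add: I_def)
  \<comment> \<open>Only periods that have begun matter, each cut at \<open>t\<close>; a period that
    starts exactly at \<open>t\<close> leaves a single instant, hence the use of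
    \<open>stay_sets_le\<close>.\<close>
  have "alive_at t = {\<omega> \<in> space (F t). \<forall>i\<in>I. \<omega> \<in> stay 0 L (T i) (min t (T i + P))}"
  proof (intro equalityI subsetI)
    fix \<omega> assume *: "\<omega> \<in> alive_at t"
    have "\<omega> \<in> stay 0 L (T i) (min t (T i + P))" if "i \<in> I" for i
      using * that T_pos[of i] unfolding stay_def alive_at_def I_def by fastforce
    then show "\<omega> \<in> {\<omega> \<in> space (F t). \<forall>i\<in>I. \<omega> \<in> stay 0 L (T i) (min t (T i + P))}"
      using * space_F[OF assms] by (auto simp: alive_at_def)
  next
    fix \<omega> assume *: "\<omega> \<in> {\<omega> \<in> space (F t). \<forall>i\<in>I. \<omega> \<in> stay 0 L (T i) (min t (T i + P))}"
    have "X u \<omega> \<in> {0<..<L}" if "u \<in> {0..t}" "i < n" "u \<in> {T i..T i + P}" for u i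
    proof -
      have "i \<in> I" using that by (simp add: I_def)
      then have "\<omega> \<in> stay 0 L (T i) (min t (T i + P))" using * by blast
      then show ?thesis using that unfolding stay_def by force
    qed
    then show "\<omega> \<in> alive_at t" using * space_F[OF assms] by (auto simp: alive_at_def)
  qed
  also have "\<dots> \<in> sets (F t)"
  proof (rule sets.sets_Collect_finite_All[OF _ \<open>finite I\<close>])
    fix i assume i: "i \<in> I"
    then have T: "0 \<le> T i" "T i \<le> min t (T i + P)" using T_pos[of i] P by (auto simp: I_def)
    have "stay 0 L (T i) (min t (T i + P)) \<in> sets (F t)"
      using T by (intro sets_F_mono[OF _ _ stay_sets_le]) auto
    moreover have "{\<omega> \<in> space (F t). \<omega> \<in> stay 0 L (T i) (min t (T i + P))} = stay 0 L (T i) (min t (T i + P))"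
      using space_F[OF assms] by (auto simp: stay_def)
    ultimately show "{\<omega> \<in> space (F t). \<omega> \<in> stay 0 L (T i) (min t (T i + P))} \<in> sets (F t)" by simp
  qed
  finally show ?thesis .
qed

lemma alive_at_stay:
  assumes "\<omega> \<in> alive_at t" "i < n" "T i + P \<le> t"
  shows "\<omega> \<in> stay 0 L (T i) (T i + P)"
proof -
  have "X u \<omega> \<in> {0<..<L}" if "u \<in> {T i..T i + P}" for u
  proof -
    have "u \<in> {0..t} \<inter> (\<Union>i<n. {T i..T i + P})" using assms that T_pos[of i] by auto
    then show ?thesis using assms(1) unfolding alive_at_def by blast
  qed
  then show ?thesis using assms(1) by (auto simp: stay_def alive_at_def)
qed

text \<open>Earlier periods and the elapsed part of the current one are settled by the history, so
  the payoff reduces to the remainder of this period and the last \<open>j\<close> periods.\<close>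

lemma alive_at_barrier:
  assumes \<omega>: "\<omega> \<in> alive_at t" and j: "j < n" and t: "T (n - Suc j) \<le> t" "t < T (n - Suc j) + P"
  shows "X t \<omega> \<in> {0<..<L}"
    and "\<omega> \<in> surv n \<longleftrightarrow> \<omega> \<in> stay 0 L t (T (n - Suc j) + P) \<inter> surv j"
proof -
  let ?m = "n - Suc j"
  have m: "?m < n" using j by simp
  have al: "X u \<omega> \<in> {0<..<L}" if "u \<in> {T ?m..t}" for u
  proof -
    have "u \<in> {0..t} \<inter> (\<Union>i<n. {T i..T i + P})" using m that t T_pos[OF m] by force
    then show ?thesis using \<omega> unfolding alive_at_def by blast
  qed
  then show "X t \<omega> \<in> {0<..<L}" using t by simp
  have sp: "\<omega> \<in> space M" using \<omega> by (simp add: alive_at_def)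
  have e: "\<omega> \<in> stay 0 L (T i) (T i + P)" if "i < ?m" for i
    using that T_gap[of i ?m] m t by (intro alive_at_stay[OF \<omega>]) auto
  have s: "\<omega> \<in> stay 0 L (T ?m) (T ?m + P) \<longleftrightarrow> \<omega> \<in> stay 0 L t (T ?m + P)"
  proof
    assume "\<omega> \<in> stay 0 L (T ?m) (T ?m + P)"
    then show "\<omega> \<in> stay 0 L t (T ?m + P)" using t by (auto simp: stay_def)
  next
    assume *: "\<omega> \<in> stay 0 L t (T ?m + P)"
    have "X u \<omega> \<in> {0<..<L}" if "u \<in> {T ?m..T ?m + P}" for u
      using al[of u] that * by (cases "u \<le> t") (auto simp: stay_def)
    then show "\<omega> \<in> stay 0 L (T ?m) (T ?m + P)" using sp by (auto simp: stay_def)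
  qed
  have split: "{n - n..<n} = {..<?m} \<union> {?m} \<union> {n - j..<n}" using j by auto
  show "\<omega> \<in> surv n \<longleftrightarrow> \<omega> \<in> stay 0 L t (T ?m + P) \<inter> surv j"
    unfolding surv_def split using e s sp by auto
qed

lemma alive_at_free:
  assumes \<omega>: "\<omega> \<in> alive_at t" and j: "j < n" and t: "Suc j = n \<or> T (n - Suc (Suc j)) + P < t"
  shows "\<omega> \<in> surv n \<longleftrightarrow> \<omega> \<in> surv (Suc j)"
proof -
  have sp: "\<omega> \<in> space M" using \<omega> by (simp add: alive_at_def)
  have e: "\<omega> \<in> stay 0 L (T i) (T i + P)" if "i < n - Suc j" for i
  proof (rule alive_at_stay[OF \<omega>])
    have t': "T (n - Suc (Suc j)) + P < t" using that t by auto
    show "T i + P \<le> t"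
    proof (cases "i = n - Suc (Suc j)")
      case False
      then have "i < n - Suc (Suc j)" using that by linarith
      then have "T i + P < T (n - Suc (Suc j))" using j by (intro T_gap) auto
      then show ?thesis using t' P by linarith
    qed (use t' in simp)
  qed (use that in simp)
  have split: "{n - n..<n} = {..<n - Suc j} \<union> {n - Suc j..<n}" by auto
  show ?thesis unfolding surv_def split using e sp by auto
qed

lemma cond_exp_barrier:
  assumes Y: "\<And>\<omega>. \<omega> \<in> space M \<Longrightarrow> Y \<omega> = indicator (surv n) \<omega>"
    and j: "j < n" and t: "T (n - Suc j) \<le> t" "t < T (n - Suc j) + P"
  shows "AE \<omega> in M. \<omega> \<in> alive_at t \<longrightarrow>
    real_cond_exp M (F t) Y \<omega> = fwd t * (tilt t \<omega> * UB j (X t \<omega>) (clock t))"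
proof -
  have t0: "0 \<le> t" using T_pos[of "n - Suc j"] j t by simp
  have ct: "clock t > tau (n - j)" unfolding clock_at(2)[OF j, symmetric] clock_less using t by simp
  note measurable_U_barrier[where tau=tau, OF L p_pos ct tau_n, of al, measurable]
  obtain C where C: "\<And>x. \<bar>UB j x (clock t)\<bar> \<le> C"
    using U_barrier_bounded[where tau=tau, OF L p_pos ct tau_n] by blast
  have C0: "0 \<le> C" using C[of 0] abs_ge_zero order_trans by blast
  have Xm [measurable]: "X t \<in> borel_measurable (F t)" by (rule measurable_X[OF t0])
  have A [measurable]: "alive_at t \<in> sets (F t)" by (rule alive_at_sets[OF t0])
  \<comment> \<open>The extra indicator makes \<open>g\<close> bounded despite the tilt; it equals 1
    on the event in question and is removed at the end.\<close>
  define g where "g \<omega> = fwd t * (tilt t \<omega>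
      * (indicator {0..L} (X t \<omega>) * UB j (X t \<omega>) (clock t)))" for \<omega>
  have gm [measurable]: "g \<in> borel_measurable (F t)" unfolding g_def by measurable
  have gb: "\<bar>g \<omega>\<bar> \<le> fwd t * (exp (\<bar>al\<bar> * (\<bar>0\<bar> + \<bar>L\<bar>)) * C)" for \<omega>
  proof (cases "X t \<omega> \<in> {0..L}")
    case True
    then show ?thesis unfolding g_def abs_mult
      using exp_strip_bound[OF True, of al] C C0 by (intro mult_mono) auto
  qed (use C0 in \<open>simp add: g_def\<close>)
  have "AE \<omega> in M. \<omega> \<in> alive_at t \<longrightarrow> real_cond_exp M (F t) Y \<omega> = g \<omega>"
  proof (rule cond_exp_on_event[OF t0 A surv_sets[of n] Y gm])
    have "(\<lambda>\<omega>. indicator (alive_at t) \<omega> * g \<omega>) \<in> borel_measurable M"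
      by (rule measurable_F_M[OF t0]) measurable
    then show "integrable M (\<lambda>\<omega>. indicator (alive_at t) \<omega> * g \<omega>)"
      by (rule integrable_bounded) (use gb in \<open>auto simp: abs_mult split: split_indicator intro: order_trans[OF abs_ge_zero]\<close>)
    fix D assume D [measurable]: "D \<in> sets (F t)"
    let ?Z = "indicator (D \<inter> alive_at t) :: 'a \<Rightarrow> real"
    have Z: "?Z \<in> borel_measurable (F t)" by measurable
    have "(\<integral>\<omega>. ?Z \<omega> * indicator (surv n) \<omega> \<partial>M) = (\<integral>\<omega>. ?Z \<omega> * indicator (stay 0 L t (T (n - Suc j) + P) \<inter> surv j) \<omega> \<partial>M)"
      using alive_at_barrier(2)[OF _ j t]
      by (intro Bochner_Integration.integral_cong refl) (simp add: indicator_def)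
    also have "\<dots> = fwd t * (\<integral>\<omega>. ?Z \<omega> * (tilt t \<omega>
          * (indicator {0..L} (X t \<omega>) * UB j (X t \<omega>) (clock t))) \<partial>M)"
      by (rule value_barrier[OF j t Z, where B=1]) (auto split: split_indicator)
    also have "\<dots> = (\<integral>\<omega>. ?Z \<omega> * g \<omega> \<partial>M)"
      unfolding integral_mult_right_zero[symmetric] g_def by (simp only: mult.left_commute)
    finally show "(\<integral>\<omega>. ?Z \<omega> * indicator (surv n) \<omega> \<partial>M) = (\<integral>\<omega>. ?Z \<omega> * g \<omega> \<partial>M)" .
  qed
  then show ?thesis
  proof eventually_elim
    fix \<omega> assume *: "\<omega> \<in> alive_at t \<longrightarrow> real_cond_exp M (F t) Y \<omega> = g \<omega>"
    show "\<omega> \<in> alive_at t \<longrightarrow>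
      real_cond_exp M (F t) Y \<omega> = fwd t * (tilt t \<omega> * UB j (X t \<omega>) (clock t))"
    proof
      assume al: "\<omega> \<in> alive_at t"
      have "X t \<omega> \<in> {0..L}" using alive_at_barrier(1)[OF al j t] by auto
      then show "real_cond_exp M (F t) Y \<omega> = fwd t * (tilt t \<omega> * UB j (X t \<omega>) (clock t))"
        using * al by (simp add: g_def)
    qed
  qed
qed

text \<open>In a gap the position is unrestricted and the tilt unbounded. Undoing the removal of the
  drift writes the tilted value as a Gaussian average of a function supported in
  \<open>[0, L]\<close>, hence bounded.\<close>

lemma exp_U_free_bounded:
  assumes j: "j < n" and t: "t < T (n - Suc j)"
  obtains C where "\<And>x. \<bar>exp (al * x) * UF j x (clock t)\<bar> \<le> C"
proof -
  let ?s = "T (n - Suc j)" and ?c = "tau (n - j) + p"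
  define d where "d = ?s - t"
  define f where "f x = indicator {0..L} x * UB j x ?c" for x
  have d: "d > 0" using t by (simp add: d_def)
  have c: "?c > tau (n - j)" using p_pos by simp
  obtain C where C: "\<And>x. \<bar>UB j x ?c\<bar> \<le> C"
    using U_barrier_bounded[where tau=tau, OF L p_pos c tau_n] by blast
  have C0: "0 \<le> C" using C[of 0] abs_ge_zero order_trans by blast
  define K where "K = exp (\<bar>al\<bar> * (\<bar>0\<bar> + \<bar>L\<bar>)) * C"
  have K0: "0 \<le> K" using C0 by (simp add: K_def)
  have fb: "\<bar>exp (al * x) * f x\<bar> \<le> K" for x
    using exp_strip_bound[of x 0 L al] C[of x] C0
    by (cases "x \<in> {0..L}") (auto simp: f_def K_def abs_mult intro!: mult_mono)
  have ct: "clock t - ?c = \<sigma>\<^sup>2 / 2 * d" using clock_at(1)[OF j] clock_diff[of t ?s] by (simp add: d_def)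
  have ct': "clock t > ?c" using clock_less[of ?s t] clock_at(1)[OF j] t by simp
  have "\<bar>exp (al * x) * UF j x (clock t)\<bar> \<le> exp (nu * d) * K" for x
  proof -
    have eq: "exp (- nu * d) * (exp (al * x) * UF j x (clock t))
      = (\<integral>z. normal_density 0 (sqrt d) z * (exp (al * (x + \<mu> * d + \<sigma> * z)) * f (x + \<mu> * d + \<sigma> * z)) \<partial>lborel)"
      unfolding U_free_normal[where tau=tau, OF L p_pos tau_n ct'] ct
      using normal_integral_drift[OF sigma d, of \<mu> x f] by (simp add: al_def nu_def f_def)
    have "\<bar>\<dots>\<bar> \<le> (\<integral>z. normal_density 0 (sqrt d) z * K \<partial>lborel)"
    proof (rule abs_integral_le_of_bound)
      show "integrable lborel (\<lambda>z. normal_density 0 (sqrt d) z * K)" using d by simp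
      show "\<bar>normal_density 0 (sqrt d) z * (exp (al * (x + \<mu> * d + \<sigma> * z)) * f (x + \<mu> * d + \<sigma> * z))\<bar> \<le> normal_density 0 (sqrt d) z * K" for z
        unfolding abs_mult[of "normal_density 0 (sqrt d) z"] using fb by (simp add: mult_left_mono)
    qed
    also have "\<dots> = K" using d by simp
    finally have "exp (- nu * d) * \<bar>exp (al * x) * UF j x (clock t)\<bar> \<le> K"
      unfolding eq[symmetric] by (simp add: abs_mult)
    then show ?thesis by (simp add: exp_minus field_simps)
  qed
  then show thesis by (rule that)
qed

lemma cond_exp_free:
  assumes Y: "\<And>\<omega>. \<omega> \<in> space M \<Longrightarrow> Y \<omega> = indicator (surv n) \<omega>"
    and j: "j < n" and t: "0 \<le> t" "t < T (n - Suc j)" "Suc j = n \<or> T (n - Suc (Suc j)) + P < t"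
  shows "AE \<omega> in M. \<omega> \<in> alive_at t \<longrightarrow>
    real_cond_exp M (F t) Y \<omega> = fwd t * (tilt t \<omega> * UF j (X t \<omega>) (clock t))"
proof -
  have ct: "clock t > tau (n - j) + p" using clock_less[of "T (n - Suc j)" t] clock_at(1)[OF j] t by simp
  have [measurable]: "(\<lambda>x. UF j x (clock t)) \<in> borel_measurable borel"
    by (rule borel_measurable_continuous_onI, rule continuous_U_free[where tau=tau, OF L p_pos tau_n ct])
  obtain C where C: "\<And>x. \<bar>exp (al * x) * UF j x (clock t)\<bar> \<le> C"
    using exp_U_free_bounded[OF j t(2)] by blast
  have Xm [measurable]: "X t \<in> borel_measurable (F t)" by (rule measurable_X[OF t(1)])
  have A [measurable]: "alive_at t \<in> sets (F t)" by (rule alive_at_sets[OF t(1)])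
  define g where "g \<omega> = fwd t * (tilt t \<omega> * UF j (X t \<omega>) (clock t))" for \<omega>
  have gm [measurable]: "g \<in> borel_measurable (F t)" unfolding g_def by measurable
  have gb: "\<bar>g \<omega>\<bar> \<le> fwd t * C" for \<omega>
    unfolding g_def abs_mult[of "fwd t"] using C by (simp add: mult_left_mono)
  have "AE \<omega> in M. \<omega> \<in> alive_at t \<longrightarrow> real_cond_exp M (F t) Y \<omega> = g \<omega>"
  proof (rule cond_exp_on_event[OF t(1) A surv_sets[of n] Y gm])
    have "(\<lambda>\<omega>. indicator (alive_at t) \<omega> * g \<omega>) \<in> borel_measurable M"
      by (rule measurable_F_M[OF t(1)]) measurable
    then show "integrable M (\<lambda>\<omega>. indicator (alive_at t) \<omega> * g \<omega>)"
      by (rule integrable_bounded) (use gb order_trans[OF abs_ge_zero gb] in \<open>auto simp: abs_mult split: split_indicator\<close>)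
    fix D assume D [measurable]: "D \<in> sets (F t)"
    let ?Z = "indicator (D \<inter> alive_at t) :: 'a \<Rightarrow> real"
    have Z: "?Z \<in> borel_measurable (F t)" by measurable
    have "(\<integral>\<omega>. ?Z \<omega> * indicator (surv n) \<omega> \<partial>M) = (\<integral>\<omega>. ?Z \<omega> * indicator (surv (Suc j)) \<omega> \<partial>M)"
      using alive_at_free[OF _ j t(3)]
      by (intro Bochner_Integration.integral_cong refl) (simp add: indicator_def)
    also have "\<dots> = fwd t * (\<integral>\<omega>. ?Z \<omega> * (tilt t \<omega> * UF j (X t \<omega>) (clock t)) \<partial>M)"
      by (rule value_free[OF j t(1,2) Z, where B=1]) (auto split: split_indicator)
    also have "\<dots> = (\<integral>\<omega>. ?Z \<omega> * g \<omega> \<partial>M)"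
      unfolding integral_mult_right_zero[symmetric] g_def by (simp only: mult.left_commute)
    finally show "(\<integral>\<omega>. ?Z \<omega> * indicator (surv n) \<omega> \<partial>M) = (\<integral>\<omega>. ?Z \<omega> * g \<omega> \<partial>M)" .
  qed
  then show ?thesis unfolding g_def .
qed

end

text \<open>The strict inequality \<open>tau (n - j) < tauof t\<close> keeps \<open>t\<close> before
  the end of the barrier period: at that end the kernel would run for time zero, where its series
  does not converge in general.\<close>

theorem theorem3p1:
  fixes M :: "'a measure" and F :: "real \<Rightarrow> 'a measure" and W :: "real \<Rightarrow> 'a \<Rightarrow> real"
    and r \<sigma> S0 P Blow Bup :: real and n :: nat and T :: "nat \<Rightarrow> real"
  assumes BM: "std_BM M F W"
    and r: "r > 0" and sig: "\<sigma> > 0" and S0: "S0 > 0"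
    and n: "n \<ge> 1"
    and T0: "0 < T 0" and Tinc: "\<And>i. Suc i < n \<Longrightarrow> T i < T (Suc i)"
    and P: "P > 0" and TP: "\<And>i. 1 \<le> i \<Longrightarrow> i \<le> n - 1 \<Longrightarrow> T (i - 1) + P < T i"
    and B: "0 < Blow" "Blow < Bup"
  defines "L \<equiv> ln (Bup / Blow)"
    and "p \<equiv> \<sigma>\<^sup>2 / 2 * P"
    and "\<alpha> \<equiv> - (1/2) * (2 * r / \<sigma>\<^sup>2 - 1)"
    and "\<beta> \<equiv> - 2 * r / \<sigma>\<^sup>2 - (- (1/2) * (2 * r / \<sigma>\<^sup>2 - 1))\<^sup>2"
    and "tau \<equiv> (\<lambda>i. \<sigma>\<^sup>2 / 2 * (T (n - 1) - T (i - 1)))"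
    and "V \<equiv> (\<lambda>t \<omega>. exp (- r * (T (n - 1) + P - t)) * real_cond_exp M (F t) (payoff (gbm S0 r \<sigma> W) n T P Blow Bup) \<omega>)"
    and "xof \<equiv> (\<lambda>t \<omega>. ln (gbm S0 r \<sigma> W t \<omega> / Blow))"
    and "tauof \<equiv> (\<lambda>t. \<sigma>\<^sup>2 / 2 * (T (n - 1) + P - t))"
  shows
    "(\<forall>j<n. \<forall>t\<ge>0. tau (n - j) < tauof t \<and> tauof t \<le> tau (n - j) + p \<longrightarrow>
        (AE \<omega> in M. \<omega> \<in> alive M (gbm S0 r \<sigma> W) n T P Blow Bup t \<longrightarrow>
           V t \<omega> = exp (\<alpha> * xof t \<omega> + \<beta> * tauof t) * U_barrier L \<alpha> p tau n j (xof t \<omega>) (tauof t)))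
   \<and> (\<forall>j<n. \<forall>t\<ge>0. tau (n - j) + p < tauof t \<and> (Suc j = n \<or> tauof t < tau (n - Suc j)) \<longrightarrow>
        (AE \<omega> in M. \<omega> \<in> alive M (gbm S0 r \<sigma> W) n T P Blow Bup t \<longrightarrow>
           V t \<omega> = exp (\<alpha> * xof t \<omega> + \<beta> * tauof t) * U_free L \<alpha> p tau n j (xof t \<omega>) (tauof t)))"
proof -
  define \<mu> where "\<mu> = r - \<sigma>\<^sup>2 / 2"
  define x0 where "x0 = ln (S0 / Blow)"
  have L: "0 < L" using B by (simp add: L_def)
  have gap: "T i + P < T (Suc i)" if "Suc i < n" for i using TP[of "Suc i"] that by simp
  interpret bp: barrier_periods M F W x0 \<mu> \<sigma> L P n T
    by unfold_locales (use BM sig L P n T0 gap in auto)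
  have X: "xof t \<omega> = bp.X t \<omega>" for t \<omega>
    unfolding xof_def gbm_def bp.X_def unfolding x0_def \<mu>_def using B S0 by (simp add: ln_mult ln_div algebra_simps)
  have inside: "Blow < gbm S0 r \<sigma> W u \<omega> \<and> gbm S0 r \<sigma> W u \<omega> < Bup \<longleftrightarrow> bp.X u \<omega> \<in> {0<..<L}" for u \<omega>
  proof -
    have g: "gbm S0 r \<sigma> W u \<omega> > 0" using S0 by (simp add: gbm_def)
    have "bp.X u \<omega> = ln (gbm S0 r \<sigma> W u \<omega>) - ln Blow" using X[of u \<omega>] g B by (simp add: xof_def ln_div)
    moreover have "L = ln Bup - ln Blow" using B by (simp add: L_def ln_div)
    moreover have "Blow < gbm S0 r \<sigma> W u \<omega> \<longleftrightarrow> ln Blow < ln (gbm S0 r \<sigma> W u \<omega>)"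
      "gbm S0 r \<sigma> W u \<omega> < Bup \<longleftrightarrow> ln (gbm S0 r \<sigma> W u \<omega>) < ln Bup" using g B by simp_all
    ultimately show ?thesis by auto
  qed
  \<comment> \<open>The product over periods 1 to n is reindexed to 0 to n - 1, and a product of
    indicators is the indicator of joint survival.\<close>
  have pay: "payoff (gbm S0 r \<sigma> W) n T P Blow Bup \<omega> = indicator (bp.surv n) \<omega>" if "\<omega> \<in> space M" for \<omega>
  proof -
    have "payoff (gbm S0 r \<sigma> W) n T P Blow Bup \<omega> = (\<Prod>i\<in>{1..n}. if \<omega> \<in> bp.stay 0 L (T (i - 1)) (T (i - 1) + P) then 1 else 0)"
      unfolding payoff_def by (rule prod.cong) (use that inside in \<open>auto simp: indicator_def bp.stay_def\<close>)
    also have "\<dots> = (\<Prod>i\<in>{..<n}. if \<omega> \<in> bp.stay 0 L (T i) (T i + P) then 1 else 0)"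
      by (rule prod.reindex_bij_witness[of _ Suc "\<lambda>i. i - 1"]) auto
    also have "\<dots> = indicator (bp.surv n) \<omega>"
      using that by (auto simp: indicator_def bp.surv_def)
    finally show ?thesis .
  qed
  have alive: "alive M (gbm S0 r \<sigma> W) n T P Blow Bup t = bp.alive_at t" for t
    unfolding alive_def bp.alive_at_def inside ..
  have al: "bp.al = \<alpha>" unfolding bp.al_def unfolding \<alpha>_def \<mu>_def using sig by (simp add: field_simps)
  have tau: "bp.tau = tau" by (simp add: fun_eq_iff bp.tau_def tau_def)
  have p: "bp.p = p" by (simp add: bp.p_def p_def)
  have clock: "bp.clock = tauof" by (simp add: fun_eq_iff bp.clock_def tauof_def)
  \<comment> \<open>\<beta> combines the discount rate with the tilt rate: \<alpha>^2 sigma^2/2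
    equals nu, so \<beta> sigma^2/2 = - r - nu.\<close>
  have disc: "exp (- r * (T (n - 1) + P - t)) * (exp (- bp.nu * (T (n - 1) + P - t)) * (exp (\<alpha> * x) * u))
      = exp (\<alpha> * x + \<beta> * tauof t) * u" for t x u
  proof -
    have "\<beta> * (\<sigma>\<^sup>2 / 2) = - r - bp.nu"
      unfolding bp.nu_def unfolding \<beta>_def \<mu>_def using sig by (simp add: power2_eq_square field_simps)
    then have "\<beta> * tauof t = (- r - bp.nu) * (T (n - 1) + P - t)"
      unfolding tauof_def mult.assoc[symmetric] by simp
    then have "- r * (T (n - 1) + P - t) + (- bp.nu * (T (n - 1) + P - t) + \<alpha> * x) = \<alpha> * x + \<beta> * tauof t"
      by (simp add: algebra_simps)
    then show ?thesis unfolding mult.assoc[symmetric] exp_add[symmetric] by (simp add: add.assoc)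
  qed
  let ?Y = "payoff (gbm S0 r \<sigma> W) n T P Blow Bup"
  show ?thesis
  proof (intro conjI allI impI)
    fix j t assume j: "j < n" and t: "0 \<le> t" and *: "tau (n - j) < tauof t \<and> tauof t \<le> tau (n - j) + p"
    \<comment> \<open>The clock runs backwards, so bounds on \<open>tauof t\<close> become bounds on
      \<open>t\<close> in the opposite order.\<close>
    have t': "T (n - Suc j) \<le> t" "t < T (n - Suc j) + P"
      using * bp.clock_less[of "T (n - Suc j)" t] bp.clock_less[of "T (n - Suc j) + P" t]
        bp.clock_at[OF j] unfolding tau p clock by auto
    have "AE \<omega> in M. \<omega> \<in> bp.alive_at t \<longrightarrow> real_cond_exp M (F t) ?Y \<omega>
        = exp (- bp.nu * (T (n - 1) + P - t)) * (exp (bp.al * bp.X t \<omega>) * U_barrier L bp.al bp.p bp.tau n j (bp.X t \<omega>) (bp.clock t))"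
      by (rule bp.cond_exp_barrier[OF _ j t']) (rule pay)
    then show "AE \<omega> in M. \<omega> \<in> alive M (gbm S0 r \<sigma> W) n T P Blow Bup t \<longrightarrow>
           V t \<omega> = exp (\<alpha> * xof t \<omega> + \<beta> * tauof t) * U_barrier L \<alpha> p tau n j (xof t \<omega>) (tauof t)"
      unfolding alive al tau p clock X V_def disc[symmetric] by eventually_elim auto
  next
    fix j t assume j: "j < n" and t: "0 \<le> t"
      and *: "tau (n - j) + p < tauof t \<and> (Suc j = n \<or> tauof t < tau (n - Suc j))"
    have 1: "t < T (n - Suc j)"
      using * bp.clock_less[of "T (n - Suc j)" t] bp.clock_at(1)[OF j] unfolding tau p clock by simp
    \<comment> \<open>If \<open>Suc j = n\<close> no period precedes the gap, and
      \<open>n - Suc (Suc j)\<close> would be a truncated difference; hence the case split.\<close>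
    have 2: "Suc j = n \<or> T (n - Suc (Suc j)) + P < t"
      using * bp.clock_less[of t "T (n - Suc (Suc j)) + P"] bp.clock_at(2)[of "Suc j"] j unfolding tau clock
      by (cases "Suc j = n") auto
    have "AE \<omega> in M. \<omega> \<in> bp.alive_at t \<longrightarrow> real_cond_exp M (F t) ?Y \<omega>
        = exp (- bp.nu * (T (n - 1) + P - t)) * (exp (bp.al * bp.X t \<omega>) * U_free L bp.al bp.p bp.tau n j (bp.X t \<omega>) (bp.clock t))"
      by (rule bp.cond_exp_free[OF _ j t 1 2]) (rule pay)
    then show "AE \<omega> in M. \<omega> \<in> alive M (gbm S0 r \<sigma> W) n T P Blow Bup t \<longrightarrow>
           V t \<omega> = exp (\<alpha> * xof t \<omega> + \<beta> * tauof t) * U_free L \<alpha> p tau n j (xof t \<omega>) (tauof t)"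
      unfolding alive al tau p clock X V_def disc[symmetric] by eventually_elim auto
  qed
qed

end
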